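(* Let $\alpha\in\mathbb{T}$ be irrational with bounded partial quotients, let $-1<\gamma<0$ and $r>0$, and let $f(x)=x^{\gamma}+r$ for $x\in(0,1)$, viewed as a function on $\mathbb{T}\setminus\{0\}$. Then the special flow $(T^f_t)_{t\in\mathbb{R}}$ above the circle rotation $R_\alpha$ and under the ceiling function $f$ does not have the WR-property.
   Context: $\mathbb{T}=\mathbb{R}/\mathbb{Z}$ is identified with $[0,1)$, with Lebesgue (Haar) measure $\lambda$ and metric $\|x-y\|$ (distance to the nearest integer); $R_\alpha x=x+\alpha$. Special flow: let $T$ be an automorphism of $(X,\mathscr{B},\mu)$, and let $f>0$, $f\in L^1(X,\mu)$. The special flow $(T^f_t)_{t\in\mathbb{R}}$ above $T$ and under $f$ acts on $X^f=\{(x,s): x\in X,\ 0\le s<f(x)\}$ (equivalently on $X\times\mathbb{R}$ modulo $(x,s+f(x))\sim(Tx,s)$) by $T^f_t(x,s)=(T^nx,\,t+s-f^{(n)}(x))$, where $n\in\mathbb{Z}$ is the unique integer with $f^{(n)}(x)\le t+s<f^{(n+1)}(x)$. Here $f^{(n)}(x)=f(x)+\dots+f(T^{n-1}x)$ for $n>0$, $f^{(0)}=0$, and $f^{(n)}(x)=-(f(T^nx)+\dots+f(T^{-1}x))$ for $n<0$. It preserves the normalized restriction of $\mu\otimes$Lebesgue to $X^f$. If $(X,d)$ is a metric space, $X^f$ carries the metric $d^f((x,s),(x',s'))=d(x,x')+|s-s'|$. The value of $f$ at its singularity is irrelevant (null set). WR-property: let $(T_t)_{t\in\mathbb{R}}$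 be an ergodic flow on a standard Borel probability space $(X,\mathscr{B},\mu)$, with $X$ a metric space with metric $d$. Let $P\subset\mathbb{R}\setminus\{0\}$ be compact and $t_0\in\mathbb{R}$. The flow has the $R(t_0,P)$-property if for every $\epsilon>0$ and $N\in\mathbb{N}$ there exist $\kappa=\kappa(\epsilon)>0$, $\delta=\delta(\epsilon,N)>0$ and $Z=Z(\epsilon,N)\in\mathscr{B}$ with $\mu(Z)>1-\epsilon$ such that for any $x,y\in Z$ with $d(x,y)<\delta$ and $x$ not in the orbit of $y$, there exist $M,L\in\mathbb{N}$ with $M,L>N$ and $L/M\ge\kappa$, and $p\in P$, such that $$\frac1L\big|\{n\in[M,M+L]\cap\mathbb{Z}: d(T_{nt_0}(x),T_{nt_0+p}(y))<\epsilon\}\big|>1-\epsilon .$$ The flow has the WR-property if for some compact $P\subset\mathbb{R}\setminus\{0\}$ the set of $t_0\in\mathbb{R}$ such that the flow has the $R(t_0,P)$-property is uncountable. *)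

theory Defs
  imports "HOL-Analysis.Analysis"
begin

subsection \<open>Continued fractions\<close>

primrec complete_quotient :: "real \<Rightarrow> nat \<Rightarrow> real" where
  "complete_quotient x 0 = x"
| "complete_quotient x (Suc n) = 1 / frac (complete_quotient x n)"

definition partial_quotient :: "real \<Rightarrow> nat \<Rightarrow> int" where
  "partial_quotient x n = \<lfloor>complete_quotient x n\<rfloor>"

definition bounded_partial_quotients :: "real \<Rightarrow> bool" where
  "bounded_partial_quotients x \<longleftrightarrow> bdd_above (range (partial_quotient x))"


subsection \<open>The circle, represented by \<open>[0,1)\<close>\<close>

definition circle :: "real measure" where
  "circle = restrict_space lborel {0..<1}"

definition circle_dist :: "real \<Rightarrow> real \<Rightarrow> real" where
  "circle_dist x y = \<bar>(x - y) - of_int (round (x - y))\<bar>"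

definition rotation :: "real \<Rightarrow> real \<Rightarrow> real" where
  "rotation \<alpha> x = frac (x + \<alpha>)"


subsection \<open>Special flows\<close>

text \<open>In this subsection \<open>T\<close> is meant to be an automorphism of \<open>M\<close>, in particular a bijection
  of \<open>space M\<close>; negative iterates use its inverse on \<open>space M\<close>.\<close>

definition int_iterate :: "'a measure \<Rightarrow> ('a \<Rightarrow> 'a) \<Rightarrow> int \<Rightarrow> 'a \<Rightarrow> 'a" where
  "int_iterate M T n x =
    (if n \<ge> 0 then (T ^^ nat n) x else (inv_into (space M) T ^^ nat (- n)) x)"

definition cocycle :: "'a measure \<Rightarrow> ('a \<Rightarrow> 'a) \<Rightarrow> ('a \<Rightarrow> real) \<Rightarrow> int \<Rightarrow> 'a \<Rightarrow> real" where
  "cocycle M T f n x =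
    (if n \<ge> 0 then \<Sum>k\<in>{0..<n}. f (int_iterate M T k x)
     else - (\<Sum>k\<in>{n..<0}. f (int_iterate M T k x)))"

definition flow_space :: "'a measure \<Rightarrow> ('a \<Rightarrow> real) \<Rightarrow> ('a \<times> real) set" where
  "flow_space M f = {(x, s). x \<in> space M \<and> 0 \<le> s \<and> s < f x}"

definition flow_measure :: "'a measure \<Rightarrow> ('a \<Rightarrow> real) \<Rightarrow> ('a \<times> real) measure" where
  "flow_measure M f =
    uniform_measure (restrict_space (M \<Otimes>\<^sub>M lborel) (flow_space M f)) (flow_space M f)"

definition flow_dist :: "('a \<Rightarrow> 'a \<Rightarrow> real) \<Rightarrow> 'a \<times> real \<Rightarrow> 'a \<times> real \<Rightarrow> real" where
  "flow_dist d p q = d (fst p) (fst q) + \<bar>snd p - snd q\<bar>"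

definition special_flow ::
  "'a measure \<Rightarrow> ('a \<Rightarrow> 'a) \<Rightarrow> ('a \<Rightarrow> real) \<Rightarrow> real \<Rightarrow> 'a \<times> real \<Rightarrow> 'a \<times> real" where
  "special_flow M T f t = (\<lambda>(x, s).
    let n = (THE n. cocycle M T f n x \<le> t + s \<and> t + s < cocycle M T f (n + 1) x)
    in (int_iterate M T n x, t + s - cocycle M T f n x))"


subsection \<open>The WR-property\<close>

text \<open>Here \<open>T\<close> is meant to be an ergodic flow on the probability space \<open>M\<close>, and \<open>d\<close> a metric on
  \<open>space M\<close>; these standing assumptions are not part of the predicates. Note that \<open>\<kappa>\<close> depends
  on \<open>\<epsilon>\<close> only, whereas \<open>\<delta>\<close> and \<open>Z\<close> may depend on both \<open>\<epsilon>\<close> and \<open>N\<close>.\<close>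

definition R_property ::
  "'a measure \<Rightarrow> ('a \<Rightarrow> 'a \<Rightarrow> real) \<Rightarrow> (real \<Rightarrow> 'a \<Rightarrow> 'a) \<Rightarrow> real \<Rightarrow> real set \<Rightarrow> bool" where
  "R_property M d T t0 P \<longleftrightarrow>
    (\<forall>\<epsilon>>0. \<exists>\<kappa>>0. \<forall>N::nat. \<exists>\<delta>>0. \<exists>Z\<in>sets M. measure M Z > 1 - \<epsilon> \<and>
      (\<forall>x\<in>Z. \<forall>y\<in>Z. d x y < \<delta> \<and> x \<notin> range (\<lambda>t. T t y) \<longrightarrow>
        (\<exists>K L::nat. \<exists>p\<in>P. K > N \<and> L > N \<and> real L / real K \<ge> \<kappa> \<and>
          real (card {n \<in> {K..K + L}. d (T (real n * t0) x) (T (real n * t0 + p) y) < \<epsilon>}) / real L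
            > 1 - \<epsilon>)))"

definition WR_property ::
  "'a measure \<Rightarrow> ('a \<Rightarrow> 'a \<Rightarrow> real) \<Rightarrow> (real \<Rightarrow> 'a \<Rightarrow> 'a) \<Rightarrow> bool" where
  "WR_property M d T \<longleftrightarrow>
    (\<exists>P. compact P \<and> 0 \<notin> P \<and> uncountable {t0. R_property M d T t0 P})"

end

theory Submission
  imports Defs
begin

text \<open>
  Two points of the flow that start at the same height over \<open>x\<close> and \<open>x + \<delta>\<close> and move side by side
  stay close only while the Birkhoff sums of \<open>f\<close> at the two base points differ by about the time shift \<open>p\<close>.
  The ceiling is strictly decreasing on the circle minus its singularity, so the difference of these sums, the
  \<^emph>\<open>drift\<close>, is monotone until the singularity separates the two orbits, and after \<open>n\<close> steps it is at
  least of order \<open>\<delta> * n powr (1 - \<gamma>)\<close>, because for \<open>\<alpha>\<close> of bounded type \<open>n\<close> consecutive orbit points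
  include one within distance \<open>O(1 / n)\<close> to the right of the singularity. As \<open>1 - \<gamma> > 1\<close>, it reaches
  order one at the time \<open>\<delta> powr (- \<beta>)\<close> with \<open>\<beta> = 1 / (1 - \<gamma>) < 1\<close>, whereas separations are at least of
  order \<open>1 / \<delta>\<close> steps apart. Fix \<open>t0 \<noteq> 0\<close> and a compact \<open>P\<close> avoiding \<open>0\<close>. For small \<open>\<epsilon>\<close>
  the property fails for two reasons, according to the length \<open>L\<close> of the window.

  \<^bold>\<open>Long windows.\<close> At a time at which the two flow points are \<open>\<epsilon>\<close>-close, their base points are
  \<open>x + m * \<alpha>\<close> and \<open>y + m' * \<alpha>\<close>; the \<^emph>\<open>gap\<close> \<open>\<eta>\<close> between them, the distance of \<open>x - y + (m - m') * \<alpha>\<close> to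
  the integers, is below \<open>\<epsilon>\<close>. Two close times with gaps at most \<open>w\<close> and different shifts \<open>m - m'\<close> lie
  at least of order \<open>1 / w\<close> apart, because \<open>\<alpha>\<close> is badly approximable (\<open>shift_eqI\<close>). Close times with
  the same shift and gap \<open>\<eta>\<close> inside a stretch of that length span at most \<open>O(\<eta> powr (- \<beta>))\<close> base steps,
  by the growth of the drift (\<open>drift_ge_one\<close>, \<open>idx_spread_le\<close>). Hence close times of gap about \<open>2 ^ (- a)\<close>
  make up a proportion of at most order \<open>2 ^ (- a * (1 - \<beta>))\<close>, and summing over the \<open>a\<close> allowed by the
  bound \<open>\<epsilon>\<close> leaves a small fraction of the window. Two error terms remain. Times spent in very high
  towers are rare uniformly in the window, again by bounded type (\<open>card_high_towers_le\<close>). The boundary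
  terms of the count are harmless as long as \<open>\<eta> powr (- \<beta>)\<close> is small compared with \<open>L\<close>
  (\<open>few_close_times\<close>).

  \<^bold>\<open>Short windows.\<close> The offset \<open>\<delta>\<close> is chosen so that all gaps with \<open>m \<noteq> m'\<close> are at least of order
  \<open>1 / \<bar>m - m'\<bar>\<close> (\<open>well_spread_offset\<close>); for these the last condition holds once \<open>L\<close> is large, and only
  \<open>m = m'\<close> in windows of length \<open>L = O(\<delta> powr (- \<beta>))\<close> is left. There the pair is chosen so that the drift
  never takes a value near \<open>P\<close>: at some time \<open>j\<close> of order \<open>\<delta> powr (- \<beta>)\<close> the orbit of \<open>x\<close> visits the
  singularity at distance less than \<open>\<theta> / j\<close>. No other orbit point up to time \<open>j\<close> is within
  \<open>c / (2 * j)\<close> to the right of the singularity, so the drift stays small before \<open>j\<close>, and the single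
  visit lifts it beyond all of \<open>P\<close> if \<open>\<theta>\<close> is small (\<open>drift_jump\<close>). Such pairs exist in every set of positive measure, by
  a density argument at the scale \<open>1 / j\<close> of the visit, since \<open>\<delta>\<close> is much smaller than \<open>\<theta> / j\<close>
  (\<open>ex_pair_near_singularity\<close>).

  Since \<open>t0 \<noteq> 0\<close> and \<open>P\<close> were arbitrary, at most \<open>t0 = 0\<close> can have the property, which is not
  an uncountable set.
\<close>

section \<open>Distance to the nearest integer\<close>

definition int_dist :: "real \<Rightarrow> real" where
  "int_dist z = \<bar>z - of_int (round z)\<bar>"

lemma circle_dist_eq: "circle_dist x y = int_dist (x - y)"
  by (simp add: circle_dist_def int_dist_def)

lemma int_dist_le: "int_dist z \<le> \<bar>z - of_int m\<bar>"
  unfolding int_dist_def by (rule round_diff_minimal)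

lemma int_dist_nonneg: "0 \<le> int_dist z"
  by (simp add: int_dist_def)

lemma int_dist_le_half: "int_dist z \<le> 1/2"
  using of_int_round_abs_le[of z] by (simp add: int_dist_def abs_minus_commute)

lemma int_dist_obtain: obtains m where "int_dist z = \<bar>z - of_int m\<bar>"
  by (auto simp: int_dist_def)

lemma int_dist_add: "int_dist (z + w) \<le> int_dist z + int_dist w"
proof -
  obtain m n where "int_dist z = \<bar>z - of_int m\<bar>" "int_dist w = \<bar>w - of_int n\<bar>"
    by (metis int_dist_obtain)
  then show ?thesis
    using int_dist_le[of "z + w" "m + n"] by simp
qed

lemma int_dist_minus [simp]: "int_dist (- z) = int_dist z"
proof -
  have "int_dist (- z) \<le> int_dist z" for z
  proof -
    obtain m where "int_dist z = \<bar>z - of_int m\<bar>" by (metis int_dist_obtain)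
    then show ?thesis using int_dist_le[of "- z" "- m"] by simp
  qed
  from this[of z] this[of "- z"] show ?thesis by simp
qed

lemma int_dist_diff: "int_dist (z - w) \<le> int_dist z + int_dist w"
  using int_dist_add[of z "- w"] by simp

lemma int_dist_add_int [simp]: "int_dist (z + of_int m) = int_dist z"
proof -
  have "int_dist (z + of_int m) \<le> int_dist z" for z m
  proof -
    obtain k where "int_dist z = \<bar>z - of_int k\<bar>" by (metis int_dist_obtain)
    then show ?thesis using int_dist_le[of "z + of_int m" "k + m"] by simp
  qed
  from this[of z m] this[of "z + of_int m" "- m"] show ?thesis by simp
qed

lemma int_dist_cong: "z - w \<in> \<int> \<Longrightarrow> int_dist z = int_dist w"
  by (metis Ints_cases add.commute diff_add_cancel int_dist_add_int)

lemma int_dist_frac_diff: "int_dist (frac x - frac y) = int_dist (x - y)"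
  by (rule int_dist_cong) (simp add: frac_def)

lemma int_dist_small: "\<bar>z\<bar> \<le> 1/2 \<Longrightarrow> int_dist z = \<bar>z\<bar>"
proof -
  assume z: "\<bar>z\<bar> \<le> 1/2"
  obtain m where m: "int_dist z = \<bar>z - of_int m\<bar>" by (metis int_dist_obtain)
  have "int_dist z \<le> \<bar>z\<bar>" using int_dist_le[of z 0] by simp
  moreover have "\<bar>z\<bar> \<le> \<bar>z - of_int m\<bar>"
  proof (cases "m = 0")
    case False
    then have "1 \<le> \<bar>real_of_int m\<bar>" by linarith
    then show ?thesis using z by linarith
  qed simp
  ultimately show ?thesis using m by simp
qed

text \<open>Points at circle distance \<open>\<eta>\<close> are translates of each other by \<open>\<eta>\<close>, in one of the two orders;
  this lets estimates for the pair \<open>x\<close>, \<open>x + \<eta>\<close> be applied to an arbitrary pair.\<close>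
lemma frac_shift_cases:
  assumes "int_dist (x - y) = \<eta>"
  shows "(\<forall>b. frac (y + b) = frac (x + \<eta> + b)) \<or> (\<forall>b. frac (x + b) = frac (y + \<eta> + b))"
proof -
  obtain m where m: "int_dist (x - y) = \<bar>x - y - of_int m\<bar>" by (metis int_dist_obtain)
  consider "x = y + \<eta> + of_int m" | "y = x + \<eta> + of_int (- m)"
    using m assms by (fastforce simp: abs_if split: if_splits)
  then show ?thesis
  proof cases
    case 1
    have "frac (x + b) = frac (y + \<eta> + b)" for b
      using frac_add_of_int_right[of "y + \<eta> + b" m] 1 by (simp add: algebra_simps)
    then show ?thesis by blast
  next
    case 2
    have "frac (y + b) = frac (x + \<eta> + b)" for b
    proof -
      have "y + b = (x + \<eta> + b) + of_int (- m)" using 2 by simp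
      then show ?thesis by (simp only: frac_add_of_int_right)
    qed
    then show ?thesis by blast
  qed
qed


section \<open>Bounded partial quotients and badly approximable numbers\<close>

definition badly_approximable :: "real \<Rightarrow> real \<Rightarrow> bool" where
  "badly_approximable c \<alpha> \<longleftrightarrow>
     0 < c \<and> (\<forall>k::int. k \<noteq> 0 \<longrightarrow> c / \<bar>real_of_int k\<bar> \<le> int_dist (of_int k * \<alpha>))"

text \<open>The continued fraction step \<open>x \<mapsto> 1 / x - a\<close>, \<open>y \<mapsto> 1 / (a + y)\<close>, \<open>(q, p) \<mapsto> (p, q - a * p)\<close> leaves
  \<open>\<bar>q * x - p\<bar> * (q + y * p) / (1 + x * y)\<close> invariant: this is the indefinite form of the natural
  extension of the Gauss map. Each step decreases \<open>q\<close>, and it is iterated until \<open>p / q\<close> is no longer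
  an approximation of \<open>x\<close>, where the bound is evident from \<open>l \<le> x n \<le> 1 - l\<close>. The value \<open>y = 0\<close> is
  the one of interest; the other values are needed for the induction.\<close>
lemma indefinite_form_bound:
  fixes x :: "nat \<Rightarrow> real" and a :: "nat \<Rightarrow> int" and l :: real and q p :: int
  assumes l: "0 < l" "l \<le> 1"
    and x: "\<And>n. l \<le> x n \<and> x n \<le> 1 - l" and a: "\<And>n. 1 \<le> a n \<and> of_int (a n) * l \<le> 1"
    and step: "\<And>n. x (Suc n) = 1 / x n - of_int (a n)"
    and y: "0 \<le> y" "y \<le> 1" and qp: "1 \<le> q" "0 \<le> p" "p \<le> q"
  shows "l ^ 3 / 2 * (1 + x n * y) \<le> \<bar>of_int q * x n - of_int p\<bar> * (of_int q + y * of_int p)"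
  using y qp
proof (induction "nat q" arbitrary: n q p y rule: less_induct)
  case less
  have l3: "l ^ 3 \<le> l" "l^3 \<le> l^2" using l power_decreasing[of 1 3 l] power_decreasing[of 2 3 l] by auto
  have xy: "1 + x n * y \<le> 2"
  proof -
    have "x n * y \<le> 1 * 1" using x[of n] l less.prems by (intro mult_mono) auto
    then show ?thesis by simp
  qed
  have q1: "1 \<le> real_of_int q" using less.prems by simp
  have Q: "1 \<le> of_int q + y * of_int p" "real_of_int q \<le> of_int q + y * of_int p"
    using less.prems q1 by (auto intro: add_increasing2)
  have triv: ?case if "l ^ 3 \<le> \<bar>of_int q * x n - of_int p\<bar> * of_int q"
  proof -
    have "l ^ 3 / 2 * (1 + x n * y) \<le> l ^ 3 / 2 * 2"
      using xy l by (intro mult_left_mono) auto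
    also have "\<dots> \<le> \<bar>of_int q * x n - of_int p\<bar> * of_int q" using that by simp
    also have "\<dots> \<le> \<bar>of_int q * x n - of_int p\<bar> * (of_int q + y * of_int p)"
      using Q by (intro mult_left_mono) auto
    finally show ?thesis .
  qed
  have xn: "0 < x n" "x n < 1" using x[of n] l by auto
  consider "p = 0" | "p = q" | "0 < p" "p < q" using less.prems by linarith
  then show ?case
  proof cases
    case 1
    have "l * 1 \<le> (of_int q * x n) * of_int q"
    proof (intro mult_mono)
      show "l \<le> of_int q * x n" using mult_mono[of 1 "of_int q" l "x n"] q1 x[of n] l by simp
    qed (use q1 xn in auto)
    then show ?thesis using triv l3 1 xn q1 by simp
  next
    case 2
    have "\<bar>of_int q * x n - of_int p\<bar> = of_int q * (1 - x n)"
      using 2 xn q1 by (simp add: abs_if algebra_simps mult_less_cancel_left2)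
    moreover have "l * 1 \<le> (of_int q * (1 - x n)) * of_int q"
    proof (intro mult_mono)
      show "l \<le> of_int q * (1 - x n)" using mult_mono[of 1 "of_int q" l "1 - x n"] q1 x[of n] l by simp
    qed (use q1 xn in auto)
    ultimately show ?thesis using triv l3 by simp
  next
    case 3
    define p' where "p' = q - a n * p"
    define x' where "x' = x (Suc n)"
    have x': "l \<le> x'" "x' \<le> 1 - l" "1 / x n = of_int (a n) + x'"
      using x[of "Suc n"] step[of n] by (auto simp: x'_def)
    have p1: "1 \<le> real_of_int p" using 3 by simp
    have "of_int q * x n - of_int p = x n * (of_int q - of_int p * (1 / x n))"
      using xn by (simp add: field_simps)
    also have "of_int q - of_int p * (1 / x n) = of_int p' - of_int p * x'"
      unfolding x'(3) by (simp add: p'_def algebra_simps)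
    finally have u: "\<bar>of_int q * x n - of_int p\<bar> = x n * \<bar>of_int p * x' - of_int p'\<bar>"
      using xn by (simp add: abs_mult abs_minus_commute)
    consider "p' < 0" | "p' > p" | "0 \<le> p'" "p' \<le> p" by linarith
    then show ?thesis
    proof cases
      case c1: 1
      have "of_int p * l \<le> of_int p * x'" using x' p1 by simp
      also have "of_int p * x' \<le> \<bar>of_int p * x' - of_int p'\<bar>" using c1 by linarith
      finally have A: "of_int p * l \<le> \<bar>of_int p * x' - of_int p'\<bar>" .
      have "l * l \<le> l * (of_int p * l)" using p1 l by simp
      also have "\<dots> \<le> x n * \<bar>of_int p * x' - of_int p'\<bar>"
        using A x[of n] l p1 by (intro mult_mono) auto
      finally have "l * l * 1 \<le> \<bar>of_int q * x n - of_int p\<bar> * of_int q"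
        unfolding u using q1 l xn by (intro mult_mono[of "l * l"]) auto
      then show ?thesis using triv l3 by (simp add: power2_eq_square)
    next
      case c2: 2
      have "of_int p * x' \<le> of_int p * (1 - l)" using x' p1 by simp
      then have A: "of_int p * l \<le> \<bar>of_int p * x' - of_int p'\<bar>" using c2 by (simp add: algebra_simps)
      have "l * l \<le> l * (of_int p * l)" using p1 l by simp
      also have "\<dots> \<le> x n * \<bar>of_int p * x' - of_int p'\<bar>"
        using A x[of n] l p1 by (intro mult_mono) auto
      finally have "l * l * 1 \<le> \<bar>of_int q * x n - of_int p\<bar> * of_int q"
        unfolding u using q1 l xn by (intro mult_mono[of "l * l"]) auto
      then show ?thesis using triv l3 by (simp add: power2_eq_square)
    next
      case c3: 3
      define A where "A = of_int (a n) + y"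
      have A: "1 \<le> A" "A \<noteq> 0" using a[of n] less.prems by (auto simp: A_def)
      have IH: "l ^ 3 / 2 * (1 + x' * (1 / A)) \<le>
            \<bar>of_int p * x' - of_int p'\<bar> * (of_int p + (1 / A) * of_int p')"
        unfolding x'_def by (rule less.hyps) (use 3 c3 A in auto)
      have e1: "1 + x n * y = x n * A * (1 + x' * (1 / A))"
      proof -
        have "x n * A * (1 + x' * (1 / A)) = x n * (A + x')" using A(2) by (simp add: field_simps)
        also have "A + x' = 1 / x n + y" using x'(3) by (simp add: A_def)
        also have "x n * (1 / x n + y) = 1 + x n * y" using xn by (simp add: distrib_left)
        finally show ?thesis by simp
      qed
      have e2: "of_int q + y * of_int p = A * (of_int p + (1 / A) * of_int p')"
      proof -
        have "A * (of_int p + (1 / A) * of_int p') = A * of_int p + of_int p'"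
          using A(2) by (simp add: field_simps)
        then show ?thesis by (simp add: A_def p'_def algebra_simps)
      qed
      have "l ^ 3 / 2 * (1 + x n * y) = x n * A * (l ^ 3 / 2 * (1 + x' * (1 / A)))"
        unfolding e1 by simp
      also have "\<dots> \<le> x n * A * (\<bar>of_int p * x' - of_int p'\<bar> * (of_int p + (1 / A) * of_int p'))"
        using IH xn A by (intro mult_left_mono) auto
      also have "\<dots> = \<bar>of_int q * x n - of_int p\<bar> * (of_int q + y * of_int p)"
        unfolding u e2 by simp
      finally show ?thesis .
    qed
  qed
qed

lemma bounded_partial_quotients_imp_badly_approximable:
  assumes "\<alpha> \<in> {0..<1}" and "\<alpha> \<notin> \<rat>" and "bounded_partial_quotients \<alpha>"
  obtains c where "badly_approximable c \<alpha>"
proof -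
  define x where "x n = frac (complete_quotient \<alpha> n)" for n
  define a where "a n = partial_quotient \<alpha> (Suc n)" for n
  obtain B where B: "\<And>n. partial_quotient \<alpha> n \<le> B"
    using assms(3) by (auto simp: bounded_partial_quotients_def bdd_above_def)
  have irr: "x n \<notin> \<rat>" for n
  proof (induction n)
    case 0
    then show ?case using assms by (simp add: x_def frac_eq)
  next
    case (Suc n)
    have "1 / x n = x (Suc n) + of_int (partial_quotient \<alpha> (Suc n))"
      by (simp add: x_def partial_quotient_def frac_def)
    then have "x n = 1 / (x (Suc n) + of_int (partial_quotient \<alpha> (Suc n)))"
      by (metis div_by_1 divide_divide_eq_right mult_1)
    then show ?case using Suc by auto
  qed
  have x01: "0 < x n" "x n < 1" for n
  proof -
    have "x n \<noteq> 0" using irr[of n] by (metis Rats_0)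
    then show "0 < x n" "x n < 1" using frac_ge_0[of "complete_quotient \<alpha> n"] by (simp_all add: x_def frac_lt_1)
  qed
  have step: "x (Suc n) = 1 / x n - of_int (a n)" for n
    by (simp add: x_def a_def partial_quotient_def frac_def)
  have a1: "1 \<le> a n" for n
  proof -
    have "1 < 1 / x n" using x01[of n] by simp
    then show ?thesis by (simp add: x_def a_def partial_quotient_def le_floor_iff)
  qed
  have B1: "1 \<le> B" using B[of "Suc 0"] a1[of 0] by (simp add: a_def)
  define l where "l = 1 / (2 * (real_of_int B + 1))"
  have l: "0 < l" "l \<le> 1" using B1 by (auto simp: l_def)
  have xl: "2 * l \<le> x n" for n
  proof -
    have "1 / x n \<le> real_of_int B + 1"
    proof -
      have "real_of_int (a n) \<le> B" using B[of "Suc n"] by (simp add: a_def)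
      then show ?thesis using step[of n] x01[of "Suc n"] by linarith
    qed
    then have "1 / (real_of_int B + 1) \<le> x n" using x01[of n] B1 by (simp add: field_simps)
    moreover have "2 * l = 1 / (real_of_int B + 1)" using B1 by (simp add: l_def field_simps)
    ultimately show ?thesis by simp
  qed
  have xu: "x n \<le> 1 - l" for n
  proof -
    have "x n * (1 + x (Suc n)) \<le> x n * (of_int (a n) + x (Suc n))"
      using x01[of n] a1[of n] by (intro mult_left_mono) auto
    also have "\<dots> = 1" using step[of n] x01[of n] by (simp add: field_simps)
    finally have "x n * (1 + 2 * l) \<le> 1"
      using xl[of "Suc n"] x01[of n] mult_left_mono[of "1 + 2 * l" "1 + x (Suc n)" "x n"] by linarith
    moreover have "1 \<le> (1 - l) * (1 + 2 * l)"
    proof -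
      have "l * (1 - 2 * l) \<ge> 0" using xl[of 0] x01[of 0] l by (intro mult_nonneg_nonneg) linarith+
      then show ?thesis by (simp add: algebra_simps)
    qed
    ultimately have "x n * (1 + 2 * l) \<le> (1 - l) * (1 + 2 * l)" by linarith
    then show ?thesis using l by simp
  qed
  have al: "of_int (a n) * l \<le> 1" for n
  proof -
    have "real_of_int (a n) \<le> B" using B[of "Suc n"] by (simp add: a_def)
    then have "of_int (a n) * l \<le> (2 * (of_int B + 1)) * l" using l B1 by (intro mult_right_mono) auto
    then show ?thesis using B1 by (simp add: l_def)
  qed
  have xl': "l \<le> x n" for n using xl[of n] l by linarith
  have x0: "x 0 = \<alpha>" using assms by (simp add: x_def frac_eq)
  have pos: "l ^ 3 / 2 / q \<le> int_dist (of_int q * \<alpha>)" if "1 \<le> q" for q :: int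
  proof -
    obtain p where p: "int_dist (of_int q * \<alpha>) = \<bar>of_int q * \<alpha> - of_int p\<bar>" by (metis int_dist_obtain)
    have q1: "1 \<le> real_of_int q" using that by simp
    have l3: "l ^ 3 / 2 \<le> l" using l power_decreasing[of 1 3 l] by simp
    have lq: "l ^ 3 / 2 / q \<le> l"
    proof -
      have "l ^ 3 / 2 / q \<le> l ^ 3 / 2 / 1" using q1 l by (intro divide_left_mono) auto
      then show ?thesis using l3 by simp
    qed
    consider "p < 0" | "p > q" | "0 \<le> p" "p \<le> q" by linarith
    then have "l ^ 3 / 2 / q \<le> \<bar>of_int q * \<alpha> - of_int p\<bar>"
    proof cases
      case 1
      have "l \<le> of_int q * \<alpha>" using mult_mono[of 1 "of_int q" l \<alpha>] q1 xl'[of 0] l x0 by simp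
      then show ?thesis using lq 1 by linarith
    next
      case 2
      have "l \<le> of_int q * (1 - \<alpha>)" using mult_mono[of 1 "of_int q" l "1 - \<alpha>"] q1 xu[of 0] l x0 by simp
      then show ?thesis using lq 2 by (simp add: algebra_simps)
    next
      case 3
      have "l ^ 3 / 2 * (1 + x 0 * 0) \<le> \<bar>of_int q * x 0 - of_int p\<bar> * (of_int q + 0 * of_int p)"
        by (rule indefinite_form_bound[where a = a]) (use l xl' xu a1 al step that 3 in auto)
      then show ?thesis using q1 by (simp add: x0 divide_le_eq)
    qed
    then show ?thesis using p by simp
  qed
  have "badly_approximable (l ^ 3 / 2) \<alpha>"
    unfolding badly_approximable_def
  proof (intro conjI allI impI)
    fix k :: int assume "k \<noteq> 0"
    then consider "1 \<le> k" | "1 \<le> - k" by linarith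
    then show "l ^ 3 / 2 / \<bar>real_of_int k\<bar> \<le> int_dist (of_int k * \<alpha>)"
    proof cases
      case 1 then show ?thesis using pos[OF 1] by simp
    next
      case 2 then show ?thesis using pos[OF 2] by simp
    qed
  qed (use l in simp)
  then show thesis by (rule that)
qed

lemma badly_approximable_uminus: "badly_approximable c \<alpha> \<Longrightarrow> badly_approximable c (- \<alpha>)"
  by (simp add: badly_approximable_def)

lemma badly_approximable_le_half: "badly_approximable c \<alpha> \<Longrightarrow> c \<le> 1/2"
  unfolding badly_approximable_def using int_dist_le_half[of \<alpha>]
  by (auto dest!: spec[of _ 1])

lemma badly_approximableD: "badly_approximable c \<alpha> \<Longrightarrow> k \<noteq> 0 \<Longrightarrow> c / \<bar>real_of_int k\<bar> \<le> int_dist (of_int k * \<alpha>)"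
  by (simp add: badly_approximable_def)

text \<open>Dividing the fraction of Dirichlet's theorem by its greatest common divisor only improves the
  approximation.\<close>
lemma Dirichlet_coprime:
  fixes \<alpha> :: real and N :: nat
  assumes "N > 0"
  obtains q p :: int where "0 < q" "q \<le> int N" "coprime q p" "\<bar>of_int q * \<alpha> - of_int p\<bar> < 1 / N"
proof -
  obtain q :: int and p :: "nat \<Rightarrow> int" where "0 < q" "q \<le> int (N ^ 1)"
    and *: "\<And>i. i < 1 \<Longrightarrow> \<bar>of_int q * \<alpha> - of_int (p i)\<bar> < 1 / N"
    using Dirichlet_approx_simult[OF assms, of 1 "\<lambda>_. \<alpha>" thesis] by simp
  then have qp: "0 < q" "q \<le> int N" "\<bar>of_int q * \<alpha> - of_int (p 0)\<bar> < 1 / N"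
    using *[of 0] by simp_all
  define g where "g = gcd q (p 0)"
  have g: "g > 0" using qp by (simp add: g_def)
  obtain q' p' where q': "q = q' * g" "p 0 = p' * g" "coprime q' p'"
    using gcd_coprime_exists[of q "p 0", folded g_def] g by blast
  have q'pos: "0 < q'" using qp(1) g q'(1) by (simp add: zero_less_mult_iff)
  have "q' * 1 \<le> q' * g" using q'pos g by (intro mult_left_mono) auto
  then have "q' \<le> int N" using qp(2) q' by simp
  moreover have "\<bar>of_int q' * \<alpha> - of_int p'\<bar> < 1 / N"
  proof -
    have "of_int q * \<alpha> - of_int (p 0) = of_int g * (of_int q' * \<alpha> - of_int p')"
      by (simp add: q' algebra_simps)
    then have "\<bar>of_int q * \<alpha> - of_int (p 0)\<bar> = of_int g * \<bar>of_int q' * \<alpha> - of_int p'\<bar>"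
      using g by (simp add: abs_mult)
    moreover have "1 * \<bar>of_int q' * \<alpha> - of_int p'\<bar> \<le> of_int g * \<bar>of_int q' * \<alpha> - of_int p'\<bar>"
      using g by (intro mult_right_mono) auto
    ultimately show ?thesis using qp(3) by simp
  qed
  ultimately show thesis using that q'pos q'(3) by blast
qed

text \<open>Take a Dirichlet fraction \<open>p1 / q1\<close> of \<open>\<alpha>\<close> with \<open>q1 \<le> q\<close>. The first \<open>q1\<close> orbit points are within
  \<open>1 / q1\<close> of the \<open>q1\<close> equally spaced points \<open>x + k / q1\<close>, and bad approximability gives \<open>q1 \<ge> c * q\<close>.\<close>
lemma orbit_visits_arc:
  assumes c: "badly_approximable c \<alpha>" and q: "q > 0"
  obtains i :: nat where "i < q" "frac (x + real i * \<alpha>) \<le> 3 / c / q"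
proof -
  obtain q1 p1 :: int where q1: "0 < q1" "q1 \<le> int q" "coprime q1 p1"
      "\<bar>of_int q1 * \<alpha> - of_int p1\<bar> < 1 / q"
    using Dirichlet_coprime[OF q] by blast
  have c0: "0 < c" using c by (simp add: badly_approximable_def)
  have "c / q1 \<le> int_dist (of_int q1 * \<alpha>)" using badly_approximableD[OF c, of q1] q1 by simp
  also have "\<dots> < 1 / q" using q1(4) int_dist_le[of "of_int q1 * \<alpha>" p1] by linarith
  finally have cq: "3 / q1 \<le> 3 / c / q" using q1 q c0 by (simp add: field_simps)
  define w where "w = \<lceil>- x * q1\<rceil> + 1"
  have w: "1 / q1 \<le> x + w / q1" "x + w / q1 < 2 / q1"
  proof -
    have "- x * q1 + 1 \<le> w" "w < - x * q1 + 2" unfolding w_def by linarith+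
    then have "1 / q1 \<le> (x * q1 + w) / q1" "(x * q1 + w) / q1 < 2 / q1"
      using q1 by (auto intro!: divide_right_mono divide_strict_right_mono)
    moreover have "(x * q1 + w) / q1 = x + w / q1" using q1 by (simp add: field_simps)
    ultimately show "1 / q1 \<le> x + w / q1" "x + w / q1 < 2 / q1" by simp_all
  qed
  obtain s t where st: "s * p1 + t * q1 = 1"
    using bezout_int[of p1 q1] q1(3) by (auto simp: coprime_iff_gcd_eq_1 gcd.commute)
  define i where "i = nat ((s * w) mod q1)"
  have i: "int i = (s * w) mod q1" using q1 by (simp add: i_def)
  define z where "z = - t * w - p1 * ((s * w) div q1)"
  have z: "p1 * int i = w + q1 * z"
  proof -
    have "p1 * int i = p1 * (s * w - q1 * ((s * w) div q1))"
      unfolding i by (simp add: minus_mult_div_eq_mod)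
    also have "\<dots> = (s * p1 + t * q1) * w + q1 * z" by (simp add: z_def algebra_simps)
    finally show ?thesis using st by simp
  qed
  have iq: "int i < q1" using i q1 by simp
  have iq': "real i < q1" using iq by linarith
  define e where "e = real i * (\<alpha> - p1 / q1)"
  have "\<bar>e\<bar> = real i / real_of_int q1 * \<bar>of_int q1 * \<alpha> - of_int p1\<bar>"
  proof -
    have "e = real i / real_of_int q1 * (of_int q1 * \<alpha> - of_int p1)" using q1 by (simp add: e_def field_simps)
    then show ?thesis using q1 by (simp add: abs_mult)
  qed
  also have "\<dots> \<le> 1 * (1 / q)"
    using iq' q1 by (intro mult_mono) auto
  also have "\<dots> \<le> 1 / q1" using q1 q by (simp add: field_simps)
  finally have e: "\<bar>e\<bar> \<le> 1 / q1" .
  have eq: "x + real i * \<alpha> = (x + w / q1 + e) + of_int z"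
  proof -
    have "real i * (p1 / q1) = real_of_int (p1 * int i) / q1" by simp
    also have "\<dots> = w / q1 + z" unfolding z using q1 by (simp add: field_simps)
    finally show ?thesis by (simp add: e_def algebra_simps)
  qed
  have "frac (x + real i * \<alpha>) = frac (x + w / q1 + e)" unfolding eq by simp
  also have "\<dots> \<le> x + w / q1 + e" using w e by (simp add: frac_def)
  also have "\<dots> \<le> 3 / q1" using w e by (simp add: field_simps)
  finally have "frac (x + real i * \<alpha>) \<le> 3 / c / q" using cq by linarith
  moreover have "i < q" using iq q1 by linarith
  ultimately show thesis using that by blast
qed

text \<open>The offset is half of a Dirichlet error, \<open>\<delta> = \<bar>q * \<alpha> - p\<bar> / 2\<close>. Then \<open>2 * (\<delta> + k * \<alpha>)\<close> is
  congruent to \<open>(2 * k \<plusminus> q) * \<alpha>\<close>, whose distance to the integers is controlled unless \<open>2 * k \<plusminus> q = 0\<close>;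
  in that exceptional case \<open>p\<close> is odd by coprimality, and \<open>\<delta> + k * \<alpha>\<close> is congruent to \<open>1 / 2\<close>.\<close>
lemma well_spread_offset:
  assumes c: "badly_approximable c \<alpha>" and N: "N > 0"
  obtains \<delta> where "c / (2 * real N) \<le> \<delta>" "\<delta> \<le> 1 / (2 * real N)"
    "\<And>k::int. k \<noteq> 0 \<Longrightarrow> c / (2 * (1 / c + 2)) / \<bar>real_of_int k\<bar> \<le> int_dist (\<delta> + of_int k * \<alpha>)"
proof -
  obtain q p :: int where q: "0 < q" "q \<le> int N" "coprime q p"
      "\<bar>of_int q * \<alpha> - of_int p\<bar> < 1 / N"
    using Dirichlet_coprime[OF N] by blast
  define \<delta> where "\<delta> = \<bar>of_int q * \<alpha> - of_int p\<bar> / 2"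
  have c0: "0 < c" using c by (simp add: badly_approximable_def)
  have c2: "c \<le> 1/2" using badly_approximable_le_half[OF c] .
  have qN: "real_of_int q \<le> N" using q by linarith
  have "c / N \<le> c / q" using c0 q qN by (intro divide_left_mono) auto
  also have "\<dots> \<le> int_dist (of_int q * \<alpha>)" using badly_approximableD[OF c, of q] q by simp
  also have "\<dots> \<le> 2 * \<delta>" using int_dist_le[of "of_int q * \<alpha>" p] by (simp add: \<delta>_def)
  finally have d1: "c / N \<le> 2 * \<delta>" .
  have d2: "2 * \<delta> \<le> 1 / N" using q by (simp add: \<delta>_def)
  obtain s :: int where s: "\<bar>s\<bar> = 1" "2 * \<delta> = of_int s * (of_int q * \<alpha> - of_int p)"
  proof (cases "of_int q * \<alpha> - of_int p \<ge> 0")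
    case True then show thesis using that[of 1] by (simp add: \<delta>_def)
  next
    case False then show thesis using that[of "-1"] by (simp add: \<delta>_def)
  qed
  have d0: "0 < \<delta>" using d1 c0 N by (smt (verit) divide_pos_pos of_nat_0_less_iff)
  define c1 where "c1 = c / (2 * (1 / c + 2))"
  have c1: "c1 \<le> c / 4" "c1 \<le> 1/2" "0 < c1"
  proof -
    have z: "0 < 1 / c" using c0 by simp
    have "c / (2 * (1 / c + 2)) \<le> c / 4"
    proof (rule divide_left_mono)
      have "4 \<le> 2 * (w + 2)" "0 < 2 * (w + 2) * 4" if "0 < w" for w :: real using that by auto
      from this[OF z] show "4 \<le> 2 * (1 / c + 2)" "0 < 2 * (1 / c + 2) * 4" by blast+
      show "0 \<le> c" using c0 by simp
    qed
    then show "c1 \<le> c / 4" by (simp add: c1_def)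
    then show "c1 \<le> 1/2" using c2 by simp
    show "0 < c1" unfolding c1_def
    proof (rule divide_pos_pos)
      have "0 < 2 * (w + 2)" if "0 < w" for w :: real using that by simp
      from this[OF z] show "0 < 2 * (1 / c + 2)" .
    qed (rule c0)
  qed
  have main: "c1 / \<bar>real_of_int k\<bar> \<le> int_dist (\<delta> + of_int k * \<alpha>)" if k: "k \<noteq> 0" for k :: int
  proof -
    have k1: "1 \<le> \<bar>real_of_int k\<bar>" using k by linarith
    consider (small) "\<bar>real_of_int k\<bar> \<le> c / (2 * \<delta>)"
      | (large) "\<bar>real_of_int k\<bar> > c / (2 * \<delta>)" "s * q + 2 * k \<noteq> 0"
      | (zero) "s * q + 2 * k = 0" by linarith
    then show ?thesis
    proof cases
      case small
      have "\<delta> \<le> c / (2 * \<bar>real_of_int k\<bar>)" using small d0 k1 by (simp add: field_simps)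
      moreover have "c / \<bar>real_of_int k\<bar> \<le> int_dist (of_int k * \<alpha>)" by (rule badly_approximableD[OF c k])
      moreover have "int_dist (of_int k * \<alpha>) \<le> int_dist (\<delta> + of_int k * \<alpha>) + int_dist \<delta>"
        using int_dist_diff[of "\<delta> + of_int k * \<alpha>" \<delta>] by simp
      moreover have "int_dist \<delta> \<le> \<delta>" using int_dist_le[of \<delta> 0] d0 by simp
      moreover have "c1 / \<bar>real_of_int k\<bar> \<le> (c / 2) / \<bar>real_of_int k\<bar>"
        using c1 c0 by (intro divide_right_mono) auto
      ultimately show ?thesis by (simp add: field_simps)
    next
      case large
      have "q \<le> N" using qN by simp
      have "c * N \<le> c / (2 * \<delta>)" using d2 d0 N c0 by (simp add: field_simps)
      then have "real_of_int q \<le> \<bar>real_of_int k\<bar> / c" using large(1) qN c0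
        by (simp add: pos_le_divide_eq) (smt (verit) mult.commute mult_left_mono)
      then have b: "real_of_int q + 2 * \<bar>real_of_int k\<bar> \<le> (1 / c + 2) * \<bar>real_of_int k\<bar>"
        by (simp add: algebra_simps)
      have "\<bar>real_of_int (s * q + 2 * k)\<bar> \<le> real_of_int q + 2 * \<bar>real_of_int k\<bar>"
      proof -
        have "\<bar>real_of_int (s * q)\<bar> = q" using s(1) q by (simp add: abs_mult flip: of_int_abs)
        then show ?thesis by simp
      qed
      then have "c / ((1 / c + 2) * \<bar>real_of_int k\<bar>) \<le> c / \<bar>real_of_int (s * q + 2 * k)\<bar>"
        using b c0 large(2) k1 by (intro divide_left_mono) (auto intro!: mult_pos_pos add_pos_pos simp del: of_int_add of_int_mult)
      also have "\<dots> \<le> int_dist (of_int (s * q + 2 * k) * \<alpha>)" by (rule badly_approximableD[OF c large(2)])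
      also have "of_int (s * q + 2 * k) * \<alpha> = ((\<delta> + of_int k * \<alpha>) + (\<delta> + of_int k * \<alpha>)) + of_int (s * p)"
        using s(2) by (simp add: algebra_simps)
      also have "int_dist \<dots> \<le> 2 * int_dist (\<delta> + of_int k * \<alpha>)"
        unfolding int_dist_add_int using int_dist_add[of "\<delta> + of_int k * \<alpha>" "\<delta> + of_int k * \<alpha>"] by linarith
      finally have *: "c / ((1 / c + 2) * \<bar>real_of_int k\<bar>) \<le> 2 * int_dist (\<delta> + of_int k * \<alpha>)" .
      have "A / 2 \<le> B" if "A \<le> 2 * B" for A B :: real using that by simp
      from this[OF *] have "c / ((1 / c + 2) * \<bar>real_of_int k\<bar>) / 2 \<le> int_dist (\<delta> + of_int k * \<alpha>)" .
      moreover have "c / (w * \<bar>real_of_int k\<bar>) / 2 = c / (2 * w) / \<bar>real_of_int k\<bar>" for w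
        by simp
      ultimately show ?thesis unfolding c1_def by metis
    next
      case zero
      have "even q"
      proof -
        have "s * q = 2 * (- k)" using zero by simp
        then have "even (s * q)" by (rule dvdI)
        moreover have "odd s" using s(1) by (cases "s \<ge> 0") auto
        ultimately show ?thesis by simp
      qed
      then have "odd p" using q(3) coprime_common_divisor[of q p 2] by auto
      moreover have "odd s" using s(1) by (cases "s \<ge> 0") auto
      ultimately have "odd (s * p)" by simp
      then obtain b where b: "s * p = 2 * b + 1" by (rule oddE)
      have "2 * (\<delta> + of_int k * \<alpha>) = - real_of_int (s * p) + of_int (s * q + 2 * k) * \<alpha>"
        using s(2) by (simp add: algebra_simps)
      also have "\<dots> = - real_of_int (2 * b + 1)" unfolding zero b by simp
      finally have "\<delta> + of_int k * \<alpha> = - (1/2) + of_int (- b)" by simp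
      then have "int_dist (\<delta> + of_int k * \<alpha>) = 1/2"
        by (simp only: int_dist_add_int) (simp add: int_dist_small)
      moreover have "c1 / \<bar>real_of_int k\<bar> \<le> 1/2" using c1 k1 by (simp add: divide_le_eq)
      ultimately show ?thesis by metis
    qed
  qed
  show thesis
    by (rule that[of \<delta>]) (use d1 d2 main in \<open>auto simp: c1_def\<close>)
qed


section \<open>Power sums over separated points\<close>

text \<open>Separation by \<open>g\<close> makes \<open>i \<mapsto> \<lfloor>u i / g\<rfloor>\<close> injective, so the sum is dominated by the sum over
  the grid \<open>g, 2 * g, \<dots>\<close>.\<close>
lemma separated_sum_le:
  fixes u :: "'i \<Rightarrow> real" and \<phi> :: "real \<Rightarrow> real"
  assumes "finite I" and g: "0 < g"
    and u: "\<And>i. i \<in> I \<Longrightarrow> g \<le> u i \<and> u i \<le> U"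
    and sep: "\<And>i j. i \<in> I \<Longrightarrow> j \<in> I \<Longrightarrow> i \<noteq> j \<Longrightarrow> g \<le> \<bar>u i - u j\<bar>"
    and anti: "\<And>x y. 0 < x \<Longrightarrow> x \<le> y \<Longrightarrow> \<phi> y \<le> \<phi> x"
    and nonneg: "\<And>x. 0 < x \<Longrightarrow> 0 \<le> \<phi> x"
  shows "(\<Sum>i\<in>I. \<phi> (u i)) \<le> (\<Sum>n\<in>{1..nat \<lfloor>U / g\<rfloor>}. \<phi> (real n * g))"
proof -
  define h where "h i = nat \<lfloor>u i / g\<rfloor>" for i
  have h: "1 \<le> h i" "real (h i) * g \<le> u i" "u i < (real (h i) + 1) * g" "h i \<le> nat \<lfloor>U / g\<rfloor>" if "i \<in> I" for i
  proof -
    have u1: "1 \<le> u i / g" using u[OF that] g by simp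
    then have "1 \<le> \<lfloor>u i / g\<rfloor>" by (simp add: le_floor_iff)
    then have hi: "real (h i) = of_int \<lfloor>u i / g\<rfloor>" "1 \<le> h i" unfolding h_def by linarith+
    then show "1 \<le> h i" by simp
    have "real (h i) \<le> u i / g" "u i / g < real (h i) + 1" using hi by linarith+
    then show "real (h i) * g \<le> u i" "u i < (real (h i) + 1) * g" using g by (auto simp: field_simps)
    have "u i / g \<le> U / g" using u[OF that] g by (intro divide_right_mono) auto
    then show "h i \<le> nat \<lfloor>U / g\<rfloor>" unfolding h_def by (intro nat_mono floor_mono)
  qed
  have inj: "inj_on h I"
  proof (rule inj_onI, rule ccontr)
    fix i j assume ij: "i \<in> I" "j \<in> I" "h i = h j" "i \<noteq> j"
    have "\<bar>u i - u j\<bar> < g"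
      using h(2,3)[OF ij(1)] h(2,3)[OF ij(2)] ij(3) by (auto simp: abs_less_iff algebra_simps)
    then show False using sep[OF ij(1,2,4)] by simp
  qed
  have "(\<Sum>i\<in>I. \<phi> (u i)) \<le> (\<Sum>i\<in>I. \<phi> (real (h i) * g))"
  proof (rule sum_mono)
    fix i assume i: "i \<in> I"
    have "0 < real (h i) * g" using h(1)[OF i] g by simp
    then show "\<phi> (u i) \<le> \<phi> (real (h i) * g)" using h(2)[OF i] by (intro anti)
  qed
  also have "\<dots> = (\<Sum>n\<in>h ` I. \<phi> (real n * g))" using inj by (simp add: sum.reindex)
  also have "\<dots> \<le> (\<Sum>n\<in>{1..nat \<lfloor>U / g\<rfloor>}. \<phi> (real n * g))"
    using h g by (intro sum_mono2) (auto intro!: nonneg mult_pos_pos)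
  finally show ?thesis .
qed

lemma separated_sum_powr_le:
  fixes u :: "'i \<Rightarrow> real"
  assumes "finite I" and g: "0 < g" and e: "e < -1"
    and u: "\<And>i. i \<in> I \<Longrightarrow> g \<le> u i"
    and sep: "\<And>i j. i \<in> I \<Longrightarrow> j \<in> I \<Longrightarrow> i \<noteq> j \<Longrightarrow> g \<le> \<bar>u i - u j\<bar>"
  shows "(\<Sum>i\<in>I. u i powr e) \<le> (\<Sum>n. real n powr e) * g powr e"
proof -
  have "(\<Sum>i\<in>I. u i powr e) \<le> (\<Sum>n\<in>{1..nat \<lfloor>Max (u ` I) / g\<rfloor>}. (real n * g) powr e)"
    using e u sep assms(1) g by (intro separated_sum_le) (auto intro: powr_mono2')
  also have "\<dots> = (\<Sum>n\<in>{1..nat \<lfloor>Max (u ` I) / g\<rfloor>}. real n powr e) * g powr e"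
    using g by (simp add: powr_mult sum_distrib_right)
  also have "\<dots> \<le> (\<Sum>n. real n powr e) * g powr e"
    using e by (intro mult_right_mono sum_le_suminf) (auto simp: summable_real_powr_iff)
  finally show ?thesis .
qed

lemma sum_powr_le:
  fixes e :: real
  assumes e: "-1 < e" "e < 0"
  shows "(\<Sum>n\<in>{1..N}. real n powr e) \<le> real N powr (1 + e) / (1 + e)"
proof (induction N)
  case (Suc N)
  show ?case
  proof (cases "N = 0")
    case True
    then show ?thesis using e by (simp add: field_simps)
  next
    case False
    have "\<exists>z. real N < z \<and> z < real N + 1 \<and>
        (real N + 1) powr (1 + e) - real N powr (1 + e) = (real N + 1 - real N) * ((1 + e) * z powr e)"
      using False e by (intro MVT2) (auto intro!: derivative_eq_intros)
    then obtain z where z: "real N < z" "z < real N + 1"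
      "(real N + 1) powr (1 + e) - real N powr (1 + e) = (1 + e) * z powr e" by auto
    have "(real N + 1) powr e \<le> z powr e" using z False e by (intro powr_mono2') auto
    also have "z powr e = ((real N + 1) powr (1 + e) - real N powr (1 + e)) / (1 + e)"
      using z e by (simp add: field_simps)
    finally have "(real N + 1) powr e \<le> ((real N + 1) powr (1 + e) - real N powr (1 + e)) / (1 + e)" .
    then show ?thesis using Suc by (simp add: diff_divide_distrib add.commute)
  qed
qed simp

lemma separated_sum_powr_le':
  fixes u :: "'i \<Rightarrow> real"
  assumes "finite I" and g: "0 < g" and e: "-1 < e" "e < 0" and U: "0 < U"
    and u: "\<And>i. i \<in> I \<Longrightarrow> g \<le> u i \<and> u i \<le> U"
    and sep: "\<And>i j. i \<in> I \<Longrightarrow> j \<in> I \<Longrightarrow> i \<noteq> j \<Longrightarrow> g \<le> \<bar>u i - u j\<bar>"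
  shows "(\<Sum>i\<in>I. u i powr e) \<le> U powr (1 + e) / (1 + e) / g"
proof -
  let ?M = "nat \<lfloor>U / g\<rfloor>"
  have M: "real ?M \<le> U / g" using U g by simp
  have "(\<Sum>i\<in>I. u i powr e) \<le> (\<Sum>n\<in>{1..?M}. (real n * g) powr e)"
    using e u sep assms(1) g by (intro separated_sum_le) (auto intro: powr_mono2')
  also have "\<dots> = (\<Sum>n\<in>{1..?M}. real n powr e) * g powr e"
    using g by (simp add: powr_mult sum_distrib_right)
  also have "\<dots> \<le> (real ?M powr (1 + e) / (1 + e)) * g powr e"
    using sum_powr_le[OF e] by (intro mult_right_mono) auto
  also have "\<dots> \<le> ((U / g) powr (1 + e) / (1 + e)) * g powr e"
    using M e by (intro mult_right_mono divide_right_mono powr_mono2) auto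
  also have "\<dots> = U powr (1 + e) / (1 + e) * (g powr e / g powr (1 + e))"
    using U g by (simp add: powr_divide)
  also have "g powr e / g powr (1 + e) = 1 / g"
    using g by (simp add: powr_add)
  finally show ?thesis by simp
qed

lemma powr_diff_bounds:
  fixes u \<eta> \<gamma> :: real
  assumes "0 < u" "0 < \<eta>" "\<gamma> < 0"
  shows "- \<gamma> * \<eta> * (u + \<eta>) powr (\<gamma> - 1) \<le> u powr \<gamma> - (u + \<eta>) powr \<gamma>"
    and "u powr \<gamma> - (u + \<eta>) powr \<gamma> \<le> - \<gamma> * \<eta> * u powr (\<gamma> - 1)"
proof -
  have "\<exists>z. u < z \<and> z < u + \<eta> \<and>
      (u + \<eta>) powr \<gamma> - u powr \<gamma> = (u + \<eta> - u) * (\<gamma> * z powr (\<gamma> - 1))"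
    using assms by (intro MVT2) (auto intro!: derivative_eq_intros)
  then obtain z where z: "u < z" "z < u + \<eta>"
    "(u + \<eta>) powr \<gamma> - u powr \<gamma> = \<eta> * (\<gamma> * z powr (\<gamma> - 1))" by auto
  have eq: "u powr \<gamma> - (u + \<eta>) powr \<gamma> = - \<gamma> * \<eta> * z powr (\<gamma> - 1)" using z(3) by (simp only: algebra_simps)
  have "(u + \<eta>) powr (\<gamma> - 1) \<le> z powr (\<gamma> - 1)" "z powr (\<gamma> - 1) \<le> u powr (\<gamma> - 1)"
    using z assms by (auto intro!: powr_mono2')
  moreover have "0 \<le> - \<gamma> * \<eta>" using assms by (simp add: mult_nonpos_nonneg)
  ultimately show "- \<gamma> * \<eta> * (u + \<eta>) powr (\<gamma> - 1) \<le> u powr \<gamma> - (u + \<eta>) powr \<gamma>"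
    "u powr \<gamma> - (u + \<eta>) powr \<gamma> \<le> - \<gamma> * \<eta> * u powr (\<gamma> - 1)"
    unfolding eq by (blast intro: mult_left_mono)+
qed


section \<open>Drift between the Birkhoff sums of two nearby points\<close>

text \<open>Positivity of orbit points is used in inequalities below, so it is kept in this form.\<close>
declare frac_gt_0_iff [simp del] frac_eq_0_iff [simp del]

abbreviation orbit_pt :: "real \<Rightarrow> real \<Rightarrow> int \<Rightarrow> real" where
  "orbit_pt \<alpha> x i \<equiv> frac (x + of_int i * \<alpha>)"

lemma orbit_pt_pos: "orbit_pt \<alpha> x i \<noteq> 0 \<Longrightarrow> 0 < orbit_pt \<alpha> x i"
  using frac_ge_0[of "x + of_int i * \<alpha>"] by linarith

lemma orbit_gap:
  assumes c: "badly_approximable c \<alpha>" and ij: "i \<noteq> j" "\<bar>real_of_int (i - j)\<bar> \<le> q"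
  shows "c / q \<le> int_dist (orbit_pt \<alpha> x i - orbit_pt \<alpha> x j)"
    and "c / q \<le> \<bar>orbit_pt \<alpha> x i - orbit_pt \<alpha> x j\<bar>"
proof -
  have c0: "0 < c" using c by (simp add: badly_approximable_def)
  have p: "0 < \<bar>real_of_int (i - j)\<bar>" using ij by simp
  have "c / q \<le> c / \<bar>real_of_int (i - j)\<bar>" using c0 ij p by (intro divide_left_mono mult_pos_pos) linarith+
  also have "\<dots> \<le> int_dist (of_int (i - j) * \<alpha>)" using badly_approximableD[OF c, of "i - j"] ij by (simp del: of_int_diff)
  also have "of_int (i - j) * \<alpha> = (x + of_int i * \<alpha>) - (x + of_int j * \<alpha>)" by (simp add: algebra_simps)
  finally show 1: "c / q \<le> int_dist (orbit_pt \<alpha> x i - orbit_pt \<alpha> x j)" by (simp only: int_dist_frac_diff)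
  show "c / q \<le> \<bar>orbit_pt \<alpha> x i - orbit_pt \<alpha> x j\<bar>"
    using 1 int_dist_le[of "orbit_pt \<alpha> x i - orbit_pt \<alpha> x j" 0] by simp
qed

lemma frac_add_small: "0 \<le> \<eta> \<Longrightarrow> frac a + \<eta> < 1 \<Longrightarrow> frac (a + \<eta>) = frac a + \<eta>"
  by (simp add: frac_unique_iff) (simp add: frac_def)

lemma orbit_pt_shift:
  "0 \<le> \<eta> \<Longrightarrow> orbit_pt \<alpha> x i + \<eta> < 1 \<Longrightarrow> orbit_pt \<alpha> (x + \<eta>) i = orbit_pt \<alpha> x i + \<eta>"
  using frac_add_small[of \<eta> "x + of_int i * \<alpha>"] by (simp add: algebra_simps)

lemma drift_le:
  assumes "finite I" and g: "0 < g" and \<gamma>: "-1 < \<gamma>" "\<gamma> < 0" and \<eta>: "0 < \<eta>"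
    and I: "\<And>i. i \<in> I \<Longrightarrow> g \<le> orbit_pt \<alpha> x i \<and> orbit_pt \<alpha> x i + \<eta> < 1"
    and sep: "\<And>i j. i \<in> I \<Longrightarrow> j \<in> I \<Longrightarrow> i \<noteq> j \<Longrightarrow> g \<le> \<bar>orbit_pt \<alpha> x i - orbit_pt \<alpha> x j\<bar>"
  shows "(\<Sum>i\<in>I. orbit_pt \<alpha> x i powr \<gamma> - orbit_pt \<alpha> (x + \<eta>) i powr \<gamma>)
          \<le> \<eta> * (\<Sum>n. real n powr (\<gamma> - 1)) * g powr (\<gamma> - 1)"
proof -
  have "(\<Sum>i\<in>I. orbit_pt \<alpha> x i powr \<gamma> - orbit_pt \<alpha> (x + \<eta>) i powr \<gamma>)
      \<le> (\<Sum>i\<in>I. \<eta> * orbit_pt \<alpha> x i powr (\<gamma> - 1))"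
  proof (rule sum_mono)
    fix i assume i: "i \<in> I"
    have "orbit_pt \<alpha> x i powr \<gamma> - (orbit_pt \<alpha> x i + \<eta>) powr \<gamma> \<le> - \<gamma> * \<eta> * orbit_pt \<alpha> x i powr (\<gamma> - 1)"
      by (rule powr_diff_bounds) (use I[OF i] g \<gamma> \<eta> in linarith)+
    also have "\<dots> \<le> 1 * \<eta> * orbit_pt \<alpha> x i powr (\<gamma> - 1)"
      using \<gamma> \<eta> by (intro mult_right_mono) auto
    finally show "orbit_pt \<alpha> x i powr \<gamma> - orbit_pt \<alpha> (x + \<eta>) i powr \<gamma> \<le> \<eta> * orbit_pt \<alpha> x i powr (\<gamma> - 1)"
      using I[OF i] \<eta> by (simp add: orbit_pt_shift)
  qed
  also have "\<dots> = \<eta> * (\<Sum>i\<in>I. orbit_pt \<alpha> x i powr (\<gamma> - 1))" by (simp add: sum_distrib_left)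
  also have "\<dots> \<le> \<eta> * ((\<Sum>n. real n powr (\<gamma> - 1)) * g powr (\<gamma> - 1))"
    using assms by (intro mult_left_mono separated_sum_powr_le) auto
  finally show ?thesis by simp
qed

lemma orbit_visits_zero:
  assumes c: "badly_approximable c \<alpha>" and m: "m1 < m2"
  obtains i where "m1 \<le> i" "i < m2" "orbit_pt \<alpha> x i \<le> 3 / c / of_int (m2 - m1)"
proof -
  obtain n where n: "n < nat (m2 - m1)" "frac ((x + of_int m1 * \<alpha>) + real n * \<alpha>) \<le> 3 / c / (nat (m2 - m1))"
    using orbit_visits_arc[OF c, of "nat (m2 - m1)" "x + of_int m1 * \<alpha>"] m by auto
  show thesis
    by (rule that[of "m1 + int n"]) (use n m in \<open>auto simp: algebra_simps\<close>)
qed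

text \<open>Over \<open>q = m2 - m1\<close> steps with \<open>\<eta> * q\<close> small, at most one step separates \<open>x\<close> and \<open>x + \<eta>\<close> by the
  singularity. Without separation all terms are nonnegative, and the visit at distance at most
  \<open>3 / (c * q)\<close> alone contributes a multiple of \<open>\<eta> * q powr (1 - \<gamma>)\<close>. With a separation, that one
  step contributes at most \<open>2 - \<eta> powr \<gamma>\<close>, and the others cannot compensate for it.\<close>
lemma drift_ge_one:
  fixes \<alpha> \<gamma> :: real
  assumes c: "badly_approximable c \<alpha>" and \<gamma>: "-1 < \<gamma>" "\<gamma> < 0"
  obtains c3 \<eta>0 Cd :: real where "0 < c3" "0 < \<eta>0" "0 < Cd"
    "\<And>x \<eta> m1 m2. 0 < \<eta> \<Longrightarrow> \<eta> \<le> \<eta>0 \<Longrightarrow> \<eta> * of_int (m2 - m1) \<le> c3 \<Longrightarrow>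
      Cd * \<eta> powr (- 1 / (1 - \<gamma>)) < of_int (m2 - m1) \<Longrightarrow>
      (\<And>i. orbit_pt \<alpha> x i \<noteq> 0) \<Longrightarrow> (\<And>i. orbit_pt \<alpha> (x + \<eta>) i \<noteq> 0) \<Longrightarrow>
      1 \<le> \<bar>\<Sum>i\<in>{m1..<m2}. orbit_pt \<alpha> x i powr \<gamma> - orbit_pt \<alpha> (x + \<eta>) i powr \<gamma>\<bar>"
proof -
  have c0: "0 < c" using c by (simp add: badly_approximable_def)
  define \<beta> where "\<beta> = 1 / (1 - \<gamma>)"
  have \<beta>: "0 < \<beta>" "\<beta> * (1 - \<gamma>) = 1" using \<gamma> by (auto simp: \<beta>_def)
  define Z where "Z = (\<Sum>n. real n powr (\<gamma> - 1))"
  have "0 \<le> Z" unfolding Z_def using \<gamma> by (intro suminf_nonneg) (auto simp: summable_real_powr_iff)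
  \<comment> \<open>\<open>c3\<close> small makes the gaps \<open>c / q\<close> large multiples of \<open>\<eta>\<close>, so that
     all steps but the separating one together contribute at most \<open>\<eta> powr \<gamma> / 2\<close>\<close>
  define c3 where "c3 = min (c / 2) (min 1 ((c / 2) * (1 / (2 * (Z + 1))) powr \<beta>))"
  define \<eta>0 where "\<eta>0 = min (1 / 4) (6 powr (1 / \<gamma>))"
  define Cd where "Cd = ((3 / c + 1) powr (1 - \<gamma>) / (- \<gamma>)) powr \<beta>"
  have c3: "0 < c3" "c3 \<le> c / 2" "c3 \<le> 1" using c0 \<open>0 \<le> Z\<close> by (auto simp: c3_def)
  have c3Z: "Z * (c / (2 * c3)) powr (\<gamma> - 1) \<le> 1 / 2"
  proof -
    have "c3 \<le> (c / 2) * (1 / (2 * (Z + 1))) powr \<beta>" by (simp add: c3_def)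
    then have "c3 / (c / 2) \<le> (1 / (2 * (Z + 1))) powr \<beta>" using c0 by (simp add: field_simps)
    then have "(c3 / (c / 2)) powr (1 - \<gamma>) \<le> ((1 / (2 * (Z + 1))) powr \<beta>) powr (1 - \<gamma>)"
      using c3 c0 \<gamma> by (intro powr_mono2) auto
    also have "\<dots> = 1 / (2 * (Z + 1))" using \<open>0 \<le> Z\<close> \<beta> by (simp add: powr_powr)
    finally have "(c3 / (c / 2)) powr (1 - \<gamma>) \<le> 1 / (2 * (Z + 1))" .
    moreover have "(c / (2 * c3)) powr (\<gamma> - 1) = (c3 / (c / 2)) powr (1 - \<gamma>)"
    proof -
      have "c / (2 * c3) = inverse (c3 / (c / 2))" by (simp add: field_simps)
      moreover have "inverse (c3 / (c / 2)) powr (\<gamma> - 1) = inverse ((c3 / (c / 2)) powr (\<gamma> - 1))"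
        using c3 c0 by (intro inverse_powr)
      moreover have "\<dots> = (c3 / (c / 2)) powr (1 - \<gamma>)" by (simp add: powr_minus[symmetric])
      ultimately show ?thesis by (simp only:)
    qed
    ultimately have "Z * (c / (2 * c3)) powr (\<gamma> - 1) \<le> Z * (1 / (2 * (Z + 1)))"
      using \<open>0 \<le> Z\<close> by (simp only: mult_left_mono)
    also have "\<dots> \<le> 1 / 2" using \<open>0 \<le> Z\<close> by (simp add: field_simps)
    finally show ?thesis .
  qed
  have \<eta>0: "0 < \<eta>0" "\<eta>0 \<le> 1 / 4" by (auto simp: \<eta>0_def)
  have c31: "0 < 3 / c + 1" using c0 by (intro add_pos_pos) auto
  have Cd: "0 < Cd" using \<gamma> c31 unfolding Cd_def by simp
  have main: "1 \<le> \<bar>\<Sum>i\<in>{m1..<m2}. orbit_pt \<alpha> x i powr \<gamma> - orbit_pt \<alpha> (x + \<eta>) i powr \<gamma>\<bar>"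
    if \<eta>: "0 < \<eta>" "\<eta> \<le> \<eta>0" and q3: "\<eta> * of_int (m2 - m1) \<le> c3"
      and qCd: "Cd * \<eta> powr (- 1 / (1 - \<gamma>)) < of_int (m2 - m1)"
      and nz: "\<And>i. orbit_pt \<alpha> x i \<noteq> 0" "\<And>i. orbit_pt \<alpha> (x + \<eta>) i \<noteq> 0"
    for x \<eta> :: real and m1 m2 :: int
  proof -
    let ?u = "\<lambda>i. orbit_pt \<alpha> x i" and ?v = "\<lambda>i. orbit_pt \<alpha> (x + \<eta>) i"
    define q where "q = real_of_int (m2 - m1)"
    have q0: "0 < q" using qCd Cd by (smt (verit) mult_nonneg_nonneg powr_ge_zero q_def)
    then have m12: "m1 < m2" by (simp add: q_def)
    have q1: "1 \<le> q" using m12 by (simp add: q_def)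
    have \<eta>q: "\<eta> \<le> c3 / q" using q3 q0 by (simp add: q_def field_simps)
    have \<eta>4: "\<eta> \<le> 1 / 4" using \<eta> \<eta>0 by simp
    have u01: "0 < ?u i" "?u i < 1" "0 < ?v i" "?v i < 1" for i
      using orbit_pt_pos nz[of i] by (auto simp: frac_lt_1)
    have gap: "c / q \<le> int_dist (?u i - ?u j)" "c / q \<le> \<bar>?u i - ?u j\<bar>"
      if "i \<in> {m1..<m2}" "j \<in> {m1..<m2}" "i \<noteq> j" for i j
    proof -
      have "\<bar>i - j\<bar> \<le> m2 - m1" using that by auto
      then have "\<bar>real_of_int (i - j)\<bar> \<le> q" unfolding q_def by linarith
      from orbit_gap[OF c that(3) this] show "c / q \<le> int_dist (?u i - ?u j)" "c / q \<le> \<bar>?u i - ?u j\<bar>" by auto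
    qed
    show ?thesis
    proof (cases "\<exists>k\<in>{m1..<m2}. 1 \<le> ?u k + \<eta>")
      case False
      have v: "?v i = ?u i + \<eta>" if "i \<in> {m1..<m2}" for i
        using False that \<eta> by (intro orbit_pt_shift) force+
      obtain k where k: "m1 \<le> k" "k < m2" "?u k \<le> 3 / c / q"
        unfolding q_def by (rule orbit_visits_zero[OF c m12, of x]) auto
      have kI: "k \<in> {m1..<m2}" using k by simp
      have pos: "0 \<le> ?u i powr \<gamma> - ?v i powr \<gamma>" if "i \<in> {m1..<m2}" for i
        using v[OF that] u01[of i] \<gamma> \<eta> by (simp add: powr_mono2')
      have "?u k + \<eta> \<le> (3 / c + 1) / q"
      proof -
        have "c3 / q \<le> 1 / q" using c3 q0 by (intro divide_right_mono) auto
        then show ?thesis using k(3) \<eta>q by (simp add: add_divide_distrib q_def)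
      qed
      then have "((3 / c + 1) / q) powr (\<gamma> - 1) \<le> (?u k + \<eta>) powr (\<gamma> - 1)"
        using u01[of k] \<eta> \<gamma> by (intro powr_mono2') auto
      then have "- \<gamma> * \<eta> * ((3 / c + 1) / q) powr (\<gamma> - 1) \<le> - \<gamma> * \<eta> * (?u k + \<eta>) powr (\<gamma> - 1)"
        using \<gamma> \<eta> by (intro mult_left_mono) (auto simp: mult_nonpos_nonneg)
      also have "\<dots> \<le> ?u k powr \<gamma> - ?v k powr \<gamma>"
        unfolding v[OF kI] by (rule powr_diff_bounds) (use u01 \<eta> \<gamma> in auto)
      also have "\<dots> \<le> (\<Sum>i\<in>{m1..<m2}. ?u i powr \<gamma> - ?v i powr \<gamma>)"
        using pos kI by (intro member_le_sum) auto
      finally have A: "- \<gamma> * \<eta> * ((3 / c + 1) / q) powr (\<gamma> - 1)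
          \<le> (\<Sum>i\<in>{m1..<m2}. ?u i powr \<gamma> - ?v i powr \<gamma>)" .
      have "(Cd * \<eta> powr (- \<beta>)) powr (1 - \<gamma>) \<le> q powr (1 - \<gamma>)"
        using qCd \<gamma> Cd by (intro powr_mono2) (auto simp: q_def \<beta>_def)
      moreover have "(Cd * \<eta> powr (- \<beta>)) powr (1 - \<gamma>) = Cd powr (1 - \<gamma>) * \<eta> powr (- 1)"
        using \<beta> Cd \<eta> by (simp add: powr_mult powr_powr)
      moreover have "Cd powr (1 - \<gamma>) = (3 / c + 1) powr (1 - \<gamma>) / (- \<gamma>)"
        using \<gamma> \<beta> c31 by (simp add: Cd_def powr_powr)
      ultimately have B: "(3 / c + 1) powr (1 - \<gamma>) / (- \<gamma>) / \<eta> \<le> q powr (1 - \<gamma>)"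
        using \<eta> by (simp add: powr_minus_divide)
      have "((3 / c + 1) / q) powr (\<gamma> - 1) = q powr (1 - \<gamma>) / (3 / c + 1) powr (1 - \<gamma>)"
      proof -
        have "((3 / c + 1) / q) powr (\<gamma> - 1) = (3 / c + 1) powr (- (1 - \<gamma>)) / q powr (- (1 - \<gamma>))"
          using c31 q0 by (simp add: powr_divide)
        then show ?thesis by (simp only: powr_minus) (simp add: field_simps)
      qed
      moreover have "1 / (- \<gamma> * \<eta>) \<le> q powr (1 - \<gamma>) / (3 / c + 1) powr (1 - \<gamma>)"
      proof -
        have p: "0 < (3 / c + 1) powr (1 - \<gamma>)" using c31 by simp
        have "1 / (- \<gamma> * \<eta>) = (3 / c + 1) powr (1 - \<gamma>) / (- \<gamma>) / \<eta> / (3 / c + 1) powr (1 - \<gamma>)"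
          using p by simp
        also have "\<dots> \<le> q powr (1 - \<gamma>) / (3 / c + 1) powr (1 - \<gamma>)"
          using B p by (intro divide_right_mono) auto
        finally show ?thesis .
      qed
      ultimately have "1 \<le> - \<gamma> * \<eta> * ((3 / c + 1) / q) powr (\<gamma> - 1)"
        using \<gamma> \<eta> mult_left_mono[of "1 / (- \<gamma> * \<eta>)" "((3 / c + 1) / q) powr (\<gamma> - 1)" "- \<gamma> * \<eta>"]
        by (simp add: mult_nonpos_nonneg)
      then show ?thesis using A by linarith
    next
      case True
      then obtain k where k: "k \<in> {m1..<m2}" "1 \<le> ?u k + \<eta>" by blast
      have \<eta>c: "\<eta> \<le> c / q / 2"
      proof -
        have "c3 / q \<le> (c / 2) / q" using c3 q0 by (intro divide_right_mono) auto
        then show ?thesis using \<eta>q by (simp add: field_simps)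
      qed
      define g where "g = c / q / 2"
      have g0: "0 < g" using c0 q0 by (simp add: g_def)
      have cq: "c / q = 2 * g" by (simp add: g_def)
      have \<eta>g: "\<eta> \<le> g" using \<eta>c by (simp add: g_def)
      let ?I = "{m1..<m2} - {k}"
      have far: "g \<le> ?u i \<and> ?u i + \<eta> < 1" if i: "i \<in> ?I" for i
      proof -
        have "2 * g \<le> int_dist (?u i - ?u k)" using gap(1)[of i k] i k cq by auto
        moreover have "int_dist (?u i - ?u k) \<le> \<bar>?u i - ?u k - of_int (-1)\<bar>" by (rule int_dist_le)
        moreover have "\<bar>?u i - ?u k - of_int (-1)\<bar> \<le> ?u i + \<eta>" using u01[of i] u01[of k] k by simp
        ultimately have 1: "g \<le> ?u i" using \<eta>g by linarith
        have "2 * g \<le> \<bar>?u i - ?u k\<bar>" using gap(2)[of i k] i k cq by auto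
        then have "?u i + \<eta> < 1" using u01[of k] u01[of i] k \<eta>g g0 by linarith
        then show ?thesis using 1 by simp
      qed
      have "(\<Sum>i\<in>?I. ?u i powr \<gamma> - ?v i powr \<gamma>) \<le> \<eta> * Z * g powr (\<gamma> - 1)"
        unfolding Z_def
      proof (rule drift_le)
        fix i j assume "i \<in> ?I" "j \<in> ?I" "i \<noteq> j"
        then show "g \<le> \<bar>?u i - ?u j\<bar>" using gap(2)[of i j] cq g0 by auto
      qed (use far g0 \<gamma> \<eta> in auto)
      also have "\<dots> \<le> \<eta> * Z * (\<eta> * (c / (2 * c3))) powr (\<gamma> - 1)"
      proof -
        have "\<eta> * (c / (2 * c3)) \<le> g"
        proof -
          have "\<eta> * (c / (2 * c3)) \<le> (c3 / q) * (c / (2 * c3))"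
            using \<eta>q c3 c0 by (intro mult_right_mono) auto
          also have "\<dots> = g" using c3 by (simp add: g_def)
          finally show ?thesis .
        qed
        then have "g powr (\<gamma> - 1) \<le> (\<eta> * (c / (2 * c3))) powr (\<gamma> - 1)"
          using \<eta> c0 c3 \<gamma> by (intro powr_mono2') auto
        then show ?thesis using \<eta> \<open>0 \<le> Z\<close> by (intro mult_left_mono) auto
      qed
      also have "\<dots> = (\<eta> * \<eta> powr (\<gamma> - 1)) * (Z * (c / (2 * c3)) powr (\<gamma> - 1))"
      proof -
        have "(\<eta> * (c / (2 * c3))) powr (\<gamma> - 1) = \<eta> powr (\<gamma> - 1) * (c / (2 * c3)) powr (\<gamma> - 1)"
          by (rule powr_mult)
        then show ?thesis by (simp only: mult_ac)
      qed
      also have "\<eta> * \<eta> powr (\<gamma> - 1) = \<eta> powr \<gamma>" using \<eta> by (simp add: powr_mult_base)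
      also have "\<eta> powr \<gamma> * (Z * (c / (2 * c3)) powr (\<gamma> - 1)) \<le> \<eta> powr \<gamma> * (1 / 2)"
        using c3Z by (intro mult_left_mono) auto
      finally have S: "(\<Sum>i\<in>?I. ?u i powr \<gamma> - ?v i powr \<gamma>) \<le> \<eta> powr \<gamma> / 2" by simp
      have vk: "?v k = ?u k + \<eta> - 1"
      proof -
        have "frac \<eta> = \<eta>" using \<eta> \<eta>4 by (simp add: frac_eq)
        moreover have "x + \<eta> + of_int k * \<alpha> = (x + of_int k * \<alpha>) + \<eta>" by simp
        ultimately show ?thesis using k(2) frac_add[of "x + of_int k * \<alpha>" \<eta>]
          by (simp only:) auto
      qed
      have "?v k \<le> \<eta>" using vk u01[of k] by simp
      then have vk': "\<eta> powr \<gamma> \<le> ?v k powr \<gamma>" using u01[of k] \<gamma> by (intro powr_mono2') auto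
      have "?u k powr \<gamma> \<le> (1 / 2) powr \<gamma>" using k(2) \<eta>4 \<gamma> by (intro powr_mono2') auto
      also have "\<dots> \<le> (1 / 2) powr (-1)" using \<gamma> by (intro powr_mono') auto
      also have "\<dots> = 2" by (simp add: powr_minus_divide)
      finally have uk: "?u k powr \<gamma> \<le> 2" .
      have "6 = (6 powr (1 / \<gamma>)) powr \<gamma>" using \<gamma> by (simp add: powr_powr)
      also have "\<dots> \<le> \<eta> powr \<gamma>" using \<eta> \<gamma> by (intro powr_mono2') (auto simp: \<eta>0_def)
      finally have six: "6 \<le> \<eta> powr \<gamma>" .
      have "(\<Sum>i\<in>{m1..<m2}. ?u i powr \<gamma> - ?v i powr \<gamma>)
          = (?u k powr \<gamma> - ?v k powr \<gamma>) + (\<Sum>i\<in>?I. ?u i powr \<gamma> - ?v i powr \<gamma>)"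
        using k by (intro sum.remove) auto
      then show ?thesis using S vk' uk six by linarith
    qed
  qed
  show thesis by (rule that[of c3 \<eta>0 Cd]) (use c3 \<eta>0 Cd main in auto)
qed


section \<open>Pairs with a close visit to the singularity\<close>

text \<open>A weak form of Lebesgue's density theorem. Approximate \<open>E\<close> by a compact subset and an open
  superset; of the cells of a fine grid that meet the compact set, all inside the open set, at
  least one is filled by \<open>E\<close> in the required proportion.\<close>
lemma ex_density_interval:
  fixes E :: "real set"
  assumes E: "E \<in> lmeasurable" "0 < measure lebesgue E" "bounded E" and \<omega>: "0 < \<omega>" and h0: "0 < h0"
  obtains e h where "0 < h" "h < h0" "measure lebesgue ({e..<e + h} - E) \<le> \<omega> * h"
proof -
  define \<mu> where "\<mu> = measure lebesgue E"
  define d where "d = min (\<mu> / 2) (\<omega> * \<mu> / 4)"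
  have d: "0 < d" using E \<omega> by (simp add: d_def \<mu>_def)
  obtain U where U: "open U" "E \<subseteq> U" "U - E \<in> lmeasurable" "measure lebesgue (U - E) < d"
  proof -
    obtain U where U: "open U" "E \<subseteq> U" "U - E \<in> lmeasurable" "emeasure lebesgue (U - E) < ennreal d"
      using sets_lebesgue_outer_open[OF fmeasurableD[OF E(1)] d] by blast
    then show thesis using d by (intro that[of U]) (auto simp: emeasure_eq_measure2 ennreal_less_iff)
  qed
  obtain K where K: "closed K" "K \<subseteq> E" "E - K \<in> lmeasurable" "measure lebesgue (E - K) < d"
  proof -
    obtain K where K: "closed K" "K \<subseteq> E" "E - K \<in> lmeasurable" "emeasure lebesgue (E - K) < ennreal d"
      using sets_lebesgue_inner_closed[OF fmeasurableD[OF E(1)] d] by blast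
    then show thesis using d by (intro that[of K]) (auto simp: emeasure_eq_measure2 ennreal_less_iff)
  qed
  have cK: "compact K" using K E(3) bounded_subset compact_eq_bounded_closed by blast
  have mK: "K \<in> lmeasurable" using cK by (rule lmeasurable_compact)
  have "\<mu> = measure lebesgue K + measure lebesgue (E - K)"
    unfolding \<mu>_def using measure_Un2[OF mK E(1)] K(2) by (simp add: Un_absorb1)
  then have K2: "\<mu> / 2 \<le> measure lebesgue K" using K(4) by (simp add: d_def)
  have UK: "U - K \<in> lmeasurable" "measure lebesgue (U - K) < \<omega> * \<mu> / 2"
  proof -
    have eq: "U - K = (U - E) \<union> (E - K)" using U(2) K(2) by blast
    show "U - K \<in> lmeasurable" unfolding eq using U K by (intro fmeasurable.Un) auto
    have "measure lebesgue (U - K) \<le> measure lebesgue (U - E) + measure lebesgue (E - K)"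
      unfolding eq using U K by (intro measure_Un_le) auto
    then show "measure lebesgue (U - K) < \<omega> * \<mu> / 2" using U K by (simp add: d_def)
  qed
  obtain \<epsilon> where \<epsilon>: "0 < \<epsilon>" "{y. \<exists>x\<in>K. dist x y < \<epsilon>} \<subseteq> U"
  proof -
    have "K \<subseteq> U" using U K by blast
    then obtain \<epsilon> where "0 < \<epsilon>" "(\<Union>x\<in>K. ball x \<epsilon>) \<subseteq> U"
      using compact_subset_open_imp_ball_epsilon_subset[OF cK U(1)] by metis
    then show thesis by (intro that[of \<epsilon>]) (auto simp: ball_def)
  qed
  define h where "h = min \<epsilon> h0 / 2"
  have h: "0 < h" "h < \<epsilon>" "h < h0" using \<epsilon> h0 by (auto simp: h_def)
  define J where "J i = {of_int i * h..<of_int i * h + h}" for i :: int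
  define q where "q x = \<lfloor>x / h\<rfloor>" for x
  have xJ: "x \<in> J (q x)" for x
  proof -
    have "of_int (q x) \<le> x / h" "x / h < of_int (q x) + 1" unfolding q_def by linarith+
    then show ?thesis using h by (simp add: J_def field_simps)
  qed
  have Jq: "q x = i" if "x \<in> J i" for x i
  proof -
    have "of_int i \<le> x / h" "x / h < of_int i + 1" using that h by (auto simp: J_def field_simps)
    then show ?thesis unfolding q_def by linarith
  qed
  define Q where "Q = q ` K"
  have finQ: "finite Q"
  proof -
    obtain B where B: "\<And>x. x \<in> K \<Longrightarrow> \<bar>x\<bar> \<le> B" using compact_imp_bounded[OF cK] by (auto simp: bounded_real)
    have "Q \<subseteq> {\<lfloor>- B / h\<rfloor>..\<lfloor>B / h\<rfloor>}"
    proof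
      fix i assume "i \<in> Q"
      then obtain x where x: "x \<in> K" "i = q x" by (auto simp: Q_def)
      have "- B \<le> x" "x \<le> B" using B[OF x(1)] by auto
      then have "- B / h \<le> x / h" "x / h \<le> B / h" using h by (intro divide_right_mono; simp)+
      then show "i \<in> {\<lfloor>- B / h\<rfloor>..\<lfloor>B / h\<rfloor>}" unfolding x(2) q_def by (auto intro: floor_mono)
    qed
    then show ?thesis by (rule finite_subset) simp
  qed
  have neQ: "Q \<noteq> {}" using K2 E(2) by (auto simp: Q_def \<mu>_def)
  have Jm: "J i \<in> lmeasurable" "measure lebesgue (J i) = h" for i
    using h unfolding J_def by (auto intro!: bounded_set_imp_lmeasurable)
  have JU: "J i \<subseteq> U" if iQ: "i \<in> Q" for i
  proof
    fix y assume y: "y \<in> J i"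
    obtain x where x: "x \<in> K" "i = q x" using iQ by (auto simp: Q_def)
    have "dist x y < \<epsilon>" using xJ[of x] y h x(2) by (auto simp: J_def dist_real_def)
    then show "y \<in> U" using \<epsilon>(2) x(1) by blast
  qed
  have KJ: "K \<subseteq> (\<Union>i\<in>Q. J i)" using xJ by (auto simp: Q_def)
  have "\<exists>i\<in>Q. measure lebesgue (J i - K) \<le> \<omega> * h"
  proof (rule ccontr)
    assume "\<not> ?thesis"
    then have "(\<Sum>i\<in>Q. \<omega> * h) < (\<Sum>i\<in>Q. measure lebesgue (J i - K))"
      using finQ neQ by (intro sum_strict_mono) auto
    also have "\<dots> = measure lebesgue (\<Union>i\<in>Q. J i - K)"
    proof (rule measure_finite_Union[symmetric])
      show "disjoint_family_on (\<lambda>i. J i - K) Q" using Jq by (auto simp: disjoint_family_on_def)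
      show "(\<lambda>i. J i - K) ` Q \<subseteq> sets lebesgue" using Jm mK by (auto simp: image_subset_iff)
      show "emeasure lebesgue (J i - K) \<noteq> \<infinity>" if "i \<in> Q" for i
        unfolding infinity_ennreal_def by (rule fmeasurableD2[OF fmeasurable.Diff[OF Jm(1) mK]])
    qed (rule finQ)
    also have "\<dots> \<le> measure lebesgue (U - K)"
    proof (rule measure_mono_fmeasurable)
      show "(\<Union>i\<in>Q. J i - K) \<subseteq> U - K" using JU by blast
      show "(\<Union>i\<in>Q. J i - K) \<in> sets lebesgue" using Jm mK finQ by (intro sets.finite_UN sets.Diff) auto
    qed (rule UK)
    also have "\<dots> \<le> \<omega> * measure lebesgue K"
    proof -
      have "\<omega> * (\<mu> / 2) \<le> \<omega> * measure lebesgue K" using K2 \<omega> by (intro mult_left_mono) auto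
      then show ?thesis using UK(2) by linarith
    qed
    also have "measure lebesgue K \<le> measure lebesgue (\<Union>i\<in>Q. J i)"
      using KJ Jm mK finQ by (intro measure_mono_fmeasurable fmeasurable.finite_UN) auto
    also have "\<dots> \<le> (\<Sum>i\<in>Q. measure lebesgue (J i))"
      using Jm finQ by (intro measure_UNION_le) auto
    finally show False using \<omega> Jm by (simp add: sum_distrib_left mult_ac)
  qed
  then obtain i where i: "i \<in> Q" "measure lebesgue (J i - K) \<le> \<omega> * h" by blast
  have "measure lebesgue (J i - E) \<le> measure lebesgue (J i - K)"
    using K(2) Jm mK E(1) by (intro measure_mono_fmeasurable) auto
  then show thesis using i(2) h that[of h "of_int i * h"] by (simp add: J_def)
qed

text \<open>The points of the interval that are outside \<open>E\<close>, and the translate of this set by \<open>- \<delta>\<close>, are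
  too small to cover the interval shortened by \<open>\<delta>\<close>.\<close>
lemma ex_pair_in_interval:
  fixes E :: "real set"
  assumes E: "E \<in> sets lebesgue" and l: "0 < l" and \<delta>: "0 \<le> \<delta>" "\<delta> \<le> l / 4"
    and m: "measure lebesgue ({a<..<a + l} - E) \<le> l / 8"
  obtains x where "x \<in> {a<..<a + l}" "x \<in> E" "x + \<delta> \<in> E"
proof (rule ccontr)
  assume none: "\<not> thesis"
  define B where "B = {a<..<a + l} - E"
  have B: "B \<in> lmeasurable" unfolding B_def using E by (intro fmeasurable_Diff) auto
  have B': "(\<lambda>x. - \<delta> + x) ` B \<in> lmeasurable" using B by (rule measurable_translation)
  have "{a<..<a + l - \<delta>} \<subseteq> B \<union> (\<lambda>x. - \<delta> + x) ` B"
  proof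
    fix x assume x: "x \<in> {a<..<a + l - \<delta>}"
    show "x \<in> B \<union> (\<lambda>x. - \<delta> + x) ` B"
    proof (cases "x \<in> E")
      case True
      then have "x + \<delta> \<notin> E" using none that[of x] x \<delta> by auto
      then have "x + \<delta> \<in> B" using x \<delta> by (auto simp: B_def)
      then show ?thesis by (auto intro: image_eqI[of _ _ "x + \<delta>"])
    qed (use x \<delta> in \<open>auto simp: B_def\<close>)
  qed
  then have "measure lebesgue {a<..<a + l - \<delta>} \<le> measure lebesgue (B \<union> (\<lambda>x. - \<delta> + x) ` B)"
    using B B' by (intro measure_mono_fmeasurable) auto
  also have "\<dots> \<le> measure lebesgue B + measure lebesgue ((\<lambda>x. - \<delta> + x) ` B)"
    using B B' by (intro measure_Un_le) auto
  also have "\<dots> = 2 * measure lebesgue B" by (simp add: measure_translation_subtract)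
  finally show False using m \<delta> l by (simp add: B_def)
qed

text \<open>The points whose orbit visits \<open>(0, \<theta> / j)\<close> at time \<open>\<sigma> * j\<close> form an interval of length \<open>\<theta> / j\<close>.
  For a density interval of length \<open>h\<close> some \<open>j\<close> of order \<open>1 / h\<close> puts this interval inside, where
  it takes a fixed proportion; so \<open>E\<close> fills most of it if the density is high enough depending
  on \<open>\<theta>\<close>. The sign \<open>\<sigma>\<close> covers flow times of both signs.\<close>
lemma ex_pair_near_singularity:
  assumes c: "badly_approximable c \<alpha>" and \<sigma>: "\<bar>\<sigma>\<bar> = (1::int)"
    and E: "E \<in> lmeasurable" "0 < measure lebesgue E" "bounded E"
    and \<theta>: "0 < \<theta>" "\<theta> \<le> 1"
    and \<delta>: "\<And>j. j0 \<le> j \<Longrightarrow> 0 \<le> \<delta> j \<and> \<delta> j \<le> \<theta> / (4 * real j)"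
  obtains j :: nat and x where "j0 \<le> j" "0 < j" "x \<in> E" "x + \<delta> j \<in> E" "orbit_pt \<alpha> x (\<sigma> * int j) < \<theta> / real j"
proof -
  have c0: "0 < c" "c \<le> 1/2" using c badly_approximable_le_half[OF c] by (auto simp: badly_approximable_def)
  define C where "C = 3 / c"
  have C: "1 \<le> C" using c0 by (simp add: C_def)
  define \<omega> where "\<omega> = \<theta> / (48 * C)"
  have \<omega>: "0 < \<omega>" using \<theta> C by (simp add: \<omega>_def)
  have "0 < 1 / (real j0 + 1)" by simp
  then obtain e h where h: "0 < h" "h < 1 / (real j0 + 1)" "measure lebesgue ({e..<e + h} - E) \<le> \<omega> * h"
    using ex_density_interval[OF E \<omega>, of "1 / (real j0 + 1)"] by metis
  have h1: "h < 1" using h(2) by (smt (verit) divide_le_eq_1_pos of_nat_0_le_iff)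
  define q where "q = nat \<lceil>2 * C / h\<rceil>"
  have q: "2 * C / h \<le> real q" "real q \<le> 3 * C / h"
  proof -
    have p: "0 < 2 * C / h" using C h by simp
    then show "2 * C / h \<le> real q" unfolding q_def by linarith
    have "real q < 2 * C / h + 1" using p unfolding q_def by linarith
    moreover have "1 \<le> C / h" using C h h1 by simp
    moreover have "3 * C / h = 2 * C / h + C / h" by (simp add: add_divide_distrib[symmetric])
    ultimately show "real q \<le> 3 * C / h" by linarith
  qed
  have q0: "0 < q" using q(1) C h by (metis divide_pos_pos gr0I less_le_trans mult_pos_pos not_less of_nat_0 zero_less_numeral zero_less_one)
  have jq: "j0 \<le> q"
  proof -
    have "real j0 < 1 / h" using h by (simp add: field_simps)
    also have "\<dots> \<le> 2 * C / h" using C h by (intro divide_right_mono) auto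
    finally show ?thesis using q by linarith
  qed
  define \<alpha>' where "\<alpha>' = - (of_int \<sigma> * \<alpha>)"
  have "\<sigma> = 1 \<or> \<sigma> = -1" using \<sigma> by linarith
  then have c': "badly_approximable c \<alpha>'"
    using c badly_approximable_uminus[OF c] by (auto simp: \<alpha>'_def)
  obtain i :: nat where i: "i < q" "frac (- e + real q * \<alpha>' + real i * \<alpha>') \<le> 3 / c / q"
    using orbit_visits_arc[OF c' q0] by blast
  define j where "j = q + i"
  define v where "v = frac (- e + real j * \<alpha>')"
  have j: "j0 \<le> j" "0 < j" "q \<le> j" "j < 2 * q" using i q0 jq by (auto simp: j_def)
  have v: "0 \<le> v" "v \<le> h / 2"
  proof -
    show "0 \<le> v" by (simp add: v_def)
    have "v \<le> C / q" using i(2) by (simp add: v_def j_def C_def algebra_simps)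
    also have "\<dots> \<le> C / (2 * C / h)" using q(1) q0 C h by (intro divide_left_mono mult_pos_pos divide_pos_pos) auto
    also have "\<dots> = h / 2" using C by simp
    finally show "v \<le> h / 2" .
  qed
  define a where "a = e + v"
  define l where "l = \<theta> / real j"
  have l: "0 < l" using \<theta> j by (simp add: l_def)
  have "l \<le> \<theta> / q" unfolding l_def using j q0 \<theta> by (intro divide_left_mono) auto
  also have "\<dots> \<le> C / q" using \<theta> C by (intro divide_right_mono) auto
  also have "\<dots> \<le> C / (2 * C / h)" using q(1) q0 C h by (intro divide_left_mono mult_pos_pos divide_pos_pos) auto
  also have "\<dots> = h / 2" using C by simp
  finally have lh: "l \<le> h / 2" .
  have sub: "{a<..<a + l} - E \<subseteq> {e..<e + h} - E" using v lh by (auto simp: a_def)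
  have "measure lebesgue ({a<..<a + l} - E) \<le> measure lebesgue ({e..<e + h} - E)"
    using E(1) sub by (intro measure_mono_fmeasurable fmeasurable_Diff bounded_set_imp_lmeasurable) auto
  also have "\<dots> \<le> \<omega> * h" by (rule h)
  also have "\<dots> \<le> l / 8"
  proof -
    have "real j \<le> 6 * C / h"
    proof -
      have "6 * C / h = 2 * (3 * C / h)" by simp
      then show ?thesis using q(2) j(4) by linarith
    qed
    then have "\<theta> / (6 * C / h) \<le> l" unfolding l_def using j \<theta> C h by (intro divide_left_mono) auto
    then show ?thesis using C h by (simp add: \<omega>_def field_simps)
  qed
  finally have m: "measure lebesgue ({a<..<a + l} - E) \<le> l / 8" .
  have d: "0 \<le> \<delta> j" "\<delta> j \<le> l / 4" using \<delta>[OF j(1)] by (auto simp: l_def)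
  obtain x where x: "x \<in> {a<..<a + l}" "x \<in> E" "x + \<delta> j \<in> E"
    using ex_pair_in_interval[OF _ l d m] E(1) by blast
  have "frac (x + of_int (\<sigma> * int j) * \<alpha>) = x - a"
  proof -
    have "x + of_int (\<sigma> * int j) * \<alpha> = (x - a) + of_int (- \<lfloor>- e + real j * \<alpha>'\<rfloor>)"
      by (simp add: a_def v_def frac_def \<alpha>'_def algebra_simps)
    then have "frac (x + of_int (\<sigma> * int j) * \<alpha>) = frac (x - a)" by (simp only: frac_add_of_int_right)
    also have "\<dots> = x - a" using x(1) lh h1 by (simp add: frac_eq)
    finally show ?thesis .
  qed
  then have "orbit_pt \<alpha> x (\<sigma> * int j) < \<theta> / real j" using x(1) by (simp add: l_def)
  then show thesis using that j x by blast
qed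


text \<open>A Borel--Cantelli bound: since \<open>v < -1\<close>, the visits at distance less than
  \<open>(\<tau> * (\<bar>m\<bar> + m1)) powr v\<close> at time \<open>m\<close> have summable measure. With \<open>v = 1 / \<gamma>\<close> this says that outside
  a small set the tower met at time \<open>m\<close> has height at most of order \<open>\<tau> * (\<bar>m\<bar> + m1)\<close>.\<close>
lemma ex_small_close_visit_set:
  fixes \<alpha> \<tau> v :: real
  assumes \<tau>: "0 < \<tau>" and v: "v < -1"
  obtains m1 :: nat and D where "0 < m1" "D \<in> sets borel" "D \<in> lmeasurable" "measure lebesgue D \<le> 1 / 4"
    "\<And>x m. x \<in> {0..<1} \<Longrightarrow> x \<notin> D \<Longrightarrow> (\<tau> * (\<bar>real_of_int m\<bar> + real m1)) powr v \<le> orbit_pt \<alpha> x m"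
proof -
  define g where "g n = 4 * (\<tau> powr v * real n powr v)" for n
  have sg: "summable g" unfolding g_def using v by (intro summable_mult) (auto simp: summable_real_powr_iff)
  have "\<exists>N. \<forall>n\<ge>N. norm (\<Sum>i. g (i + n)) < 1 / 4"
    using sg by (intro suminf_exist_split) auto
  then obtain N where "\<forall>n\<ge>N. norm (\<Sum>i. g (i + n)) < 1 / 4" by blast
  then obtain m1 where m1: "norm (\<Sum>i. g (i + m1)) < 1 / 4" "0 < m1"
    by (meson le_SucI le_refl zero_less_Suc)
  define w where "w m = (\<tau> * (\<bar>real_of_int m\<bar> + real m1)) powr v" for m :: int
  define C where "C m = {- frac (of_int m * \<alpha>)..<- frac (of_int m * \<alpha>) + w m}
      \<union> {1 - frac (of_int m * \<alpha>)..<1 - frac (of_int m * \<alpha>) + w m}" for m :: int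
  have Cm: "emeasure lebesgue (C m) \<le> ennreal (2 * w m)" "C m \<in> sets borel" for m
  proof -
    have "emeasure lebesgue (C m) \<le> ennreal (w m) + ennreal (w m)"
      unfolding C_def by (rule order_trans[OF emeasure_subadditive]) (auto simp: w_def)
    then show "emeasure lebesgue (C m) \<le> ennreal (2 * w m)"
      by (simp add: w_def flip: ennreal_plus)
    show "C m \<in> sets borel" by (simp add: C_def)
  qed
  define D where "D = (\<Union>n. C (int n) \<union> C (- int n))"
  have D: "D \<in> sets borel" unfolding D_def using Cm by (intro sets.countable_UN) auto
  have "emeasure lebesgue D \<le> (\<Sum>n. emeasure lebesgue (C (int n) \<union> C (- int n)))"
    unfolding D_def using Cm by (intro emeasure_subadditive_countably) auto
  also have "\<dots> \<le> (\<Sum>n. ennreal (g (n + m1)))"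
  proof (intro suminf_le summableI)
    fix n
    have "emeasure lebesgue (C (int n) \<union> C (- int n)) \<le> emeasure lebesgue (C (int n)) + emeasure lebesgue (C (- int n))"
      using Cm by (intro emeasure_subadditive) auto
    also have "\<dots> \<le> ennreal (2 * w (int n)) + ennreal (2 * w (- int n))"
      by (intro add_mono Cm)
    also have "\<dots> = ennreal (g (n + m1))"
      by (simp add: w_def g_def powr_mult flip: ennreal_plus)
    finally show "emeasure lebesgue (C (int n) \<union> C (- int n)) \<le> ennreal (g (n + m1))" .
  qed
  also have "\<dots> = ennreal (\<Sum>n. g (n + m1))"
    by (intro suminf_ennreal2 summable_ignore_initial_segment sg) (simp add: g_def)
  also have "\<dots> \<le> ennreal (1 / 4)" using m1 by (intro ennreal_leI) auto
  finally have m: "emeasure lebesgue D \<le> ennreal (1 / 4)" .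
  have Dl: "D \<in> lmeasurable" using m D by (auto intro!: fmeasurableI simp: less_top[symmetric] top_unique)
  show thesis
  proof (rule that[OF m1(2) D Dl])
    show "measure lebesgue D \<le> 1 / 4" using m Dl by (simp add: emeasure_eq_measure2)
    fix x m assume x: "x \<in> {0..<1}" "x \<notin> D"
    have "m = int (nat \<bar>m\<bar>) \<or> m = - int (nat \<bar>m\<bar>)" by auto
    then obtain n where "m = int n \<or> m = - int n" by blast
    then have "C m \<subseteq> C (int n) \<union> C (- int n)" by auto
    also have "\<dots> \<subseteq> D" unfolding D_def by blast
    finally have xC: "x \<notin> C m" using x by blast
    show "(\<tau> * (\<bar>real_of_int m\<bar> + real m1)) powr v \<le> orbit_pt \<alpha> x m"
    proof (rule ccontr)
      assume "\<not> ?thesis"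
      then have lt: "orbit_pt \<alpha> x m < w m" by (simp add: w_def)
      define b where "b = frac (of_int m * \<alpha>)"
      have b: "0 \<le> b" "b < 1" by (auto simp: b_def frac_lt_1)
      have "orbit_pt \<alpha> x m = (if x + b < 1 then x + b else x + b - 1)"
        using x frac_add[of x "of_int m * \<alpha>"] by (simp add: b_def frac_eq)
      then have "x \<in> C m" using lt x b unfolding C_def b_def[symmetric] by (auto split: if_splits)
      then show False using xC by simp
    qed
  qed
qed


section \<open>Counting in dyadic classes\<close>

lemma sum_power_tail_le:
  fixes x :: real
  assumes "finite A" "0 \<le> x" "x < 1" and A: "\<And>a. a \<in> A \<Longrightarrow> a0 \<le> a"
  shows "(\<Sum>a\<in>A. x ^ a) \<le> x ^ a0 / (1 - x)"
proof (cases "A = {}")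
  case False
  have "(\<Sum>a\<in>A. x ^ a) \<le> (\<Sum>a=a0..Max A. x ^ a)"
    using assms by (intro sum_mono2) auto
  also have "\<dots> \<le> x ^ a0 / (1 - x)"
    using assms by (auto simp: sum_gp divide_right_mono)
  finally show ?thesis .
qed (use assms in simp)

lemma sum_power_le_last:
  fixes z :: real
  assumes "finite A" "1 < z" and A: "\<And>a. a \<in> A \<Longrightarrow> z ^ a \<le> B" and B: "0 \<le> B"
  shows "(\<Sum>a\<in>A. z ^ a) \<le> z / (z - 1) * B"
proof (cases "A = {}")
  case False
  have "(\<Sum>a\<in>A. z ^ a) \<le> (\<Sum>a=0..Max A. z ^ a)"
    using assms by (intro sum_mono2) auto
  also have "\<dots> = (1 - z ^ Suc (Max A)) / (1 - z)"
    using assms by (subst sum_gp) auto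
  also have "\<dots> = (z ^ Suc (Max A) - 1) / (z - 1)"
    using assms by (metis minus_diff_eq minus_divide_divide)
  also have "\<dots> \<le> (z * B) / (z - 1)"
    using assms A[OF Max_in[OF assms(1) False]]
    by (intro divide_right_mono) (auto intro: order_trans[of _ "z * z ^ Max A"])
  finally show ?thesis by simp
qed (use assms in simp)

lemma card_by_fibres: "finite A \<Longrightarrow> real (card A) = (\<Sum>i\<in>g ` A. real (card {n \<in> A. g n = i}))"
  using sum.group[of A "g ` A" g "\<lambda>_. 1::real"] by simp

text \<open>In the class \<open>a\<close> there are at most \<open>L / (b * 2 ^ a) + 2\<close> blocks, with at most \<open>W * z ^ a\<close> elements
  each. The main terms form a geometric series of ratio \<open>z / 2 < 1\<close> and are controlled by the
  smallest class, the boundary terms one of ratio \<open>z > 1\<close>, controlled by the largest.\<close>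
lemma card_dyadic_classes:
  fixes G :: "nat set" and h :: "nat \<Rightarrow> nat" and z b W B :: real
  assumes G: "G \<subseteq> {K..K+L}" and z: "1 < z" "z < 2" and b: "0 < b" and W: "0 \<le> W" and B: "0 \<le> B"
    and h: "\<And>n. n \<in> G \<Longrightarrow> a0 \<le> h n \<and> z ^ h n \<le> B"
    and block: "\<And>a i. a0 \<le> a \<Longrightarrow> real (card {n \<in> G. h n = a \<and> \<lfloor>real n / (b * 2 ^ a)\<rfloor> = i}) \<le> W * z ^ a"
  shows "real (card G) \<le> W * (real L / b * ((z / 2) ^ a0 / (1 - z / 2)) + 2 * (z / (z - 1) * B))"
proof -
  have fin: "finite G" using G finite_subset by blast
  have cls: "real (card {n \<in> G. h n = a}) \<le> W * (real L / b * (z / 2) ^ a + 2 * z ^ a)"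
    if a: "a0 \<le> a" for a
  proof -
    define D where "D = b * 2 ^ a"
    have D: "0 < D" using b by (simp add: D_def)
    define C where "C = {n \<in> G. h n = a}"
    define q where "q n = \<lfloor>real n / D\<rfloor>" for n :: nat
    have "q ` C \<subseteq> {\<lfloor>real K / D\<rfloor>..\<lfloor>real (K + L) / D\<rfloor>}"
    proof
      fix i assume "i \<in> q ` C"
      then obtain n where n: "i = q n" "n \<in> G" by (auto simp: C_def)
      then have "real K \<le> real n" "real n \<le> real (K + L)" using G by auto
      then have "real K / D \<le> real n / D" "real n / D \<le> real (K + L) / D"
        using D by (auto intro!: divide_right_mono)
      then show "i \<in> {\<lfloor>real K / D\<rfloor>..\<lfloor>real (K + L) / D\<rfloor>}"
        unfolding n(1) q_def by (auto intro: floor_mono)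
    qed
    then have "card (q ` C) \<le> card {\<lfloor>real K / D\<rfloor>..\<lfloor>real (K + L) / D\<rfloor>}" by (intro card_mono) auto
    moreover have "\<lfloor>real K / D\<rfloor> \<le> \<lfloor>real (K + L) / D\<rfloor>"
      using D by (intro floor_mono divide_right_mono) auto
    ultimately have "real (card (q ` C)) \<le> real_of_int (\<lfloor>real (K + L) / D\<rfloor> - \<lfloor>real K / D\<rfloor> + 1)"
      by simp
    also have "\<dots> \<le> real (K + L) / D - real K / D + 2" by linarith
    also have "\<dots> = real L / D + 2" by (simp add: add_divide_distrib)
    finally have J: "real (card (q ` C)) \<le> real L / D + 2" .
    have "real (card C) = (\<Sum>i\<in>q ` C. real (card {n \<in> C. q n = i}))"
      using fin by (intro card_by_fibres) (simp add: C_def)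
    also have "\<dots> \<le> (\<Sum>i\<in>q ` C. W * z ^ a)"
      using block[OF a] by (intro sum_mono) (simp add: C_def q_def D_def)
    also have "\<dots> = real (card (q ` C)) * (W * z ^ a)" by simp
    also have "\<dots> \<le> (real L / D + 2) * (W * z ^ a)"
      using J W z by (intro mult_right_mono) auto
    also have "\<dots> = W * (real L / b * (z / 2) ^ a + 2 * z ^ a)"
      using b by (simp add: D_def field_simps)
    finally show ?thesis by (simp add: C_def)
  qed
  have "real (card G) = (\<Sum>a\<in>h ` G. real (card {n \<in> G. h n = a}))" by (rule card_by_fibres[OF fin])
  also have "\<dots> \<le> (\<Sum>a\<in>h ` G. W * (real L / b * (z / 2) ^ a + 2 * z ^ a))"
    using h by (intro sum_mono cls) auto
  also have "\<dots> = W * (real L / b * (\<Sum>a\<in>h ` G. (z / 2) ^ a) + 2 * (\<Sum>a\<in>h ` G. z ^ a))"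
    by (simp only: sum.distrib flip: sum_distrib_left)
  also have "\<dots> \<le> W * (real L / b * ((z / 2) ^ a0 / (1 - z / 2)) + 2 * (z / (z - 1) * B))"
    using fin h z W b B
    by (intro mult_left_mono add_mono sum_power_tail_le sum_power_le_last) auto
  finally show ?thesis .
qed

lemma dyadic_index:
  fixes \<eta> :: real
  assumes "0 < \<eta>" "\<eta> < 1 / 2 ^ a0"
  defines "a \<equiv> nat \<lfloor>- log 2 \<eta>\<rfloor>"
  shows "a0 \<le> a" "1 / 2 ^ Suc a < \<eta>" "\<eta> \<le> 1 / 2 ^ a"
proof -
  have "log 2 \<eta> < log 2 (1 / 2 ^ a0)" using assms by simp
  then have l: "log 2 \<eta> < - real a0" by (simp add: log_divide log_nat_power)
  then have "int a0 \<le> \<lfloor>- log 2 \<eta>\<rfloor>" by (simp add: le_floor_iff)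
  then show "a0 \<le> a" by (simp add: a_def nat_le_iff le_nat_iff)
  have a: "real a \<le> - log 2 \<eta>" "- log 2 \<eta> < real a + 1"
    unfolding a_def using l by linarith+
  have \<eta>: "\<eta> = 2 powr (log 2 \<eta>)" using assms by simp
  have "2 powr (- real (Suc a)) < 2 powr (log 2 \<eta>)" using a by simp
  moreover have "2 powr (- real (Suc a)) = 1 / 2 ^ Suc a"
    unfolding powr_minus_divide by (subst powr_realpow) simp_all
  ultimately show "1 / 2 ^ Suc a < \<eta>" using \<eta> by simp
  have "2 powr (log 2 \<eta>) \<le> 2 powr (- real a)" using a by simp
  moreover have "2 powr (- real a) = 1 / 2 ^ a" by (simp add: powr_minus_divide powr_realpow)
  ultimately show "\<eta> \<le> 1 / 2 ^ a" using \<eta> by simp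
qed


section \<open>The special flow in coordinates\<close>

lemma space_circle: "space circle = {0..<1}"
  by (simp add: circle_def space_restrict_space)

lemma rotation_funpow: "x \<in> {0..<1} \<Longrightarrow> (rotation \<alpha> ^^ n) x = frac (x + real n * \<alpha>)"
proof (induction n)
  case 0
  then show ?case by (simp add: frac_eq)
next
  case (Suc n)
  then show ?case by (simp add: rotation_def algebra_simps)
qed

lemma inv_into_rotation:
  assumes "z \<in> {0..<1}"
  shows "inv_into {0..<1} (rotation \<alpha>) z = rotation (- \<alpha>) z"
proof (rule inv_into_f_eq)
  show "inj_on (rotation \<alpha>) {0..<1}"
  proof (rule inj_onI)
    fix x y assume xy: "x \<in> {0..<1}" "y \<in> {0..<1}" "rotation \<alpha> x = rotation \<alpha> y"
    have "frac (frac (z + \<alpha>) + (- \<alpha>)) = z" if "z \<in> {0..<1}" for z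
      unfolding frac_add_simps using that by (simp add: frac_eq)
    from this[OF xy(1)] this[OF xy(2)] show "x = y" using xy(3) unfolding rotation_def by metis
  qed
  show "rotation (- \<alpha>) z \<in> {0..<1}" by (simp add: rotation_def frac_lt_1)
  show "rotation \<alpha> (rotation (- \<alpha>) z) = z"
    using assms by (simp add: rotation_def frac_eq)
qed

lemma int_iterate_rotation:
  assumes "x \<in> {0..<1}"
  shows "int_iterate circle (rotation \<alpha>) n x = orbit_pt \<alpha> x n"
proof (cases "n \<ge> 0")
  case True
  then show ?thesis using assms by (simp add: int_iterate_def rotation_funpow)
next
  case False
  have "(inv_into {0..<1} (rotation \<alpha>) ^^ k) x = (rotation (- \<alpha>) ^^ k) x" for k
  proof (induction k)
    case (Suc k)
    have "(rotation (- \<alpha>) ^^ k) x \<in> {0..<1}" using assms by (simp add: rotation_funpow frac_lt_1)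
    then show ?case using Suc by (simp add: inv_into_rotation)
  qed simp
  then show ?thesis using False assms by (simp add: int_iterate_def space_circle rotation_funpow)
qed

lemma card_le_diameter:
  fixes A :: "nat set"
  assumes "finite A" "0 \<le> D" and D: "\<And>m n. m \<in> A \<Longrightarrow> n \<in> A \<Longrightarrow> real n - real m \<le> D"
  shows "real (card A) \<le> D + 1"
proof (cases "A = {}")
  case False
  have "A \<subseteq> {Min A..Max A}" using assms by auto
  then have "card A \<le> card {Min A..Max A}" by (intro card_mono) auto
  then have "real (card A) \<le> real (Max A) - real (Min A) + 1"
    using Min_le[OF assms(1) Max_in[OF assms(1) False]] by simp
  then show ?thesis using D[OF Min_in[OF assms(1) False] Max_in[OF assms(1) False]] by linarith
qed (use assms in simp)

text \<open>The value of \<open>f\<close> at \<open>0\<close> is left open; the estimates concern \<open>regular\<close> points, whose orbit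
  never meets \<open>0\<close>.\<close>
locale power_ceiling =
  fixes \<alpha> \<gamma> r c :: real and f :: "real \<Rightarrow> real"
  assumes gamma: "-1 < \<gamma>" "\<gamma> < 0" and r_pos: "r > 0"
    and f_eq: "\<And>x. x \<in> {0<..<1} \<Longrightarrow> f x = x powr \<gamma> + r"
    and badly: "badly_approximable c \<alpha>"
begin

abbreviation F :: "int \<Rightarrow> real \<Rightarrow> real" where
  "F \<equiv> cocycle circle (rotation \<alpha>) f"

definition regular :: "real set" where
  "regular = {x \<in> {0..<1}. \<forall>i. orbit_pt \<alpha> x i \<noteq> 0}"

lemma c_pos: "0 < c"
  using badly by (simp add: badly_approximable_def)

lemma regular_orbit: "x \<in> regular \<Longrightarrow> 0 < orbit_pt \<alpha> x i \<and> orbit_pt \<alpha> x i < 1"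
  using orbit_pt_pos by (auto simp: regular_def frac_lt_1)

lemma f_orbit: "x \<in> regular \<Longrightarrow> f (orbit_pt \<alpha> x i) = orbit_pt \<alpha> x i powr \<gamma> + r"
  using regular_orbit[of x i] by (simp add: f_eq)

lemma one_le_powr: "0 < u \<Longrightarrow> u < 1 \<Longrightarrow> 1 \<le> u powr \<gamma>"
  using powr_mono2'[of \<gamma> u 1] gamma by simp

lemma f_orbit_ge_1: "x \<in> regular \<Longrightarrow> 1 \<le> f (orbit_pt \<alpha> x i)"
  using regular_orbit[of x i] one_le_powr[of "orbit_pt \<alpha> x i"] r_pos by (simp add: f_orbit)

lemma F_0 [simp]: "F 0 x = 0"
  by (simp add: cocycle_def)

lemma F_step: "x \<in> {0..<1} \<Longrightarrow> F (m + 1) x = F m x + f (orbit_pt \<alpha> x m)"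
proof -
  assume x: "x \<in> {0..<1}"
  consider "m \<ge> 0" | "m = -1" | "m < -1" by linarith
  then show ?thesis
  proof cases
    case 1
    then have "{0..<m + 1} = insert m {0..<m}" by auto
    then show ?thesis using 1 x by (simp add: cocycle_def int_iterate_rotation)
  next
    case 2
    have "{-1..<0::int} = {-1}" by auto
    then show ?thesis using 2 x by (simp add: cocycle_def int_iterate_rotation)
  next
    case 3
    then have "{m..<0} = insert m {m + 1..<0}" by auto
    then show ?thesis using 3 x by (simp add: cocycle_def int_iterate_rotation)
  qed
qed

lemma F_diff:
  assumes "x \<in> {0..<1}" "m1 \<le> m2"
  shows "F m2 x - F m1 x = (\<Sum>i\<in>{m1..<m2}. f (orbit_pt \<alpha> x i))"
  using assms(2)
proof (induction m2 rule: int_ge_induct)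
  case (step m)
  then have "{m1..<m + 1} = insert m {m1..<m}" by auto
  then show ?case using step F_step[OF assms(1), of m] by simp
qed simp

lemma F_diff_ge:
  assumes "x \<in> regular" "m1 \<le> m2"
  shows "of_int (m2 - m1) \<le> F m2 x - F m1 x"
proof -
  have "(\<Sum>i\<in>{m1..<m2}. 1) \<le> (\<Sum>i\<in>{m1..<m2}. f (orbit_pt \<alpha> x i))"
    by (intro sum_mono f_orbit_ge_1 assms)
  then show ?thesis using assms F_diff[of x m1 m2] by (simp add: regular_def)
qed

text \<open>The number of base steps completed when the flow started at height \<open>0\<close> over \<open>x\<close> has run for
  time \<open>\<tau>\<close>.\<close>
definition idx :: "real \<Rightarrow> real \<Rightarrow> int" where
  "idx \<tau> x = (THE m. F m x \<le> \<tau> \<and> \<tau> < F (m + 1) x)"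

lemma idx_unique:
  assumes x: "x \<in> regular" and "F m x \<le> \<tau>" "\<tau> < F (m + 1) x" and "F m' x \<le> \<tau>" "\<tau> < F (m' + 1) x"
  shows "m = m'"
proof (rule ccontr)
  assume "m \<noteq> m'"
  then consider "m + 1 \<le> m'" | "m' + 1 \<le> m" by linarith
  then show False
  proof cases
    case 1 then show ?thesis using F_diff_ge[OF x 1] assms by linarith
  next
    case 2 then show ?thesis using F_diff_ge[OF x 2] assms by linarith
  qed
qed

lemma idx_bounds:
  assumes x: "x \<in> regular"
  shows "F (idx \<tau> x) x \<le> \<tau>" and "\<tau> < F (idx \<tau> x + 1) x"
proof -
  define b where "b = \<lceil>\<bar>\<tau>\<bar>\<rceil> + 1"
  have b: "0 \<le> b" "\<bar>\<tau>\<bar> < of_int b" unfolding b_def by linarith+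
  define S where "S = {m \<in> {-b..b}. F m x \<le> \<tau>}"
  have S: "finite S" by (rule finite_subset[of _ "{-b..b}"]) (auto simp: S_def)
  have "F (- b) x \<le> \<tau>" using F_diff_ge[OF x, of "- b" 0] b by simp
  then have ne: "S \<noteq> {}" using b by (auto simp: S_def intro!: exI[of _ "- b"])
  define m where "m = Max S"
  have m: "m \<in> S" using Max_in[OF S ne] by (simp add: m_def)
  have "\<tau> < F b x" using F_diff_ge[OF x, of 0 b] b by simp
  then have "m \<noteq> b" using m by (auto simp: S_def)
  then have "m + 1 \<in> {-b..b}" using m by (auto simp: S_def)
  moreover have "m + 1 \<notin> S"
  proof
    assume "m + 1 \<in> S"
    from Max_ge[OF S this] show False unfolding m_def by linarith
  qed
  ultimately have "F m x \<le> \<tau> \<and> \<tau> < F (m + 1) x" using m by (auto simp: S_def)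
  then have "F (idx \<tau> x) x \<le> \<tau> \<and> \<tau> < F (idx \<tau> x + 1) x"
    unfolding idx_def by (rule theI) (use \<open>F m x \<le> \<tau> \<and> \<tau> < F (m + 1) x\<close> idx_unique[OF x] in blast)
  then show "F (idx \<tau> x) x \<le> \<tau>" and "\<tau> < F (idx \<tau> x + 1) x" by auto
qed

lemma special_flow_eq:
  assumes "x \<in> regular"
  shows "special_flow circle (rotation \<alpha>) f t (x, s)
    = (orbit_pt \<alpha> x (idx (t + s) x), t + s - F (idx (t + s) x) x)"
  using assms by (simp add: special_flow_def Let_def idx_def int_iterate_rotation regular_def)

lemma idx_diff:
  assumes x: "x \<in> regular" and \<tau>: "\<tau>1 \<le> \<tau>2"
  shows "idx \<tau>1 x \<le> idx \<tau>2 x" and "of_int (idx \<tau>2 x - idx \<tau>1 x) \<le> \<tau>2 - \<tau>1 + 1"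
proof -
  show 1: "idx \<tau>1 x \<le> idx \<tau>2 x"
  proof (rule ccontr)
    assume "\<not> ?thesis"
    then have "idx \<tau>2 x + 1 \<le> idx \<tau>1 x" by linarith
    from F_diff_ge[OF x this] have "F (idx \<tau>2 x + 1) x \<le> F (idx \<tau>1 x) x"
      using \<open>idx \<tau>2 x + 1 \<le> idx \<tau>1 x\<close> by linarith
    then show False using idx_bounds[OF x, of \<tau>1] idx_bounds[OF x, of \<tau>2] \<tau> by linarith
  qed
  show "of_int (idx \<tau>2 x - idx \<tau>1 x) \<le> \<tau>2 - \<tau>1 + 1"
  proof (cases "idx \<tau>1 x = idx \<tau>2 x")
    case True then show ?thesis using \<tau> by simp
  next
    case False
    then have "idx \<tau>1 x + 1 \<le> idx \<tau>2 x" using 1 by linarith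
    from F_diff_ge[OF x this] show ?thesis
      using idx_bounds[OF x, of \<tau>1] idx_bounds[OF x, of \<tau>2] by simp
  qed
qed

lemma idx_0: "x \<in> regular \<Longrightarrow> idx 0 x = 0"
  using idx_unique[of x "idx 0 x" 0 0] idx_bounds[of x 0] F_diff_ge[of x 0 1] by simp

lemma idx_abs_le: "x \<in> regular \<Longrightarrow> \<bar>of_int (idx \<tau> x)\<bar> \<le> \<bar>\<tau>\<bar> + 1"
  using idx_diff[of x 0 \<tau>] idx_diff[of x \<tau> 0] by (cases "0 \<le> \<tau>") (auto simp: idx_0)

lemma idx_abs_diff:
  "x \<in> regular \<Longrightarrow> \<bar>of_int (idx \<tau>1 x) - of_int (idx \<tau>2 x)\<bar> \<le> \<bar>\<tau>1 - \<tau>2\<bar> + 1"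
  using idx_diff[of x \<tau>1 \<tau>2] idx_diff[of x \<tau>2 \<tau>1] by (cases "\<tau>1 \<le> \<tau>2") auto

lemma card_idx_fibre:
  assumes x: "x \<in> regular" and t0: "t0 \<noteq> 0" and A: "finite A"
    and idx: "\<And>n. n \<in> A \<Longrightarrow> idx (real n * t0 + s) x = m"
  shows "real (card A) \<le> f (orbit_pt \<alpha> x m) / \<bar>t0\<bar> + 1"
proof (rule card_le_diameter)
  have x01: "x \<in> {0..<1}" using x by (simp add: regular_def)
  show "0 \<le> f (orbit_pt \<alpha> x m) / \<bar>t0\<bar>" using f_orbit_ge_1[OF x, of m] by simp
  fix n n' assume nn: "n \<in> A" "n' \<in> A"
  have "\<bar>(real n' - real n) * t0\<bar> \<le> f (orbit_pt \<alpha> x m)"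
    using idx_bounds[OF x, of "real n * t0 + s"] idx_bounds[OF x, of "real n' * t0 + s"]
      idx[OF nn(1)] idx[OF nn(2)] F_step[OF x01, of m] by (simp add: abs_le_iff algebra_simps)
  then have "\<bar>real n' - real n\<bar> \<le> f (orbit_pt \<alpha> x m) / \<bar>t0\<bar>"
    using t0 unfolding abs_mult by (simp add: pos_le_divide_eq)
  then show "real n' - real n \<le> f (orbit_pt \<alpha> x m) / \<bar>t0\<bar>" by linarith
qed (rule A)


section \<open>Time spent in high towers\<close>

text \<open>The window sees an orbit segment of length at most \<open>Q = \<bar>t0\<bar> * L + 1\<close>, whose points are separated
  by \<open>c / Q\<close>. At most one of them is below \<open>c / Q\<close>, and its tower is accounted for by \<open>T\<close>; the others
  contribute at most a multiple of \<open>Q\<close> times the integral of \<open>f\<close> over \<open>(0, u0)\<close>, which does not depend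
  on where the window starts.\<close>
lemma card_high_towers_le:
  assumes x: "x \<in> regular" and t0: "t0 \<noteq> 0" and u0: "0 < u0"
    and T: "0 \<le> T" "\<And>n. n \<in> {K..K+L} \<Longrightarrow> f (orbit_pt \<alpha> x (idx (real n * t0 + s) x)) \<le> T"
  shows "real (card {n \<in> {K..K+L}. orbit_pt \<alpha> x (idx (real n * t0 + s) x) < u0})
    \<le> (1 / \<bar>t0\<bar> + 1) * (T + (u0 powr (1 + \<gamma>) / (1 + \<gamma>) + r * u0) * (\<bar>t0\<bar> * real L + 1) / c)"
proof -
  let ?m = "\<lambda>n::nat. idx (real n * t0 + s) x"
  define Q where "Q = \<bar>t0\<bar> * real L + 1"
  define g where "g = c / Q"
  have Q: "0 < Q" using t0 by (simp add: Q_def add_nonneg_pos)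
  have g: "0 < g" using c_pos Q by (simp add: g_def)
  define A where "A = {n \<in> {K..K+L}. orbit_pt \<alpha> x (?m n) < u0}"
  define I where "I = ?m ` A"
  have fin: "finite A" "finite I" by (auto simp: A_def I_def)
  have IT: "f (orbit_pt \<alpha> x i) \<le> T" "orbit_pt \<alpha> x i < u0" if "i \<in> I" for i
    using that T by (auto simp: I_def A_def)
  have sep: "g \<le> \<bar>orbit_pt \<alpha> x i - orbit_pt \<alpha> x j\<bar>" if ij: "i \<in> I" "j \<in> I" "i \<noteq> j" for i j
  proof -
    obtain n n' where n: "n \<in> {K..K+L}" "n' \<in> {K..K+L}" "i = ?m n" "j = ?m n'"
      using ij by (auto simp: I_def A_def)
    have "\<bar>real n - real n'\<bar> \<le> real L" using n by auto
    then have "\<bar>(real n - real n') * t0\<bar> \<le> \<bar>t0\<bar> * real L"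
      using t0 by (simp add: abs_mult mult.commute)
    then have "\<bar>real_of_int (i - j)\<bar> \<le> Q"
      using idx_abs_diff[OF x, of "real n * t0 + s" "real n' * t0 + s"] n
      by (simp add: Q_def algebra_simps)
    from orbit_gap(2)[OF badly ij(3) this] show ?thesis by (simp add: g_def)
  qed
  have "real (card A) = (\<Sum>i\<in>I. real (card {n \<in> A. ?m n = i}))"
    unfolding I_def using sum.group[OF fin(1), of "?m ` A" ?m "\<lambda>_. 1::real"] fin by simp
  also have "\<dots> \<le> (\<Sum>i\<in>I. f (orbit_pt \<alpha> x i) / \<bar>t0\<bar> + 1)"
    using fin by (intro sum_mono card_idx_fibre[OF x t0, of _ s]) auto
  also have "\<dots> \<le> (\<Sum>i\<in>I. (1 / \<bar>t0\<bar> + 1) * f (orbit_pt \<alpha> x i))"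
    using f_orbit_ge_1[OF x] by (intro sum_mono) (simp add: algebra_simps)
  also have "\<dots> = (1 / \<bar>t0\<bar> + 1) * (\<Sum>i\<in>I. f (orbit_pt \<alpha> x i))" by (simp add: sum_distrib_left)
  finally have 1: "real (card A) \<le> (1 / \<bar>t0\<bar> + 1) * (\<Sum>i\<in>I. f (orbit_pt \<alpha> x i))" .
  define I0 where "I0 = {i \<in> I. orbit_pt \<alpha> x i < g}"
  define I1 where "I1 = {i \<in> I. g \<le> orbit_pt \<alpha> x i}"
  have "(\<Sum>i\<in>I. f (orbit_pt \<alpha> x i)) = (\<Sum>i\<in>I0. f (orbit_pt \<alpha> x i)) + (\<Sum>i\<in>I1. f (orbit_pt \<alpha> x i))"
    using fin by (subst sum.union_disjoint[symmetric]) (auto simp: I0_def I1_def intro!: sum.cong)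
  \<comment> \<open>two points of the orbit segment in \<open>[0, g)\<close> would be closer than \<open>g\<close>\<close>
  moreover have "(\<Sum>i\<in>I0. f (orbit_pt \<alpha> x i)) \<le> T"
  proof (cases "I0 = {}")
    case False
    then obtain k where k: "k \<in> I0" by blast
    have "I0 = {k}"
    proof -
      have "i = k" if i: "i \<in> I0" for i
      proof (rule ccontr)
        assume "i \<noteq> k"
        then have "g \<le> \<bar>orbit_pt \<alpha> x i - orbit_pt \<alpha> x k\<bar>" using sep[of i k] i k by (auto simp: I0_def)
        then show False using i k regular_orbit[OF x, of i] regular_orbit[OF x, of k]
          by (auto simp: I0_def)
      qed
      then show ?thesis using k by blast
    qed
    moreover have "k \<in> I" using k by (simp add: I0_def)
    ultimately show ?thesis using IT(1)[of k] by simp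
  qed (use T in simp)
  moreover have "(\<Sum>i\<in>I1. f (orbit_pt \<alpha> x i)) \<le> (u0 powr (1 + \<gamma>) / (1 + \<gamma>) + r * u0) / g"
  proof -
    have I1: "finite I1" "\<And>i. i \<in> I1 \<Longrightarrow> g \<le> orbit_pt \<alpha> x i \<and> orbit_pt \<alpha> x i \<le> u0"
      using fin IT(2) by (auto simp: I1_def less_imp_le)
    have sep1: "\<And>i j. i \<in> I1 \<Longrightarrow> j \<in> I1 \<Longrightarrow> i \<noteq> j \<Longrightarrow> g \<le> \<bar>orbit_pt \<alpha> x i - orbit_pt \<alpha> x j\<bar>"
      using sep by (simp add: I1_def)
    have "(\<Sum>i\<in>I1. orbit_pt \<alpha> x i powr \<gamma>) \<le> u0 powr (1 + \<gamma>) / (1 + \<gamma>) / g"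
      by (rule separated_sum_powr_le'[where u = "orbit_pt \<alpha> x", OF I1(1) g gamma u0 I1(2) sep1])
    moreover have "(\<Sum>i\<in>I1. 1::real) \<le> (\<Sum>n\<in>{1..nat \<lfloor>u0 / g\<rfloor>}. 1)"
      by (rule separated_sum_le[where \<phi> = "\<lambda>_. 1" and u = "orbit_pt \<alpha> x", OF I1(1) g I1(2) sep1]) simp_all
    then have "real (card I1) \<le> u0 / g" using u0 g of_nat_floor[of "u0 / g"] by simp linarith
    then have "r * real (card I1) \<le> r * (u0 / g)" using r_pos by (intro mult_left_mono) auto
    ultimately show ?thesis using f_orbit[OF x] by (simp add: sum.distrib add_divide_distrib mult.commute)
  qed
  ultimately have 2: "(\<Sum>i\<in>I. f (orbit_pt \<alpha> x i)) \<le> T + (u0 powr (1 + \<gamma>) / (1 + \<gamma>) + r * u0) * Q / c"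
    by (simp add: g_def)
  have "real (card A) \<le> (1 / \<bar>t0\<bar> + 1) * (T + (u0 powr (1 + \<gamma>) / (1 + \<gamma>) + r * u0) * Q / c)"
    by (rule order_trans[OF 1 mult_left_mono[OF 2]]) simp
  then show ?thesis by (simp only: A_def Q_def)
qed


section \<open>Close times\<close>

text \<open>The flow points compared are those of \<open>(x, s)\<close> at time \<open>t\<close> and of \<open>(y, s)\<close> at time \<open>t + p\<close>. Their
  base points differ by \<open>x - y + shift * \<alpha>\<close> modulo the integers.\<close>
definition shift :: "real \<Rightarrow> real \<Rightarrow> real \<Rightarrow> real \<Rightarrow> real \<Rightarrow> int" where
  "shift x y s p t = idx (t + s) x - idx (t + p + s) y"

definition gap :: "real \<Rightarrow> real \<Rightarrow> real \<Rightarrow> real \<Rightarrow> real \<Rightarrow> real" where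
  "gap x y s p t = int_dist (x - y + of_int (shift x y s p t) * \<alpha>)"

definition close :: "real \<Rightarrow> real \<Rightarrow> real \<Rightarrow> real \<Rightarrow> real \<Rightarrow> real \<Rightarrow> bool" where
  "close \<epsilon> x y s p t \<longleftrightarrow> gap x y s p t < \<epsilon> \<and>
     \<bar>F (idx (t + p + s) y) y - F (idx (t + s) x) x - p\<bar> < \<epsilon>"

lemma flow_dist_less_imp_close:
  assumes x: "x \<in> regular" and y: "y \<in> regular"
    and d: "flow_dist circle_dist (special_flow circle (rotation \<alpha>) f t (x, s))
              (special_flow circle (rotation \<alpha>) f (t + p) (y, s)) < \<epsilon>"
  shows "close \<epsilon> x y s p t"
proof -
  let ?m = "idx (t + s) x" and ?m' = "idx (t + p + s) y"
  have "int_dist (orbit_pt \<alpha> x ?m - orbit_pt \<alpha> y ?m') + \<bar>F ?m' y - F ?m x - p\<bar> < \<epsilon>"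
    using d by (simp add: flow_dist_def circle_dist_eq special_flow_eq x y)
  moreover have "int_dist (orbit_pt \<alpha> x ?m - orbit_pt \<alpha> y ?m') = gap x y s p t"
    unfolding int_dist_frac_diff gap_def shift_def by (simp add: algebra_simps)
  moreover have "0 \<le> gap x y s p t" unfolding gap_def by (rule int_dist_nonneg)
  ultimately show ?thesis unfolding close_def by linarith
qed

text \<open>If the shifts differed by \<open>k \<noteq> 0\<close>, then \<open>k * \<alpha>\<close> would be within \<open>2 * w\<close> of an integer, while
  \<open>\<bar>k\<bar>\<close> is at most the number of base steps in between.\<close>
lemma shift_eqI:
  assumes x: "x \<in> regular" and y: "y \<in> regular"
    and w: "0 < w" "gap x y s p t1 \<le> w" "gap x y s p t2 \<le> w"
    and t: "\<bar>t1 - t2\<bar> + 1 < c / (2 * w)"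
  shows "shift x y s p t1 = shift x y s p t2"
proof (rule ccontr)
  define k where "k = shift x y s p t1 - shift x y s p t2"
  assume "\<not> ?thesis"
  then have k0: "k \<noteq> 0" by (simp add: k_def)
  have "\<bar>real_of_int k\<bar> \<le> \<bar>t1 - t2\<bar> + 1"
  proof (cases "t1 \<le> t2")
    case True
    then show ?thesis using idx_diff[OF x, of "t1 + s" "t2 + s"] idx_diff[OF y, of "t1 + p + s" "t2 + p + s"]
      by (simp add: k_def shift_def)
  next
    case False
    then show ?thesis using idx_diff[OF x, of "t2 + s" "t1 + s"] idx_diff[OF y, of "t2 + p + s" "t1 + p + s"]
      by (simp add: k_def shift_def)
  qed
  then have "\<bar>real_of_int k\<bar> < c / (2 * w)" using t by linarith
  then have "2 * w < c / \<bar>real_of_int k\<bar>" using k0 w by (simp add: field_simps)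
  also have "\<dots> \<le> int_dist (of_int k * \<alpha>)" by (rule badly_approximableD[OF badly k0])
  also have "of_int k * \<alpha> = (x - y + of_int (shift x y s p t1) * \<alpha>) - (x - y + of_int (shift x y s p t2) * \<alpha>)"
    by (simp add: k_def algebra_simps)
  also have "int_dist \<dots> \<le> gap x y s p t1 + gap x y s p t2"
    unfolding gap_def by (rule int_dist_diff)
  finally show False using w by linarith
qed

text \<open>With equal shifts the drift accumulated between the two times is a drift of two points at
  distance \<open>gap\<close> over the same base steps; closeness at both ends bounds it by \<open>2 * \<epsilon> \<le> 1\<close>, so
  there cannot be more steps than the growth of the drift allows.\<close>
lemma idx_spread_le:
  assumes x: "x \<in> regular" and y: "y \<in> regular" and "0 < Cd"
    and drift: "\<And>x \<eta> m1 m2. 0 < \<eta> \<Longrightarrow> \<eta> \<le> \<eta>0 \<Longrightarrow> \<eta> * of_int (m2 - m1) \<le> c3 \<Longrightarrow>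
      Cd * \<eta> powr (- 1 / (1 - \<gamma>)) < of_int (m2 - m1) \<Longrightarrow>
      (\<And>i. orbit_pt \<alpha> x i \<noteq> 0) \<Longrightarrow> (\<And>i. orbit_pt \<alpha> (x + \<eta>) i \<noteq> 0) \<Longrightarrow>
      1 \<le> \<bar>\<Sum>i\<in>{m1..<m2}. orbit_pt \<alpha> x i powr \<gamma> - orbit_pt \<alpha> (x + \<eta>) i powr \<gamma>\<bar>"
    and close: "close \<epsilon> x y s p t1" "close \<epsilon> x y s p t2" and \<epsilon>: "\<epsilon> \<le> 1 / 2"
    and w: "w \<le> \<eta>0" "0 < gap x y s p t1" "gap x y s p t1 \<le> w" "(\<bar>t1 - t2\<bar> + 1) * w \<le> c3"
    and shift: "shift x y s p t1 = shift x y s p t2"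
    and le: "idx (t1 + s) x \<le> idx (t2 + s) x"
  shows "of_int (idx (t2 + s) x - idx (t1 + s) x) \<le> Cd * gap x y s p t1 powr (- 1 / (1 - \<gamma>))"
proof (rule ccontr)
  assume neg: "\<not> ?thesis"
  define k where "k = shift x y s p t1"
  define m1 where "m1 = idx (t1 + s) x"
  define m2 where "m2 = idx (t2 + s) x"
  define \<eta> where "\<eta> = gap x y s p t1"
  define y' where "y' = y - of_int k * \<alpha>"
  have my: "idx (t1 + p + s) y = m1 - k" "idx (t2 + p + s) y = m2 - k"
    using shift by (auto simp: k_def shift_def m1_def m2_def)
  have m12: "m1 \<le> m2" using le by (simp add: m1_def m2_def)
  have x01: "x \<in> {0..<1}" "y \<in> {0..<1}" using x y by (auto simp: regular_def)
  have y': "orbit_pt \<alpha> y (i - k) = orbit_pt \<alpha> y' i" for i by (simp add: y'_def algebra_simps)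
  have Fx: "F m2 x - F m1 x = (\<Sum>i\<in>{m1..<m2}. orbit_pt \<alpha> x i powr \<gamma> + r)"
    using F_diff[OF x01(1) m12] by (simp add: f_orbit[OF x])
  have "F (m2 - k) y - F (m1 - k) y = (\<Sum>i\<in>{m1 - k..<m2 - k}. orbit_pt \<alpha> y i powr \<gamma> + r)"
    using F_diff[OF x01(2), of "m1 - k" "m2 - k"] m12 by (simp add: f_orbit[OF y])
  also have "\<dots> = (\<Sum>i\<in>{m1..<m2}. orbit_pt \<alpha> y (i - k) powr \<gamma> + r)"
    by (rule sum.reindex_bij_witness[of _ "\<lambda>i. i - k" "\<lambda>i. i + k"]) auto
  finally have Fy: "F (m2 - k) y - F (m1 - k) y = (\<Sum>i\<in>{m1..<m2}. orbit_pt \<alpha> y' i powr \<gamma> + r)"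
    unfolding y' .
  have "\<bar>(F m2 x - F m1 x) - (F (m2 - k) y - F (m1 - k) y)\<bar> < 1"
    using close \<epsilon> unfolding close_def my m1_def[symmetric] m2_def[symmetric] by linarith
  then have small: "\<bar>\<Sum>i\<in>{m1..<m2}. orbit_pt \<alpha> x i powr \<gamma> - orbit_pt \<alpha> y' i powr \<gamma>\<bar> < 1"
    unfolding Fx Fy by (simp add: sum.distrib sum_subtractf)
  have \<eta>: "0 < \<eta>" "\<eta> \<le> \<eta>0" using w by (auto simp: \<eta>_def)
  have "of_int (m2 - m1) \<le> \<bar>t1 - t2\<bar> + 1"
    using idx_abs_diff[OF x, of "t2 + s" "t1 + s"] by (simp add: m1_def m2_def)
  then have "\<eta> * of_int (m2 - m1) \<le> w * (\<bar>t1 - t2\<bar> + 1)"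
    using m12 w by (intro mult_mono) (auto simp: \<eta>_def)
  then have q: "\<eta> * of_int (m2 - m1) \<le> c3" using w by (simp add: mult.commute)
  have big: "Cd * \<eta> powr (- 1 / (1 - \<gamma>)) < of_int (m2 - m1)"
    using neg by (simp add: \<eta>_def m1_def m2_def)
  have nz: "orbit_pt \<alpha> x i \<noteq> 0" "orbit_pt \<alpha> y' i \<noteq> 0" for i
  proof -
    show "orbit_pt \<alpha> x i \<noteq> 0" using x by (auto simp: regular_def)
    have "orbit_pt \<alpha> y (i - k) \<noteq> 0" using y unfolding regular_def by blast
    then show "orbit_pt \<alpha> y' i \<noteq> 0" unfolding y' .
  qed
  have "int_dist (x - y') = \<eta>" by (simp add: \<eta>_def gap_def k_def y'_def algebra_simps)
  from frac_shift_cases[OF this] show False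
  proof
    assume A0: "\<forall>b. frac (y' + b) = frac (x + \<eta> + b)"
    have A: "orbit_pt \<alpha> (x + \<eta>) i = orbit_pt \<alpha> y' i" for i by (rule A0[rule_format, symmetric])
    have "1 \<le> \<bar>\<Sum>i\<in>{m1..<m2}. orbit_pt \<alpha> x i powr \<gamma> - orbit_pt \<alpha> (x + \<eta>) i powr \<gamma>\<bar>"
      by (rule drift[OF \<eta> q big]) (simp_all only: A nz not_False_eq_True)
    then show False using small unfolding A by linarith
  next
    assume A0: "\<forall>b. frac (x + b) = frac (y' + \<eta> + b)"
    have A: "orbit_pt \<alpha> (y' + \<eta>) i = orbit_pt \<alpha> x i" for i by (rule A0[rule_format, symmetric])
    have "1 \<le> \<bar>\<Sum>i\<in>{m1..<m2}. orbit_pt \<alpha> y' i powr \<gamma> - orbit_pt \<alpha> (y' + \<eta>) i powr \<gamma>\<bar>"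
      by (rule drift[OF \<eta> q big]) (simp_all only: A nz not_False_eq_True)
    moreover have "(\<Sum>i\<in>{m1..<m2}. orbit_pt \<alpha> y' i powr \<gamma> - orbit_pt \<alpha> (y' + \<eta>) i powr \<gamma>)
       = - (\<Sum>i\<in>{m1..<m2}. orbit_pt \<alpha> x i powr \<gamma> - orbit_pt \<alpha> y' i powr \<gamma>)"
      unfolding A by (simp flip: sum_negf)
    ultimately show False using small by simp
  qed
qed


text \<open>Outside the high towers, one base step lasts for a bounded number of sampling times. So a block
  of length \<open>b * 2 ^ a\<close> contains \<open>O(2 ^ (a * \<beta>))\<close> close times of gap in \<open>(2 ^ (- a - 1), 2 ^ (- a)]\<close>, and
  the dyadic count applies with \<open>z = 2 powr \<beta> < 2\<close>. Here \<open>\<tau>\<close> bounds the towers that are met and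
  \<open>\<omega>\<close> the influence of the smallest gap, both relative to the window length \<open>L\<close>. None of the constants
  depends on the ratio \<open>L / K\<close>.\<close>
lemma few_close_times:
  fixes t0 :: real
  assumes t0: "t0 \<noteq> 0"
  obtains \<epsilon>0 \<omega> \<tau> :: real where "0 < \<epsilon>0" "\<epsilon>0 \<le> 1 / 4" "0 < \<omega>" "0 < \<tau>"
    "\<And>\<epsilon> x y s p K L. \<epsilon> \<le> \<epsilon>0 \<Longrightarrow> x \<in> regular \<Longrightarrow> y \<in> regular \<Longrightarrow> 0 < L \<Longrightarrow>
      (\<And>n. n \<in> {K..K+L} \<Longrightarrow> f (orbit_pt \<alpha> x (idx (real n * t0 + s) x)) \<le> \<tau> * real L) \<Longrightarrow>
      (\<And>n. n \<in> {K..K+L} \<Longrightarrow> close \<epsilon> x y s p (real n * t0) \<Longrightarrow>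
          0 < gap x y s p (real n * t0) \<and>
          gap x y s p (real n * t0) powr (- 1 / (1 - \<gamma>)) \<le> \<omega> * real L) \<Longrightarrow>
      real (card {n \<in> {K..K+L}. close \<epsilon> x y s p (real n * t0)}) \<le> real L / 2"
proof -
  obtain c3 \<eta>0 Cd where c3: "0 < c3" and \<eta>0: "0 < \<eta>0" and Cd: "0 < Cd"
    and drift: "\<And>x \<eta> m1 m2. 0 < \<eta> \<Longrightarrow> \<eta> \<le> \<eta>0 \<Longrightarrow> \<eta> * of_int (m2 - m1) \<le> c3 \<Longrightarrow>
      Cd * \<eta> powr (- 1 / (1 - \<gamma>)) < of_int (m2 - m1) \<Longrightarrow>
      (\<And>i. orbit_pt \<alpha> x i \<noteq> 0) \<Longrightarrow> (\<And>i. orbit_pt \<alpha> (x + \<eta>) i \<noteq> 0) \<Longrightarrow>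
      1 \<le> \<bar>\<Sum>i\<in>{m1..<m2}. orbit_pt \<alpha> x i powr \<gamma> - orbit_pt \<alpha> (x + \<eta>) i powr \<gamma>\<bar>"
    using drift_ge_one[OF badly gamma] by blast
  define \<beta> where "\<beta> = 1 / (1 - \<gamma>)"
  have \<beta>: "0 < \<beta>" "\<beta> < 1" "- 1 / (1 - \<gamma>) = - \<beta>" using gamma by (auto simp: \<beta>_def)
  define z :: real where "z = 2 powr \<beta>"
  have z: "1 < z" "z < 2" using \<beta> powr_less_mono[of \<beta> 1 2] by (auto simp: z_def)
  define T where "T = 1 / \<bar>t0\<bar> + 1"
  have T: "1 \<le> T" by (simp add: T_def)
  \<comment> \<open>cutoff: towers over \<open>(0, u0)\<close> account for at most an eighth of the sampling times\<close>
  define v where "v = c / (16 * T * (\<bar>t0\<bar> + 1) * (1 / (1 + \<gamma>) + r))"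
  have v: "0 < v" using c_pos T gamma r_pos unfolding v_def
    by (intro divide_pos_pos mult_pos_pos add_pos_pos add_nonneg_pos) auto
  define u0 where "u0 = min 1 (v powr (1 / (1 + \<gamma>)))"
  have u0: "0 < u0" "u0 \<le> 1" using v by (auto simp: u0_def)
  have u0v: "u0 powr (1 + \<gamma>) \<le> v"
  proof -
    have "u0 powr (1 + \<gamma>) \<le> (v powr (1 / (1 + \<gamma>))) powr (1 + \<gamma>)"
      using u0 gamma by (intro powr_mono2) (auto simp: u0_def)
    also have "\<dots> = v" using v gamma by (simp add: powr_powr)
    finally show ?thesis .
  qed
  have u0s: "u0 powr (1 + \<gamma>) / (1 + \<gamma>) + r * u0 \<le> v * (1 / (1 + \<gamma>) + r)"
  proof -
    have "u0 powr 1 \<le> u0 powr (1 + \<gamma>)" using u0 gamma by (intro powr_mono') auto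
    then have "u0 \<le> v" using u0v u0 by simp
    then have "u0 powr (1 + \<gamma>) / (1 + \<gamma>) + r * u0 \<le> v / (1 + \<gamma>) + r * v"
      using u0v gamma r_pos by (intro add_mono divide_right_mono mult_left_mono) auto
    then show ?thesis by (simp add: algebra_simps)
  qed
  define H where "H = u0 powr \<gamma> + r"
  define \<tau> where "\<tau> = 1 / (16 * T)"
  define W where "W = (H / \<bar>t0\<bar> + 1) * (2 * Cd + 1)"
  have H: "0 < H" using r_pos by (simp add: H_def add_nonneg_pos)
  have W: "0 < W" unfolding W_def using H t0 Cd by (intro mult_pos_pos add_pos_pos add_nonneg_pos) auto
  define \<mu> where "\<mu> = min c3 (c / 2)"
  have \<mu>: "0 < \<mu>" "\<mu> \<le> c3" "\<mu> \<le> c / 2" using c3 c_pos by (auto simp: \<mu>_def)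
  define b where "b = \<mu> / (2 * \<bar>t0\<bar>)"
  have b: "0 < b" using \<mu> t0 by (simp add: b_def)
  define \<omega> where "\<omega> = 1 / (16 * W * (z / (z - 1)))"
  have \<omega>: "0 < \<omega>" using W z by (simp add: \<omega>_def)
  obtain a0 where a0: "1 \<le> a0" "2 / \<mu> \<le> 2 ^ a0" "1 / \<eta>0 \<le> 2 ^ a0" "W / b / (1 - z / 2) * (z / 2) ^ a0 \<le> 1 / 8"
  proof -
    obtain n1 :: nat where n1: "2 / \<mu> < 2 ^ n1" using real_arch_pow[of 2 "2 / \<mu>"] by auto
    obtain n2 :: nat where n2: "1 / \<eta>0 < 2 ^ n2" using real_arch_pow[of 2 "1 / \<eta>0"] by auto
    define Y where "Y = W / b / (1 - z / 2)"
    have Y: "0 < Y" using W b z by (simp add: Y_def)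
    obtain n3 where n3: "(z / 2) ^ n3 < 1 / (8 * Y)"
      using real_arch_pow_inv[of "1 / (8 * Y)" "z / 2"] Y z by auto
    define a0 where "a0 = Suc (n1 + n2 + n3)"
    have "(2::real) ^ n1 \<le> 2 ^ a0" "(2::real) ^ n2 \<le> 2 ^ a0" by (rule power_increasing; simp add: a0_def)+
    then have "2 / \<mu> \<le> 2 ^ a0" "1 / \<eta>0 \<le> 2 ^ a0" using n1 n2 by linarith+
    moreover have "(z / 2) ^ a0 \<le> (z / 2) ^ n3" using z by (intro power_decreasing) (auto simp: a0_def)
    then have "Y * (z / 2) ^ a0 \<le> Y * (1 / (8 * Y))" using n3 Y by (intro mult_left_mono) auto
    then have "Y * (z / 2) ^ a0 \<le> 1 / 8" using Y by simp
    moreover have "1 \<le> a0" by (simp add: a0_def)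
    ultimately show thesis unfolding Y_def by (intro that[of a0])
  qed
  define \<epsilon>0 where "\<epsilon>0 = min (1 / 2 ^ a0) (1 / 4 :: real)"
  have \<epsilon>0: "0 < \<epsilon>0" "\<epsilon>0 \<le> 1 / 4" "\<epsilon>0 \<le> 1 / 2 ^ a0" by (auto simp: \<epsilon>0_def)
  have main: "real (card {n \<in> {K..K+L}. close \<epsilon> x y s p (real n * t0)}) \<le> real L / 2"
    if \<epsilon>: "\<epsilon> \<le> \<epsilon>0" and x: "x \<in> regular" and y: "y \<in> regular" and L: "0 < L"
      and low: "\<And>n. n \<in> {K..K+L} \<Longrightarrow> f (orbit_pt \<alpha> x (idx (real n * t0 + s) x)) \<le> \<tau> * real L"
      and gp: "\<And>n. n \<in> {K..K+L} \<Longrightarrow> close \<epsilon> x y s p (real n * t0) \<Longrightarrow>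
          0 < gap x y s p (real n * t0) \<and>
          gap x y s p (real n * t0) powr (- 1 / (1 - \<gamma>)) \<le> \<omega> * real L"
    for \<epsilon> x y s p :: real and K L :: nat
  proof -
    let ?m = "\<lambda>n. idx (real n * t0 + s) x" and ?g = "\<lambda>n. gap x y s p (real n * t0)"
    define tall where "tall = {n \<in> {K..K+L}. orbit_pt \<alpha> x (?m n) < u0}"
    define G where "G = {n \<in> {K..K+L}. close \<epsilon> x y s p (real n * t0) \<and> u0 \<le> orbit_pt \<alpha> x (?m n)}"
    have fin: "finite tall" "finite G" by (auto simp: tall_def G_def)
    have GD: "n \<in> {K..K+L}" "close \<epsilon> x y s p (real n * t0)" "u0 \<le> orbit_pt \<alpha> x (?m n)"
      "0 < ?g n" "?g n < 1 / 2 ^ a0" "?g n powr (- \<beta>) \<le> \<omega> * real L" if "n \<in> G" for n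
    proof -
      show n: "n \<in> {K..K+L}" "close \<epsilon> x y s p (real n * t0)" "u0 \<le> orbit_pt \<alpha> x (?m n)"
        using that by (auto simp: G_def)
      show "0 < ?g n" "?g n powr (- \<beta>) \<le> \<omega> * real L" using gp[OF n(1,2)] \<beta>(3) by auto
      show "?g n < 1 / 2 ^ a0" using n(2) \<epsilon> \<epsilon>0 by (auto simp: close_def)
    qed
    have "real (card tall) \<le> T * (\<tau> * real L + (u0 powr (1 + \<gamma>) / (1 + \<gamma>) + r * u0) * (\<bar>t0\<bar> * real L + 1) / c)"
      unfolding tall_def T_def
    proof (rule card_high_towers_le[OF x t0 u0(1) _ low])
      show "0 \<le> \<tau> * real L" using T by (simp add: \<tau>_def)
    qed
    also have "\<dots> \<le> T * (\<tau> * real L + (v * (1 / (1 + \<gamma>) + r)) * ((\<bar>t0\<bar> + 1) * real L) / c)"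
    proof -
      have "\<bar>t0\<bar> * real L + 1 \<le> (\<bar>t0\<bar> + 1) * real L" using L by (simp add: algebra_simps)
      moreover have "0 \<le> v * (1 / (1 + \<gamma>) + r)" using v gamma r_pos by simp
      moreover have "0 \<le> \<tau>" using T by (simp add: \<tau>_def)
      ultimately show ?thesis using u0s T c_pos
        by (intro mult_left_mono add_mono divide_right_mono mult_mono) auto
    qed
    also have "\<dots> = real L / 8"
    proof -
      define w where "w = 1 / (1 + \<gamma>) + r"
      have w: "w \<noteq> 0" using gamma r_pos by (simp add: w_def add_pos_pos less_imp_neq[symmetric])
      have nz: "T \<noteq> 0" "\<bar>t0\<bar> + 1 \<noteq> 0" "c \<noteq> 0" using T c_pos by auto
      have "T * (\<tau> * real L) = real L / 16" using nz by (simp add: \<tau>_def)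
      moreover have "T * ((v * w) * ((\<bar>t0\<bar> + 1) * real L) / c) = real L / 16"
        using nz w unfolding v_def w_def[symmetric] by (simp add: divide_simps)
      ultimately have "T * (\<tau> * real L + (v * w) * ((\<bar>t0\<bar> + 1) * real L) / c) = real L / 16 + real L / 16"
        by (simp only: distrib_left[of T])
      then show ?thesis unfolding w_def by linarith
    qed
    finally have tall8: "real (card tall) \<le> real L / 8" .
    define h where "h n = nat \<lfloor>- log 2 (?g n)\<rfloor>" for n
    have h: "a0 \<le> h n" "1 / 2 ^ Suc (h n) < ?g n" "?g n \<le> 1 / 2 ^ h n" if "n \<in> G" for n
      using dyadic_index[OF GD(4,5)[OF that]] by (auto simp: h_def)
    have zpow: "z ^ a = (2 ^ a) powr \<beta>" for a
      by (simp add: z_def powr_powr mult.commute flip: powr_realpow)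
    have "real (card G) \<le> W * (real L / b * ((z / 2) ^ a0 / (1 - z / 2)) + 2 * (z / (z - 1) * (\<omega> * real L)))"
    proof (rule card_dyadic_classes)
      show "G \<subseteq> {K..K+L}" by (auto simp: G_def)
      fix n assume n: "n \<in> G"
      have "(2 ^ h n) powr \<beta> \<le> (1 / ?g n) powr \<beta>"
        using h(3)[OF n] GD(4)[OF n] \<beta> by (intro powr_mono2) (auto simp: field_simps)
      also have "\<dots> = ?g n powr (- \<beta>)" using GD(4)[OF n] by (simp add: powr_divide powr_minus_divide)
      finally show "a0 \<le> h n \<and> z ^ h n \<le> \<omega> * real L" using GD(6)[OF n] h(1)[OF n] zpow by simp
    next
      fix a i assume a: "a0 \<le> a"
      define S where "S = {n \<in> G. h n = a \<and> \<lfloor>real n / (b * 2 ^ a)\<rfloor> = i}"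
      have finS: "finite S" using fin by (simp add: S_def)
      define w where "w = (1::real) / 2 ^ a"
      have p2a: "(2::real) ^ a0 \<le> 2 ^ a" using a by (intro power_increasing) auto
      have w: "0 < w" "w \<le> \<eta>0"
      proof -
        show "0 < w" by (simp add: w_def)
        have "1 / \<eta>0 \<le> 2 ^ a" using a0 p2a by linarith
        then show "w \<le> \<eta>0" using \<eta>0 by (simp add: w_def field_simps)
      qed
      have near: "(\<bar>real n * t0 - real n' * t0\<bar> + 1) * w < \<mu>" if "n \<in> S" "n' \<in> S" for n n'
      proof -
        have "\<bar>real n / (b * 2 ^ a) - real n' / (b * 2 ^ a)\<bar> < 1"
          using that by (simp add: S_def) linarith
        then have "\<bar>real n - real n'\<bar> / (b * 2 ^ a) < 1"
          using b by (simp add: diff_divide_distrib[symmetric])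
        then have "\<bar>real n - real n'\<bar> < b * 2 ^ a" using b by simp
        then have "\<bar>t0\<bar> * \<bar>real n - real n'\<bar> < \<bar>t0\<bar> * (b * 2 ^ a)" using t0 by simp
        also have "\<dots> = \<mu> / 2 * 2 ^ a" using t0 by (simp add: b_def)
        finally have A: "\<bar>real n * t0 - real n' * t0\<bar> < \<mu> / 2 * 2 ^ a"
          by (simp add: abs_mult[symmetric] algebra_simps)
        have "2 / \<mu> \<le> 2 ^ a" using a0 p2a by linarith
        then have "1 \<le> \<mu> / 2 * 2 ^ a" using \<mu> by (simp add: field_simps)
        then have "\<bar>real n * t0 - real n' * t0\<bar> + 1 < \<mu> * 2 ^ a" using A by linarith
        then show ?thesis by (simp add: w_def field_simps)
      qed
      have gS: "0 < ?g n" "?g n \<le> w" "w / 2 < ?g n" "close \<epsilon> x y s p (real n * t0)" "u0 \<le> orbit_pt \<alpha> x (?m n)"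
        if "n \<in> S" for n
        using that h[of n] GD[of n] by (auto simp: S_def w_def)
      have spread: "of_int (?m n' - ?m n) \<le> 2 * Cd * z ^ a" if n: "n \<in> S" "n' \<in> S" for n n'
      proof (cases "?m n \<le> ?m n'")
        case False
        then have "real_of_int (?m n' - ?m n) \<le> 0" by simp
        also have "0 \<le> 2 * Cd * z ^ a" using Cd z by simp
        finally show ?thesis .
      next
        case True
        have sh: "shift x y s p (real n * t0) = shift x y s p (real n' * t0)"
        proof (rule shift_eqI[OF x y w(1) gS(2)[OF n(1)] gS(2)[OF n(2)]])
          have "(\<bar>real n * t0 - real n' * t0\<bar> + 1) * w < c / 2" using near[OF n] \<mu> by linarith
          then show "\<bar>real n * t0 - real n' * t0\<bar> + 1 < c / (2 * w)" using w by (simp add: field_simps)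
        qed
        have "of_int (?m n' - ?m n) \<le> Cd * ?g n powr (- 1 / (1 - \<gamma>))"
        proof (rule idx_spread_le[OF x y Cd drift gS(4)[OF n(1)] gS(4)[OF n(2)] _ w(2) gS(1,2)[OF n(1)] _ sh True])
          show "\<epsilon> \<le> 1 / 2" using \<epsilon> \<epsilon>0 by simp
          show "(\<bar>real n * t0 - real n' * t0\<bar> + 1) * w \<le> c3" using near[OF n] \<mu> by simp
        qed
        also have "\<dots> = Cd * (1 / ?g n) powr \<beta>"
          unfolding \<beta>(3) using gS(1)[OF n(1)] by (simp add: powr_divide powr_minus_divide)
        also have "\<dots> \<le> Cd * (2 * 2 ^ a) powr \<beta>"
          using gS(1,3)[OF n(1)] Cd \<beta> by (intro mult_left_mono powr_mono2) (auto simp: w_def field_simps)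
        also have "\<dots> = Cd * (z * z ^ a)" by (simp only: powr_mult zpow) (simp add: z_def)
        also have "\<dots> \<le> Cd * (2 * z ^ a)" using z Cd by (intro mult_left_mono mult_right_mono) auto
        finally show ?thesis by simp
      qed
      have cardm: "real (card (?m ` S)) \<le> 2 * Cd * z ^ a + 1"
      proof (cases "S = {}")
        case False
        let ?A = "?m ` S"
        have A: "finite ?A" "?A \<noteq> {}" using finS False by auto
        have "?A \<subseteq> {Min ?A..Max ?A}" using A by auto
        then have "card ?A \<le> card {Min ?A..Max ?A}" by (intro card_mono) auto
        moreover have "Min ?A \<le> Max ?A" by (rule Min_le[OF A(1) Max_in[OF A]])
        ultimately have "real (card ?A) \<le> of_int (Max ?A - Min ?A) + 1" by simp
        moreover have "of_int (Max ?A - Min ?A) \<le> 2 * Cd * z ^ a"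
        proof -
          obtain n where n: "n \<in> S" "Min ?A = ?m n" using Min_in[OF A] by blast
          obtain n' where n': "n' \<in> S" "Max ?A = ?m n'" using Max_in[OF A] by blast
          show ?thesis unfolding n(2) n'(2) by (rule spread[OF n(1) n'(1)])
        qed
        ultimately show ?thesis by linarith
      qed (use Cd z in simp)
      have "real (card S) = (\<Sum>m\<in>?m ` S. real (card {n \<in> S. ?m n = m}))" by (rule card_by_fibres[OF finS])
      also have "\<dots> \<le> (\<Sum>m\<in>?m ` S. H / \<bar>t0\<bar> + 1)"
      proof (rule sum_mono)
        fix m assume "m \<in> ?m ` S"
        then have m: "u0 \<le> orbit_pt \<alpha> x m" using gS(5) by auto
        then have "f (orbit_pt \<alpha> x m) \<le> H"
          using u0 gamma by (simp add: f_orbit[OF x] H_def powr_mono2')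
        then have "f (orbit_pt \<alpha> x m) / \<bar>t0\<bar> \<le> H / \<bar>t0\<bar>" by (intro divide_right_mono) auto
        moreover have "real (card {n \<in> S. ?m n = m}) \<le> f (orbit_pt \<alpha> x m) / \<bar>t0\<bar> + 1"
          using finS by (intro card_idx_fibre[OF x t0, of _ s]) auto
        ultimately show "real (card {n \<in> S. ?m n = m}) \<le> H / \<bar>t0\<bar> + 1" by linarith
      qed
      also have "\<dots> = real (card (?m ` S)) * (H / \<bar>t0\<bar> + 1)" by simp
      also have "\<dots> \<le> (2 * Cd * z ^ a + z ^ a) * (H / \<bar>t0\<bar> + 1)"
      proof (rule mult_right_mono)
        have "1 \<le> z ^ a" using z by simp
        then show "real (card (?m ` S)) \<le> 2 * Cd * z ^ a + z ^ a" using cardm by linarith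
      qed (use H in simp)
      also have "\<dots> = W * z ^ a" by (simp add: W_def algebra_simps)
      finally show "real (card {n \<in> G. h n = a \<and> \<lfloor>real n / (b * 2 ^ a)\<rfloor> = i}) \<le> W * z ^ a"
        by (simp add: S_def)
    qed (use z b W \<omega> in auto)
    also have "\<dots> = (W / b / (1 - z / 2) * (z / 2) ^ a0) * real L + 2 * (W * (z / (z - 1)) * \<omega>) * real L"
      by (simp add: algebra_simps)
    also have "\<dots> \<le> (1 / 8) * real L + 2 * (1 / 16) * real L"
    proof -
      have "W * (z / (z - 1)) * \<omega> = 1 / 16" using W z by (simp add: \<omega>_def)
      then show ?thesis using a0(4) by (intro add_mono mult_right_mono) auto
    qed
    finally have G4: "real (card G) \<le> real L / 4" by simp
    have "{n \<in> {K..K+L}. close \<epsilon> x y s p (real n * t0)} \<subseteq> tall \<union> G"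
      by (auto simp: tall_def G_def)
    then have "card {n \<in> {K..K+L}. close \<epsilon> x y s p (real n * t0)} \<le> card (tall \<union> G)"
      using fin by (intro card_mono) auto
    also have "\<dots> \<le> card tall + card G" by (rule card_Un_le)
    finally show ?thesis using tall8 G4 by linarith
  qed
  show thesis
  proof (rule that[OF \<epsilon>0(1,2) \<omega> _ main])
    show "0 < \<tau>" using T by (simp add: \<tau>_def)
  qed assumption+
qed


section \<open>Horizontal sections of large sets\<close>

lemma measurable_ceiling: "f \<in> borel_measurable circle"
proof -
  have "(\<lambda>x. if x = 0 then f 0 else x powr \<gamma> + r) \<in> borel_measurable borel"
    by measurable
  then have "(\<lambda>x. if x = 0 then f 0 else x powr \<gamma> + r) \<in> borel_measurable circle"
    unfolding circle_def by (intro measurable_restrict_space1) simp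
  moreover have "f x = (if x = 0 then f 0 else x powr \<gamma> + r)" if "x \<in> space circle" for x
    using that f_eq[of x] by (auto simp: space_circle)
  ultimately show ?thesis by (simp cong: measurable_cong)
qed

text \<open>The box \<open>(0, 1) \<times> [0, 1]\<close> lies below the graph of \<open>f\<close>. A set of nearly full flow measure covers
  more than half of it, hence more than half of one horizontal section.\<close>
lemma ex_fat_section:
  assumes f0: "0 < f 0"
  obtains \<epsilon>1 where "0 < \<epsilon>1"
    "\<And>Z. Z \<in> sets (flow_measure circle f) \<Longrightarrow> 1 - \<epsilon>1 < measure (flow_measure circle f) Z \<Longrightarrow>
      \<exists>s\<in>{0..1}. \<exists>E. E \<in> sets borel \<and> E \<subseteq> {0<..<1} \<and> 1 / 2 < measure lebesgue E \<and> (\<forall>x\<in>E. (x, s) \<in> Z)"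
proof -
  define N where "N = circle \<Otimes>\<^sub>M (lborel :: real measure)"
  define X where "X = flow_space circle f"
  define R where "R = restrict_space N X"
  have M: "flow_measure circle f = uniform_measure R X"
    by (simp add: flow_measure_def R_def N_def X_def)
  have spN: "space N = {0..<1} \<times> UNIV" by (simp add: N_def space_pair_measure space_circle)
  have [measurable]: "f \<in> borel_measurable circle" by (rule measurable_ceiling)
  have XN: "X \<in> sets N"
  proof -
    have "X = {z \<in> space N. 0 \<le> snd z \<and> snd z < f (fst z)}"
      by (auto simp: X_def flow_space_def spN space_circle)
    also have "\<dots> \<in> sets N" unfolding N_def by measurable
    finally show ?thesis .
  qed
  have XsubN: "X \<inter> space N \<in> sets N" "X \<subseteq> space N" using XN sets.sets_into_space by auto
  have setsR: "A \<in> sets R \<longleftrightarrow> A \<in> sets N \<and> A \<subseteq> X" for A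
    using sets_restrict_space_iff[OF XsubN(1)] by (auto simp: R_def)
  have emR: "emeasure R A = emeasure N A" if "A \<subseteq> X" for A
    unfolding R_def by (rule emeasure_restrict_space[OF XsubN(1) that])
  define B where "B = {0<..<1::real} \<times> {0..1::real}"
  have sc: "A \<in> sets circle \<longleftrightarrow> A \<in> sets borel \<and> A \<subseteq> {0..<1}" for A
    unfolding circle_def by (auto simp: sets_restrict_space_iff)
  have ec: "emeasure circle A = emeasure lborel A" if "A \<subseteq> {0..<1}" for A
    unfolding circle_def using that by (intro emeasure_restrict_space) auto
  have I01: "{0<..<1} \<in> sets circle" by (auto simp: sc)
  have BN: "B \<in> sets N" unfolding B_def N_def using I01 by (intro pair_measureI) auto
  have BX: "B \<subseteq> X"
  proof
    fix z assume "z \<in> B"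
    then obtain x s where z: "z = (x, s)" "0 < x" "x < 1" "0 \<le> s" "s \<le> 1" by (auto simp: B_def)
    have "s < f x" using one_le_powr[of x] z f_eq[of x] r_pos by simp
    then show "z \<in> X" using z by (simp add: X_def flow_space_def space_circle)
  qed
  have "emeasure circle {0<..<1} = 1" by (subst ec) auto
  then have eB: "emeasure N B = 1"
    unfolding B_def N_def using I01 by (simp add: lborel.emeasure_pair_measure_Times)
  have A1: "1 \<le> emeasure R X"
    using emeasure_mono[OF BX XN] eB by (simp add: emR)
  show thesis
  proof (cases "emeasure R X = \<infinity>")
    case True
    \<comment> \<open>a total mass \<open>\<infinity>\<close> would make the normalised measure vanish\<close>
    have "measure (flow_measure circle f) Z = 0" if "Z \<in> sets (flow_measure circle f)" for Z
      using that True XN by (simp add: M measure_def setsR)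
    then show thesis by (intro that[of 1]) auto
  next
    case False
    define a where "a = measure R X"
    have aA: "emeasure R X = ennreal a" using False by (simp add: a_def emeasure_eq_ennreal_measure)
    have a1: "1 \<le> a" using A1 unfolding aA by (metis ennreal_le_iff ennreal_1 a_def measure_nonneg)
    have spR: "space R = X" using XsubN(2) by (auto simp: R_def space_restrict_space)
    have XR: "X \<in> sets R" and BR: "B \<in> sets R" using XN BN BX by (auto simp: setsR)
    have A0: "emeasure R X \<noteq> 0" using A1 by auto
    interpret R: finite_measure R
      using False by (intro finite_measureI) (simp add: spR)
    have mRN: "measure R A = measure N A" if "A \<in> sets R" for A
      using that by (simp add: measure_def emR setsR)
    have mNB: "measure N B = 1" using eB by (simp add: measure_def)
    show thesis
    proof (rule that[of "1 / (4 * a)"])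
      show "0 < 1 / (4 * a)" using a1 by simp
      fix Z assume Z: "Z \<in> sets (flow_measure circle f)" "1 - 1 / (4 * a) < measure (flow_measure circle f) Z"
      have ZR: "Z \<in> sets R" using Z by (simp add: M)
      have BZ: "B \<inter> Z \<in> sets R" "B \<inter> Z \<in> sets N" using ZR BR by (auto simp: setsR)
      have "measure (flow_measure circle f) Z = measure R Z / a"
      proof -
        have "X \<inter> Z = Z" using ZR by (auto simp: setsR)
        then show ?thesis using measure_uniform_measure[OF A0 _ ZR] False by (simp add: M a_def)
      qed
      then have "1 - 1 / (4 * a) < measure R Z / a" using Z(2) by simp
      then have "(1 - 1 / (4 * a)) * a < measure R Z / a * a" using a1 by (intro mult_strict_right_mono) auto
      then have mZ: "a - 1 / 4 < measure R Z" using a1 by (simp add: algebra_simps)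
      have "measure R B \<le> measure R ((B \<inter> Z) \<union> (X - Z))"
        using BZ ZR XR BX by (intro R.finite_measure_mono) auto
      also have "\<dots> \<le> measure R (B \<inter> Z) + measure R (X - Z)"
        using BZ ZR XR by (intro measure_Un_le) auto
      also have "measure R (X - Z) = a - measure R Z"
        unfolding a_def using ZR XR by (intro R.finite_measure_Diff) (auto simp: setsR)
      finally have big: "3 / 4 < measure N (B \<inter> Z)"
        using mZ mRN[OF BR] mRN[OF BZ(1)] mNB by simp
      interpret C: sigma_finite_measure circle
        unfolding circle_def by (rule sigma_finite_measure_restrict_space) (auto intro: lborel.sigma_finite_measure_axioms)
      interpret pair_sigma_finite circle lborel ..
      have "\<exists>s\<in>{0..1}. ennreal (1 / 2) < emeasure circle ((\<lambda>x. (x, s)) -` (B \<inter> Z))"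
      proof (rule ccontr)
        assume "\<not> ?thesis"
        then have le: "emeasure circle ((\<lambda>x. (x, s)) -` (B \<inter> Z)) \<le> ennreal (1 / 2) * indicator {0..1} s" for s
          by (cases "s \<in> {0..1}") (auto simp: B_def not_less)
        have "emeasure N (B \<inter> Z) = (\<integral>\<^sup>+ s. emeasure circle ((\<lambda>x. (x, s)) -` (B \<inter> Z)) \<partial>lborel)"
          unfolding N_def by (rule emeasure_pair_measure_alt2[OF BZ(2)[unfolded N_def]])
        also have "\<dots> \<le> (\<integral>\<^sup>+ s. ennreal (1 / 2) * indicator {0..1::real} s \<partial>lborel)"
          by (rule nn_integral_mono) (rule le)
        also have "\<dots> = ennreal (1 / 2)" by (simp add: nn_integral_cmult_indicator)
        finally have "emeasure N (B \<inter> Z) \<le> ennreal (1 / 2)" .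
        then have "measure N (B \<inter> Z) \<le> 1 / 2" unfolding measure_def by (intro enn2real_leI) auto
        then show False using big by simp
      qed
      then obtain s where s: "s \<in> {0..1}" "ennreal (1 / 2) < emeasure circle ((\<lambda>x. (x, s)) -` (B \<inter> Z))" by blast
      define E where "E = (\<lambda>x. (x, s)) -` (B \<inter> Z)"
      have E1: "E \<subseteq> {0<..<1}" by (auto simp: E_def B_def)
      have "E \<in> sets circle" unfolding E_def by (rule sets_Pair2[OF BZ(2)[unfolded N_def]])
      then have E2: "E \<in> sets borel" by (simp add: sc)
      have El: "E \<in> lmeasurable"
        using E1 E2 bounded_subset[of "{0<..<1::real}" E] by (intro bounded_set_imp_lmeasurable) auto
      have "emeasure circle E = emeasure lebesgue E" using E1 E2 by (subst ec) auto
      then have "ennreal (1 / 2) < ennreal (measure lebesgue E)"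
        using s(2) emeasure_eq_measure2[OF El] unfolding E_def[symmetric] by simp
      then have "1 / 2 < measure lebesgue E" by (subst (asm) ennreal_less_iff) auto
      then show "\<exists>s\<in>{0..1}. \<exists>E. E \<in> sets borel \<and> E \<subseteq> {0<..<1} \<and> 1 / 2 < measure lebesgue E \<and> (\<forall>x\<in>E. (x, s) \<in> Z)"
        using s(1) E1 E2 by (intro bexI[of _ s] exI[of _ E]) (auto simp: E_def)
    qed
  qed
qed


section \<open>A pair whose drift jumps\<close>

text \<open>A separation at time \<open>i\<close> puts the orbit point just to the left of the singularity, too close
  to the one that is just to the right of it at time \<open>J\<close>.\<close>
lemma no_separation:
  assumes R: "0 < R" "\<bar>real_of_int i\<bar> \<le> R" "\<bar>real_of_int J\<bar> \<le> R" and iJ: "i \<noteq> J"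
    and J: "orbit_pt \<alpha> x J + \<delta> < c / (2 * R)"
  shows "orbit_pt \<alpha> x i + \<delta> < 1"
proof -
  have "\<bar>real_of_int (i - J)\<bar> \<le> 2 * R" using R by simp
  from orbit_gap(1)[OF badly iJ this, of x]
  have "c / (2 * R) \<le> int_dist (orbit_pt \<alpha> x i - orbit_pt \<alpha> x J)" .
  also have "\<dots> \<le> \<bar>orbit_pt \<alpha> x i - orbit_pt \<alpha> x J - of_int 1\<bar>" by (rule int_dist_le)
  also have "\<dots> = 1 - orbit_pt \<alpha> x i + orbit_pt \<alpha> x J"
    using frac_lt_1[of "x + of_int i * \<alpha>"] frac_ge_0[of "x + of_int J * \<alpha>"]
    unfolding of_int_1 by linarith
  finally show ?thesis using J by linarith
qed

lemma drift_before_le: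
  assumes j: "0 < j" "\<bar>real_of_int J\<bar> = j" and I: "finite I" "\<And>i. i \<in> I \<Longrightarrow> i \<noteq> J \<and> \<bar>real_of_int i\<bar> \<le> j"
    and J: "orbit_pt \<alpha> x J < c / (2 * j)" and \<delta>: "0 < \<delta>"
    and sep: "\<And>i. i \<in> I \<Longrightarrow> orbit_pt \<alpha> x i + \<delta> < 1"
  shows "(\<Sum>i\<in>I. orbit_pt \<alpha> x i powr \<gamma> - orbit_pt \<alpha> (x + \<delta>) i powr \<gamma>)
    \<le> \<delta> * (\<Sum>n. real n powr (\<gamma> - 1)) * (c / (2 * j)) powr (\<gamma> - 1)"
proof (rule drift_le)
  show "0 < c / (2 * j)" using c_pos j by simp
  have gap: "c / (2 * j) \<le> \<bar>orbit_pt \<alpha> x i - orbit_pt \<alpha> x k\<bar>"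
    if "\<bar>real_of_int i\<bar> \<le> j" "\<bar>real_of_int k\<bar> \<le> j" "i \<noteq> k" for i k
  proof -
    have "\<bar>real_of_int (i - k)\<bar> \<le> 2 * j" using that by simp
    from orbit_gap(2)[OF badly that(3) this] show ?thesis .
  qed
  show "c / (2 * j) \<le> \<bar>orbit_pt \<alpha> x i - orbit_pt \<alpha> x k\<bar>" if "i \<in> I" "k \<in> I" "i \<noteq> k" for i k
    using gap that I by blast
  show "c / (2 * j) \<le> orbit_pt \<alpha> x i \<and> orbit_pt \<alpha> x i + \<delta> < 1" if i: "i \<in> I" for i
  proof -
    have "c / (2 * j) \<le> \<bar>orbit_pt \<alpha> x i - orbit_pt \<alpha> x J\<bar>" using gap[of i J] I(2)[OF i] j by simp
    then show ?thesis
      using sep[OF i] J frac_ge_0[of "x + of_int i * \<alpha>"] frac_ge_0[of "x + of_int J * \<alpha>"] by linarith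
  qed
qed (use gamma I \<delta> in auto)

lemma drift_after_ge:
  assumes x: "x \<in> regular" and I: "finite I" "J \<in> I" and \<delta>: "0 < \<delta>"
    and sep: "\<And>i. i \<in> I \<Longrightarrow> orbit_pt \<alpha> x i + \<delta> < 1"
  shows "- \<gamma> * \<delta> * (orbit_pt \<alpha> x J + \<delta>) powr (\<gamma> - 1)
    \<le> (\<Sum>i\<in>I. orbit_pt \<alpha> x i powr \<gamma> - orbit_pt \<alpha> (x + \<delta>) i powr \<gamma>)"
proof -
  have sh: "orbit_pt \<alpha> (x + \<delta>) i = orbit_pt \<alpha> x i + \<delta>" if "i \<in> I" for i
    using sep[OF that] \<delta> by (intro orbit_pt_shift) auto
  have "- \<gamma> * \<delta> * (orbit_pt \<alpha> x J + \<delta>) powr (\<gamma> - 1)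
      \<le> orbit_pt \<alpha> x J powr \<gamma> - orbit_pt \<alpha> (x + \<delta>) J powr \<gamma>"
    unfolding sh[OF I(2)] using regular_orbit[OF x, of J] gamma \<delta> by (intro powr_diff_bounds) auto
  also have "\<dots> \<le> (\<Sum>i\<in>I. orbit_pt \<alpha> x i powr \<gamma> - orbit_pt \<alpha> (x + \<delta>) i powr \<gamma>)"
  proof (intro member_le_sum I)
    fix i assume "i \<in> I - {J}"
    then have i: "i \<in> I" by simp
    show "0 \<le> orbit_pt \<alpha> x i powr \<gamma> - orbit_pt \<alpha> (x + \<delta>) i powr \<gamma>"
      unfolding sh[OF i] using regular_orbit[OF x, of i] gamma \<delta> by (simp add: powr_mono2')
  qed
  finally show ?thesis .
qed

lemma drift_sum_nonneg:
  assumes x: "x \<in> regular" and \<delta>: "0 < \<delta>"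
    and sep: "\<And>i. i \<in> I \<Longrightarrow> orbit_pt \<alpha> x i + \<delta> < 1"
  shows "0 \<le> (\<Sum>i\<in>I. orbit_pt \<alpha> x i powr \<gamma> - orbit_pt \<alpha> (x + \<delta>) i powr \<gamma>)"
proof (rule sum_nonneg)
  fix i assume i: "i \<in> I"
  have "orbit_pt \<alpha> (x + \<delta>) i = orbit_pt \<alpha> x i + \<delta>"
    using sep[OF i] \<delta> by (intro orbit_pt_shift) auto
  then show "0 \<le> orbit_pt \<alpha> x i powr \<gamma> - orbit_pt \<alpha> (x + \<delta>) i powr \<gamma>"
    using regular_orbit[OF x, of i] gamma \<delta> by (simp add: powr_mono2')
qed

text \<open>Up to the time \<open>R\<close> there is no separation, so the drift is monotone: it is small until it
  passes the visit at time \<open>J\<close> and at least as large as the contribution of this visit afterwards.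
  The sign condition says that \<open>m\<close> lies on the same side of \<open>0\<close> as \<open>J\<close>.\<close>
lemma drift_jump:
  assumes x: "x \<in> regular" and y: "x + \<delta> \<in> regular" and \<delta>: "0 < \<delta>"
    and j: "0 < j" "j \<le> R" "\<bar>real_of_int J\<bar> = j"
    and J: "orbit_pt \<alpha> x J + \<delta> < c / (2 * R)" "orbit_pt \<alpha> x J + \<delta> < 1"
    and m: "\<bar>real_of_int m\<bar> \<le> R" "0 \<le> J * m"
  shows "\<bar>F m x - F m (x + \<delta>)\<bar> \<le> \<delta> * (\<Sum>n. real n powr (\<gamma> - 1)) * (c / (2 * j)) powr (\<gamma> - 1) \<or>
    - \<gamma> * \<delta> * (orbit_pt \<alpha> x J + \<delta>) powr (\<gamma> - 1) \<le> \<bar>F m x - F m (x + \<delta>)\<bar>"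
proof -
  define I where "I = (if 0 \<le> m then {0..<m} else {m..<0})"
  let ?S = "\<Sum>i\<in>I. orbit_pt \<alpha> x i powr \<gamma> - orbit_pt \<alpha> (x + \<delta>) i powr \<gamma>"
  have x01: "x \<in> {0..<1}" "x + \<delta> \<in> {0..<1}" using x y by (auto simp: regular_def)
  have FS: "\<bar>F m x - F m (x + \<delta>)\<bar> = \<bar>?S\<bar>"
  proof (cases "0 \<le> m")
    case True
    then show ?thesis using F_diff[OF x01(1), of 0 m] F_diff[OF x01(2), of 0 m]
      by (simp add: I_def f_orbit[OF x] f_orbit[OF y] sum.distrib sum_subtractf)
  next
    case False
    then show ?thesis using F_diff[OF x01(1), of m 0] F_diff[OF x01(2), of m 0]
      by (simp add: I_def f_orbit[OF x] f_orbit[OF y] sum.distrib sum_subtractf)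
  qed
  have Im: "\<bar>i\<bar> \<le> \<bar>m\<bar>" if "i \<in> I" for i using that by (auto simp: I_def split: if_splits)
  have IR: "\<bar>real_of_int i\<bar> \<le> R" if "i \<in> I" for i using Im[OF that] m(1) by linarith
  have fin: "finite I" by (simp add: I_def)
  have sep: "orbit_pt \<alpha> x i + \<delta> < 1" if i: "i \<in> I" for i
  proof (cases "i = J")
    case False
    show ?thesis by (rule no_separation[OF _ IR[OF i] _ False J(1)]) (use j in auto)
  qed (use J(2) in simp)
  have S0: "0 \<le> ?S" by (rule drift_sum_nonneg[OF x \<delta> sep])
  show ?thesis
  proof (cases "J \<in> I")
    case True
    then show ?thesis using drift_after_ge[OF x fin True \<delta> sep] FS S0 by simp
  next
    case False
    have J0: "J \<noteq> 0" using j by auto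
    have "\<bar>i\<bar> \<le> \<bar>J\<bar>" if i: "i \<in> I" for i
    proof (cases "0 \<le> m")
      case True
      then have "0 < m" using i by (cases "m = 0") (auto simp: I_def)
      then have "0 < J" using m(2) J0 by (auto simp: zero_le_mult_iff)
      then show ?thesis using False i True by (auto simp: I_def)
    next
      case c: False
      then have "J < 0" using m(2) J0 by (auto simp: zero_le_mult_iff)
      then show ?thesis using False i c by (auto simp: I_def)
    qed
    then have "i \<noteq> J \<and> \<bar>real_of_int i\<bar> \<le> j" if "i \<in> I" for i
      using that False j(3) by (metis of_int_abs of_int_le_iff)
    moreover have "orbit_pt \<alpha> x J < c / (2 * j)"
    proof -
      have "c / (2 * R) \<le> c / (2 * j)" using j c_pos by (intro divide_left_mono) auto
      then show ?thesis using J(1) \<delta> by linarith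
    qed
    ultimately show ?thesis using drift_before_le[OF j(1,3) fin _ _ \<delta> sep] FS S0 by simp
  qed
qed


section \<open>Failure of the property\<close>

lemma regular_Compl: "{0..<1} - regular \<subseteq> range (\<lambda>i::int. frac (- (of_int i * \<alpha>)))"
proof
  fix x assume x: "x \<in> {0..<1} - regular"
  then obtain i where i: "orbit_pt \<alpha> x i = 0" by (auto simp: regular_def)
  then have "x + of_int i * \<alpha> \<in> \<int>" by (simp add: frac_eq_0_iff)
  then have "frac (- (of_int i * \<alpha>)) = x" using x by (auto simp: frac_unique_iff) (metis Ints_minus minus_add_distrib uminus_add_conv_diff)
  then show "x \<in> range (\<lambda>i::int. frac (- (of_int i * \<alpha>)))" by blast
qed

text \<open>The constants are chosen in this order: \<open>\<epsilon>\<close> from \<open>t0\<close> and \<open>P\<close>; then, given \<open>\<kappa>\<close>, the bound \<open>D\<close> for the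
  number of base steps relative to \<open>L\<close>, and \<open>N\<close>; then, given \<open>Z\<close>, the set \<open>E'\<close> of admissible base points;
  then the scale \<open>\<rho>\<close> of the offset, which keeps the drift below the values in \<open>P\<close> before the
  close visit, the factor \<open>C2\<close> by which a window may outlast the visit, and \<open>\<theta>\<close>, which depends on both.\<close>
lemma not_R_property:
  assumes f0: "0 < f 0" and t0: "t0 \<noteq> 0" and P: "compact P" "0 \<notin> P"
  shows "\<not> R_property (flow_measure circle f) (flow_dist circle_dist)
           (special_flow circle (rotation \<alpha>) f) t0 P"
proof
  assume R: "R_property (flow_measure circle f) (flow_dist circle_dist)
           (special_flow circle (rotation \<alpha>) f) t0 P"
  let ?T = "special_flow circle (rotation \<alpha>) f"
  obtain cP CP where cP: "0 < cP" "0 < CP" "\<And>p. p \<in> P \<Longrightarrow> cP \<le> \<bar>p\<bar>" "\<And>p. p \<in> P \<Longrightarrow> \<bar>p\<bar> \<le> CP"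
  proof -
    obtain CP where "0 < CP" "\<And>p. p \<in> P \<Longrightarrow> \<bar>p\<bar> \<le> CP"
      using compact_imp_bounded[OF P(1)] by (auto simp: bounded_pos)
    moreover have "open (- P)" using P(1) by (simp add: compact_imp_closed open_Compl)
    then obtain cP where "0 < cP" "ball 0 cP \<subseteq> - P" using P(2) by (auto simp: open_contains_ball)
    then have "cP \<le> \<bar>p\<bar>" if "p \<in> P" for p using that by (force simp: subset_iff)
    ultimately show thesis using that \<open>0 < cP\<close> by blast
  qed
  define \<beta> where "\<beta> = 1 / (1 - \<gamma>)"
  have \<beta>: "0 < \<beta>" "\<beta> < 1" "- 1 / (1 - \<gamma>) = - \<beta>" "\<beta> * (1 - \<gamma>) = 1" "\<beta> * (\<gamma> - 1) = -1"
    using gamma by (auto simp: \<beta>_def field_simps)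
  obtain \<epsilon>0 \<omega> \<tau> where \<epsilon>0: "0 < \<epsilon>0" "\<epsilon>0 \<le> 1 / 4" and \<omega>: "0 < \<omega>" and \<tau>: "0 < \<tau>" and few:
    "\<And>\<epsilon> x y s p K L. \<epsilon> \<le> \<epsilon>0 \<Longrightarrow> x \<in> regular \<Longrightarrow> y \<in> regular \<Longrightarrow> 0 < L \<Longrightarrow>
      (\<And>n. n \<in> {K..K+L} \<Longrightarrow> f (orbit_pt \<alpha> x (idx (real n * t0 + s) x)) \<le> \<tau> * real L) \<Longrightarrow>
      (\<And>n. n \<in> {K..K+L} \<Longrightarrow> close \<epsilon> x y s p (real n * t0) \<Longrightarrow>
          0 < gap x y s p (real n * t0) \<and>
          gap x y s p (real n * t0) powr (- 1 / (1 - \<gamma>)) \<le> \<omega> * real L) \<Longrightarrow>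
      real (card {n \<in> {K..K+L}. close \<epsilon> x y s p (real n * t0)}) \<le> real L / 2"
    using few_close_times[OF t0] by blast
  obtain \<epsilon>1 where \<epsilon>1: "0 < \<epsilon>1" and fat:
    "\<And>Z. Z \<in> sets (flow_measure circle f) \<Longrightarrow> 1 - \<epsilon>1 < measure (flow_measure circle f) Z \<Longrightarrow>
      \<exists>s\<in>{0..1}. \<exists>E. E \<in> sets borel \<and> E \<subseteq> {0<..<1} \<and> 1 / 2 < measure lebesgue E \<and> (\<forall>x\<in>E. (x, s) \<in> Z)"
    using ex_fat_section[OF f0] by blast
  define \<epsilon> where "\<epsilon> = min (min \<epsilon>0 \<epsilon>1) (min (cP / 2) CP)"
  have \<epsilon>: "0 < \<epsilon>" "\<epsilon> \<le> \<epsilon>0" "\<epsilon> \<le> \<epsilon>1" "\<epsilon> \<le> cP / 2" "\<epsilon> \<le> CP"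
    using \<epsilon>0 \<epsilon>1 cP by (auto simp: \<epsilon>_def)
  obtain \<kappa> where \<kappa>: "0 < \<kappa>" and R': "\<And>N. \<exists>\<delta>>0. \<exists>Z\<in>sets (flow_measure circle f).
      measure (flow_measure circle f) Z > 1 - \<epsilon> \<and>
      (\<forall>x\<in>Z. \<forall>y\<in>Z. flow_dist circle_dist x y < \<delta> \<and> x \<notin> range (\<lambda>t. ?T t y) \<longrightarrow>
        (\<exists>K L::nat. \<exists>p\<in>P. K > N \<and> L > N \<and> real L / real K \<ge> \<kappa> \<and>
          real (card {n \<in> {K..K + L}. flow_dist circle_dist (?T (real n * t0) x) (?T (real n * t0 + p) y) < \<epsilon>}) / real L
            > 1 - \<epsilon>))"
    using R \<epsilon>(1) unfolding R_property_def by blast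
  \<comment> \<open>base indices met in a window with \<open>L \<ge> \<kappa> * K\<close> are at most \<open>D * L\<close> in absolute value\<close>
  define D where "D = \<bar>t0\<bar> * (1 / \<kappa> + 1) + 1"
  have D: "1 \<le> D" using \<kappa> by (simp add: D_def)
  define c1 where "c1 = c / (2 * (1 / c + 2))"
  have c1: "0 < c1" unfolding c1_def using c_pos by (intro divide_pos_pos mult_pos_pos add_pos_pos) auto
  have "1 / \<gamma> < -1" using gamma by (simp add: field_simps)
  then obtain m1 :: nat and V where m1: "0 < m1" and V: "V \<in> sets borel" "V \<in> lmeasurable" "measure lebesgue V \<le> 1 / 4"
    and Vm: "\<And>x m. x \<in> {0..<1} \<Longrightarrow> x \<notin> V \<Longrightarrow>
      (\<tau> / (2 * (D + 1)) * (\<bar>real_of_int m\<bar> + real m1)) powr (1 / \<gamma>) \<le> orbit_pt \<alpha> x m"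
    using ex_small_close_visit_set[of "\<tau> / (2 * (D + 1))" "1 / \<gamma>" \<alpha>] \<tau> D by auto
  \<comment> \<open>beyond \<open>L1\<close>, a gap of at least \<open>c1 / (2 * D * L)\<close> is large enough for the count of close times\<close>
  define L1 where "L1 = ((2 * D / c1) powr \<beta> / \<omega>) powr (1 / (1 - \<beta>))"
  obtain N :: nat where N: "real m1 \<le> N" "1 \<le> N" "2 * r / \<tau> \<le> N" "CP + 2 \<le> N" "L1 \<le> N" "2 / \<bar>t0\<bar> \<le> N"
  proof -
    obtain N :: nat where "real m1 + 1 + 2 * r / \<tau> + (CP + 2) + L1 + 2 / \<bar>t0\<bar> \<le> real N"
      using real_arch_simple by blast
    moreover have "0 \<le> 2 * r / \<tau>" "0 \<le> L1" "0 \<le> 2 / \<bar>t0\<bar>" using r_pos \<tau> by (auto simp: L1_def)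
    ultimately show thesis using cP(2) by (intro that[of N]) linarith+
  qed
  obtain \<delta>0 Z where \<delta>0: "0 < \<delta>0" and Z: "Z \<in> sets (flow_measure circle f)" "1 - \<epsilon> < measure (flow_measure circle f) Z"
    and pairs: "\<And>x y. x \<in> Z \<Longrightarrow> y \<in> Z \<Longrightarrow> flow_dist circle_dist x y < \<delta>0 \<Longrightarrow> x \<notin> range (\<lambda>t. ?T t y) \<Longrightarrow>
        (\<exists>K L::nat. \<exists>p\<in>P. K > N \<and> L > N \<and> real L / real K \<ge> \<kappa> \<and>
          real (card {n \<in> {K..K + L}. flow_dist circle_dist (?T (real n * t0) x) (?T (real n * t0 + p) y) < \<epsilon>}) / real L
            > 1 - \<epsilon>)"
    using R'[of N] by (elim exE bexE conjE) blast
  obtain s E where s: "0 \<le> s" "s \<le> 1" and E: "E \<in> sets borel" "E \<subseteq> {0<..<1}" "1 / 2 < measure lebesgue E"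
    and EZ: "\<And>x. x \<in> E \<Longrightarrow> (x, s) \<in> Z"
    using fat[OF Z(1)] Z(2) \<epsilon>(3) by fastforce
  define Orb where "Orb = range (\<lambda>i::int. frac (- (of_int i * \<alpha>)))"
  define E' where "E' = E - V - Orb"
  have E'r: "x \<in> regular" if "x \<in> E'" for x
  proof -
    have "x \<in> {0<..<1}" "x \<notin> Orb" using that E(2) by (auto simp: E'_def)
    moreover have "x \<notin> {0..<1} - regular"
      using regular_Compl \<open>x \<notin> Orb\<close> unfolding Orb_def by blast
    ultimately have "x \<in> {0..<1}" "x \<notin> {0..<1} - regular" by auto
    then show ?thesis by blast
  qed
  have E'm: "E' \<in> lmeasurable" "0 < measure lebesgue E'" "bounded E'"
  proof -
    have Orb: "countable Orb" by (simp add: Orb_def)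
    have OS: "Orb \<in> null_sets lebesgue" using Orb by (simp add: countable_imp_null_set_lborel null_sets_completionI)
    have bE: "bounded E" using E(2) bounded_subset[of "{0<..<1::real}" E] by auto
    then have El: "E \<in> lmeasurable" using E(1) by (intro bounded_set_imp_lmeasurable) auto
    show "bounded E'" using bE by (rule bounded_subset) (auto simp: E'_def)
    have EV: "E - V \<in> lmeasurable" using El V by (intro fmeasurable.Diff) auto
    show "E' \<in> lmeasurable" unfolding E'_def by (rule fmeasurable_Diff[OF EV null_setsD2[OF OS]])
    have "measure lebesgue E' = measure lebesgue (E - V)"
      unfolding E'_def by (rule measure_Diff_null_set[OF fmeasurableD[OF EV] OS])
    moreover have "measure lebesgue E \<le> measure lebesgue (E - V) + measure lebesgue V"
    proof -
      have "measure lebesgue E \<le> measure lebesgue ((E - V) \<union> V)"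
        using EV V El by (intro measure_mono_fmeasurable fmeasurable.Un) auto
      also have "\<dots> \<le> measure lebesgue (E - V) + measure lebesgue V"
        using EV V by (intro measure_Un_le) auto
      finally show ?thesis .
    qed
    ultimately show "0 < measure lebesgue E'" using E(3) V(3) by linarith
  qed
  \<comment> \<open>the offset is tuned to the time \<open>j\<close> of the close visit: \<open>\<delta> j\<close> is of order \<open>j powr (\<gamma> - 1)\<close>\<close>
  define Zc where "Zc = (\<Sum>n. real n powr (\<gamma> - 1))"
  have Zc: "0 \<le> Zc" unfolding Zc_def using gamma by (intro suminf_nonneg) (auto simp: summable_real_powr_iff)
  define \<rho> where "\<rho> = cP / ((Zc + 1) * (c / 2) powr (\<gamma> - 1))"
  have \<rho>: "0 < \<rho>" unfolding \<rho>_def using cP Zc c_pos by (intro divide_pos_pos mult_pos_pos) auto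
  define \<rho>1 where "\<rho>1 = c * \<rho> / 4"
  have \<rho>1: "0 < \<rho>1" using c_pos \<rho> by (simp add: \<rho>1_def)
  define C2 where "C2 = max 1 (D / \<omega> * \<rho>1 powr (- \<beta>))"
  have C2: "1 \<le> C2" "D / \<omega> * \<rho>1 powr (- \<beta>) \<le> C2" by (auto simp: C2_def)
  \<comment> \<open>\<open>Y \<le> (2 * \<theta>) powr (\<gamma> - 1)\<close> makes the jump at the close visit exceed \<open>2 * CP\<close>\<close>
  define Y where "Y = (2 * CP + 1) / (- \<gamma> * \<rho>1)"
  have Y: "0 < Y" unfolding Y_def using cP gamma \<rho>1 by (intro divide_pos_pos mult_pos_pos) auto
  define \<theta> where "\<theta> = min (min (1 / 4) (c / (8 * C2))) (Y powr (- \<beta>) / 2)"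
  have \<theta>: "0 < \<theta>" "\<theta> \<le> 1 / 4" "\<theta> \<le> c / (8 * C2)" "2 * \<theta> \<le> Y powr (- \<beta>)"
    using c_pos C2 Y by (auto simp: \<theta>_def)
  define Nj where "Nj j = nat \<lceil>real j powr (1 - \<gamma>) / \<rho>\<rceil>" for j
  have "\<exists>\<delta>. c / (2 * real (Nj j)) \<le> \<delta> \<and> \<delta> \<le> 1 / (2 * real (Nj j)) \<and>
      (\<forall>k::int. k \<noteq> 0 \<longrightarrow> c1 / \<bar>real_of_int k\<bar> \<le> int_dist (\<delta> + of_int k * \<alpha>))" if "0 < Nj j" for j
    using well_spread_offset[OF badly that] unfolding c1_def by metis
  then obtain \<delta> where \<delta>: "\<And>j. 0 < Nj j \<Longrightarrow> c / (2 * real (Nj j)) \<le> \<delta> j"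
    "\<And>j. 0 < Nj j \<Longrightarrow> \<delta> j \<le> 1 / (2 * real (Nj j))"
    "\<And>j k. 0 < Nj j \<Longrightarrow> k \<noteq> 0 \<Longrightarrow> c1 / \<bar>real_of_int k\<bar> \<le> int_dist (\<delta> j + of_int k * \<alpha>)"
    by metis
  obtain j0 :: nat where j0: "1 \<le> j0" "\<rho> \<le> j0" "(\<theta> / (2 * \<rho>)) powr (1 / \<gamma>) \<le> j0" "\<theta> / \<delta>0 \<le> j0"
  proof -
    obtain j0 :: nat where "1 + \<rho> + (\<theta> / (2 * \<rho>)) powr (1 / \<gamma>) + \<theta> / \<delta>0 \<le> real j0"
      using real_arch_simple by blast
    moreover have "0 \<le> \<theta> / \<delta>0" "0 \<le> (\<theta> / (2 * \<rho>)) powr (1 / \<gamma>)" using \<theta> \<delta>0 by auto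
    ultimately show thesis using \<rho> by (intro that[of j0]) linarith+
  qed
  have size: "0 < Nj j" "0 < \<delta> j" "\<rho>1 * real j powr (\<gamma> - 1) \<le> \<delta> j" "\<delta> j \<le> \<rho> / 2 * real j powr (\<gamma> - 1)"
    "\<delta> j \<le> 1 / 2" "\<delta> j \<le> \<theta> / (4 * real j)" if j: "j0 \<le> j" for j
  proof -
    have jr: "1 \<le> real j" "\<rho> \<le> real j" "(\<theta> / (2 * \<rho>)) powr (1 / \<gamma>) \<le> real j" using j j0 by linarith+
    define B where "B = real j powr (1 - \<gamma>) / \<rho>"
    have "real j powr 1 \<le> real j powr (1 - \<gamma>)" using jr gamma by (intro powr_mono) auto
    then have "\<rho> \<le> real j powr (1 - \<gamma>)" using jr by simp
    then have B1: "1 \<le> B" using \<rho> by (simp add: B_def)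
    have NB: "B \<le> real (Nj j)" "real (Nj j) \<le> 2 * B" using B1 unfolding Nj_def B_def[symmetric] by linarith+
    show N0: "0 < Nj j" using NB B1 by linarith
    have inv: "1 / B = \<rho> * real j powr (\<gamma> - 1)"
      using \<rho> jr powr_minus_divide[of "real j" "1 - \<gamma>"] by (simp add: B_def field_simps)
    have "\<rho>1 * real j powr (\<gamma> - 1) = c / 4 * (\<rho> * real j powr (\<gamma> - 1))" by (simp add: \<rho>1_def)
    also have "\<dots> = c / (2 * (2 * B))" unfolding inv[symmetric] by simp
    also have "\<dots> \<le> c / (2 * real (Nj j))" using NB N0 c_pos B1 by (intro divide_left_mono) auto
    also have "\<dots> \<le> \<delta> j" by (rule \<delta>(1)[OF N0])
    finally show lo: "\<rho>1 * real j powr (\<gamma> - 1) \<le> \<delta> j" .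
    have "0 < \<rho>1 * real j powr (\<gamma> - 1)" using \<rho>1 jr by simp
    then show "0 < \<delta> j" using lo by linarith
    have up0: "\<delta> j \<le> 1 / (2 * real (Nj j))" by (rule \<delta>(2)[OF N0])
    also have "\<dots> \<le> 1 / (2 * B)" using NB N0 B1 by (intro divide_left_mono) auto
    also have "\<dots> = 1 / B / 2" by simp
    also have "\<dots> = \<rho> / 2 * real j powr (\<gamma> - 1)" unfolding inv by simp
    finally show up: "\<delta> j \<le> \<rho> / 2 * real j powr (\<gamma> - 1)" .
    have "1 / (2 * real (Nj j)) \<le> 1 / (2 * 1)" using N0 by (intro divide_left_mono) auto
    then show "\<delta> j \<le> 1 / 2" using up0 by simp
    have "real j powr \<gamma> \<le> ((\<theta> / (2 * \<rho>)) powr (1 / \<gamma>)) powr \<gamma>"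
      using jr gamma \<theta> \<rho> by (intro powr_mono2') auto
    also have "\<dots> = \<theta> / (2 * \<rho>)" using gamma \<theta> \<rho> by (simp add: powr_powr)
    finally have "\<rho> / 2 * real j powr \<gamma> \<le> \<theta> / 4" using \<rho> by (simp add: field_simps)
    moreover have "real j powr (\<gamma> - 1) = real j powr \<gamma> / real j" using jr by (simp add: powr_diff)
    ultimately have "\<rho> / 2 * real j powr (\<gamma> - 1) \<le> \<theta> / 4 / real j"
      using divide_right_mono[of "\<rho> / 2 * real j powr \<gamma>" "\<theta> / 4" "real j"] by simp
    then show "\<delta> j \<le> \<theta> / (4 * real j)" using up by simp
  qed
  define \<sigma> :: int where "\<sigma> = (if 0 < t0 then 1 else -1)"
  have \<sigma>: "\<bar>\<sigma>\<bar> = 1" by (simp add: \<sigma>_def)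
  obtain j x where j: "j0 \<le> j" "0 < j" and xy: "x \<in> E'" "x + \<delta> j \<in> E'"
    and visit: "orbit_pt \<alpha> x (\<sigma> * int j) < \<theta> / real j"
    by (rule ex_pair_near_singularity[OF badly \<sigma> E'm, of \<theta> j0 \<delta>])
      (use \<theta> size in \<open>auto intro: less_imp_le\<close>)
  define d where "d = \<delta> j"
  define y where "y = x + d"
  note dsize = size[OF j(1), folded d_def]
  have jr: "1 \<le> real j" using j by simp
  have xr: "x \<in> regular" and yr: "y \<in> regular" using E'r xy by (auto simp: y_def d_def)
  have xyZ: "(x, s) \<in> Z" "(y, s) \<in> Z" using EZ xy by (auto simp: E'_def y_def d_def)
  have x01: "x \<in> {0..<1}" "y \<in> {0..<1}" using xr yr by (auto simp: regular_def)
  have offs: "c1 / \<bar>real_of_int k\<bar> \<le> int_dist (x - y + of_int k * \<alpha>)" if "k \<noteq> 0" for k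
  proof -
    have "c1 / \<bar>real_of_int (- k)\<bar> \<le> int_dist (d + of_int (- k) * \<alpha>)"
      unfolding d_def by (rule \<delta>(3)[OF size(1)[OF j(1)]]) (use that in simp)
    also have "d + of_int (- k) * \<alpha> = - (x - y + of_int k * \<alpha>)" by (simp add: y_def)
    finally show ?thesis unfolding int_dist_minus by simp
  qed
  have xmy: "int_dist (x - y) = d" using dsize by (simp add: y_def int_dist_small)
  have "flow_dist circle_dist (x, s) (y, s) < \<delta>0"
  proof -
    have "\<theta> / (4 * real j) < \<theta> / real j" using \<theta> jr by (simp add: field_simps)
    also have "\<theta> / real j \<le> \<delta>0"
    proof -
      have "\<theta> / \<delta>0 \<le> real j" using j0(4) j(1) by linarith
      then show ?thesis using \<delta>0 jr by (simp add: field_simps)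
    qed
    finally show ?thesis using dsize xmy by (simp add: flow_dist_def circle_dist_eq)
  qed
  moreover have "(x, s) \<notin> range (\<lambda>t. ?T t (y, s))"
  proof
    assume "(x, s) \<in> range (\<lambda>t. ?T t (y, s))"
    then obtain t where "(x, s) = ?T t (y, s)" by blast
    then have "x = orbit_pt \<alpha> y (idx (t + s) y)" by (simp add: special_flow_eq[OF yr])
    then obtain m where m: "x = orbit_pt \<alpha> y m" by blast
    have "int_dist (x - y + of_int (- m) * \<alpha>) = int_dist (of_int (- \<lfloor>y + of_int m * \<alpha>\<rfloor>))"
      by (subst m) (simp add: frac_def)
    also have "\<dots> = 0" using int_dist_le[of "of_int (- \<lfloor>y + of_int m * \<alpha>\<rfloor>)" "- \<lfloor>y + of_int m * \<alpha>\<rfloor>"]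
        int_dist_nonneg[of "of_int (- \<lfloor>y + of_int m * \<alpha>\<rfloor>)"] by simp
    finally have 0: "int_dist (x - y + of_int (- m) * \<alpha>) = 0" .
    show False
    proof (cases "m = 0")
      case True then show ?thesis using 0 xmy dsize by simp
    next
      case False
      have "0 < c1 / \<bar>real_of_int (- m)\<bar>" using c1 False by simp
      then show ?thesis using offs[of "- m"] 0 False by simp
    qed
  qed
  ultimately obtain K L :: nat and p where p: "p \<in> P" and K: "N < K" and L: "N < L" and KL: "\<kappa> \<le> real L / real K"
    and dense: "1 - \<epsilon> < real (card {n \<in> {K..K + L}. flow_dist circle_dist (?T (real n * t0) (x, s))
        (?T (real n * t0 + p) (y, s)) < \<epsilon>}) / real L"
    using pairs[OF xyZ] by blast
  have LN: "real N \<le> real L" "0 < real L" using L N by auto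
  have KL': "real K + real L \<le> (1 / \<kappa> + 1) * real L"
  proof -
    have "real K \<le> real L / \<kappa>" using KL \<kappa> K by (simp add: field_simps)
    then show ?thesis by (simp add: algebra_simps)
  qed
  have idx_le: "\<bar>of_int (idx (real n * t0 + s) x)\<bar> \<le> D * real L"
    "\<bar>of_int (idx (real n * t0 + p + s) y)\<bar> \<le> D * real L" if n: "n \<in> {K..K+L}" for n
  proof -
    have "\<bar>real n * t0\<bar> \<le> (real K + real L) * \<bar>t0\<bar>" unfolding abs_mult using n by (intro mult_right_mono) auto
    also have "\<dots> \<le> (1 / \<kappa> + 1) * real L * \<bar>t0\<bar>" using KL' by (intro mult_right_mono) auto
    finally have 1: "\<bar>real n * t0\<bar> + real L \<le> D * real L" by (simp add: D_def algebra_simps)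
    have "CP + 2 \<le> real L" using N LN by linarith
    moreover have "\<bar>p\<bar> \<le> CP" by (rule cP(4)[OF p])
    ultimately have "\<bar>real n * t0 + s\<bar> + 1 \<le> D * real L" "\<bar>real n * t0 + p + s\<bar> + 1 \<le> D * real L"
      using 1 s cP(2) by linarith+
    then show "\<bar>of_int (idx (real n * t0 + s) x)\<bar> \<le> D * real L"
      "\<bar>of_int (idx (real n * t0 + p + s) y)\<bar> \<le> D * real L"
      using idx_abs_le[OF xr, of "real n * t0 + s"] idx_abs_le[OF yr, of "real n * t0 + p + s"] by linarith+
  qed
  have low: "f (orbit_pt \<alpha> x (idx (real n * t0 + s) x)) \<le> \<tau> * real L" if n: "n \<in> {K..K+L}" for n
  proof -
    let ?m = "idx (real n * t0 + s) x"
    define w where "w = \<tau> / (2 * (D + 1)) * (\<bar>real_of_int ?m\<bar> + real m1)"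
    have Dp: "0 < 2 * (D + 1)" using D by simp
    have w1: "w \<le> \<tau> / 2 * real L"
    proof -
      have "real m1 \<le> real L" using N LN by linarith
      then have "\<bar>real_of_int ?m\<bar> + real m1 \<le> (D + 1) * real L" using idx_le(1)[OF n] by (simp add: algebra_simps)
      then have "w \<le> \<tau> / (2 * (D + 1)) * ((D + 1) * real L)" unfolding w_def using \<tau> Dp by (intro mult_left_mono) auto
      also have "\<dots> = \<tau> / 2 * real L"
      proof -
        have "a / (2 * b) * (b * l) = a / 2 * l" if "b \<noteq> 0" for a b l :: real using that by simp
        from this[of "D + 1" \<tau> "real L"] show ?thesis using D by linarith
      qed
      finally show ?thesis .
    qed
    have "orbit_pt \<alpha> x ?m powr \<gamma> \<le> \<tau> / 2 * real L"
    proof -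
      have w0: "0 < w" using \<tau> Dp D m1 unfolding w_def by (intro mult_pos_pos divide_pos_pos add_nonneg_pos) auto
      have "w powr (1 / \<gamma>) \<le> orbit_pt \<alpha> x ?m"
        unfolding w_def using xy(1) x01(1) by (intro Vm) (auto simp: E'_def)
      then have "orbit_pt \<alpha> x ?m powr \<gamma> \<le> (w powr (1 / \<gamma>)) powr \<gamma>"
        using w0 gamma by (intro powr_mono2') auto
      also have "\<dots> = w" using w0 gamma by (simp add: powr_powr)
      finally show ?thesis using w1 by linarith
    qed
    moreover have "r \<le> \<tau> / 2 * real L"
    proof -
      have "2 * r / \<tau> \<le> real L" using N LN by linarith
      then show ?thesis using \<tau> by (simp add: field_simps)
    qed
    ultimately show ?thesis by (simp add: f_orbit[OF xr])
  qed
  have gaps: "0 < gap x y s p (real n * t0) \<and> gap x y s p (real n * t0) powr (- 1 / (1 - \<gamma>)) \<le> \<omega> * real L"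
    if n: "n \<in> {K..K+L}" and cl: "close \<epsilon> x y s p (real n * t0)" for n
  proof -
    define m where "m = idx (real n * t0 + s) x"
    define m' where "m' = idx (real n * t0 + p + s) y"
    define k where "k = m - m'"
    have g: "gap x y s p (real n * t0) = int_dist (x - y + of_int k * \<alpha>)"
      by (simp add: gap_def shift_def k_def m_def m'_def)
    show ?thesis
    proof (cases "k = 0")
      case False
      have kD: "\<bar>real_of_int k\<bar> \<le> 2 * D * real L"
        using idx_le[OF n] unfolding k_def m_def m'_def by linarith
      have k1: "1 \<le> \<bar>real_of_int k\<bar>" using False by linarith
      have lower: "c1 / (2 * D * real L) \<le> gap x y s p (real n * t0)"
      proof -
        have "c1 / (2 * D * real L) \<le> c1 / \<bar>real_of_int k\<bar>"
          using kD k1 c1 D LN by (intro divide_left_mono mult_pos_pos) auto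
        then show ?thesis unfolding g using offs[OF False] by linarith
      qed
      have lp: "0 < c1 / (2 * D * real L)" using c1 D LN by (intro divide_pos_pos mult_pos_pos) auto
      have "gap x y s p (real n * t0) powr (- \<beta>) \<le> (c1 / (2 * D * real L)) powr (- \<beta>)"
        using lower lp \<beta> by (intro powr_mono2') auto
      also have "\<dots> = (2 * D / c1 * real L) powr \<beta>"
      proof -
        have "2 * D / c1 * real L = inverse (c1 / (2 * D * real L))" by simp
        then show ?thesis using lp by (simp only: inverse_powr powr_minus less_imp_le)
      qed
      also have "\<dots> = (2 * D / c1) powr \<beta> * real L powr \<beta>" by (rule powr_mult)
      also have "\<dots> \<le> \<omega> * real L"
      proof -
        have "L1 powr (1 - \<beta>) \<le> real L powr (1 - \<beta>)"
          using N(5) LN \<beta> by (intro powr_mono2) (auto simp: L1_def)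
        moreover have "L1 powr (1 - \<beta>) = (2 * D / c1) powr \<beta> / \<omega>"
          using \<beta> \<omega> by (simp add: L1_def powr_powr)
        ultimately have "(2 * D / c1) powr \<beta> \<le> \<omega> * real L powr (1 - \<beta>)"
          using \<omega> by (simp add: field_simps)
        then have "(2 * D / c1) powr \<beta> * real L powr \<beta> \<le> \<omega> * real L powr (1 - \<beta>) * real L powr \<beta>"
          by (intro mult_right_mono) auto
        also have "\<dots> = \<omega> * (real L powr (1 - \<beta>) * real L powr \<beta>)" by simp
        also have "real L powr (1 - \<beta>) * real L powr \<beta> = real L" using LN by (simp flip: powr_add)
        finally show ?thesis .
      qed
      finally show ?thesis using lower lp unfolding \<beta>(3) by linarith
    next
      case True
      then have mm: "m' = m" by (simp add: k_def)
      have gd: "gap x y s p (real n * t0) = d" using g True xmy by simp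
      have "d powr (- \<beta>) \<le> \<omega> * real L"
      proof (rule ccontr)
        assume "\<not> ?thesis"
        then have short: "\<omega> * real L < d powr (- \<beta>)" by simp
        \<comment> \<open>the whole window lies before the time \<open>C2 * j\<close>, up to which the orbits are not separated\<close>
        have "d powr (- \<beta>) \<le> (\<rho>1 * real j powr (\<gamma> - 1)) powr (- \<beta>)"
          using dsize(3) \<rho>1 jr \<beta> by (intro powr_mono2') auto
        also have "\<dots> = \<rho>1 powr (- \<beta>) * (real j powr (\<gamma> - 1)) powr (- \<beta>)" by (rule powr_mult)
        also have "(real j powr (\<gamma> - 1)) powr (- \<beta>) = real j"
          using \<beta>(5) jr by (simp add: powr_powr mult.commute)
        finally have "\<omega> * real L < \<rho>1 powr (- \<beta>) * real j" using short by linarith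
        then have "real L < \<rho>1 powr (- \<beta>) * real j / \<omega>" using \<omega> by (simp add: field_simps)
        then have "D * real L \<le> D * (\<rho>1 powr (- \<beta>) * real j / \<omega>)" using D by (intro mult_left_mono) auto
        also have "\<dots> = (D / \<omega> * \<rho>1 powr (- \<beta>)) * real j" by simp
        also have "\<dots> \<le> C2 * real j" using C2 jr by (intro mult_right_mono) auto
        finally have mR: "\<bar>real_of_int m\<bar> \<le> C2 * real j" using idx_le(1)[OF n] unfolding m_def by linarith
        let ?J = "\<sigma> * int j"
        have oJ: "orbit_pt \<alpha> x ?J + d \<le> 2 * \<theta> / real j" "0 < orbit_pt \<alpha> x ?J + d"
        proof -
          have "\<theta> / (4 * real j) \<le> \<theta> / real j" using \<theta> jr by (intro divide_left_mono) auto
          then show "orbit_pt \<alpha> x ?J + d \<le> 2 * \<theta> / real j" using visit dsize(6) by linarith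
          show "0 < orbit_pt \<alpha> x ?J + d" using regular_orbit[OF xr, of ?J] dsize(2) by linarith
        qed
        have "\<bar>F m x - F m (x + d)\<bar> \<le> d * Zc * (c / (2 * real j)) powr (\<gamma> - 1) \<or>
          - \<gamma> * d * (orbit_pt \<alpha> x ?J + d) powr (\<gamma> - 1) \<le> \<bar>F m x - F m (x + d)\<bar>"
          unfolding Zc_def
        proof (rule drift_jump[OF xr yr[unfolded y_def] dsize(2), where R = "C2 * real j"])
          show "0 < real j" "real j \<le> C2 * real j" using jr C2 by auto
          show "\<bar>real_of_int ?J\<bar> = real j" by (simp add: \<sigma>_def)
          have "2 * \<theta> / real j < c / (2 * C2) / real j"
          proof (rule divide_strict_right_mono)
            have "c / (8 * C2) = c / (2 * C2) / 4" by simp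
            moreover have "0 < c / (2 * C2)" using c_pos C2 by simp
            ultimately show "2 * \<theta> < c / (2 * C2)" using \<theta>(3) by linarith
          qed (use jr in simp)
          then show "orbit_pt \<alpha> x ?J + d < c / (2 * (C2 * real j))" using oJ by simp
          have "2 * \<theta> / real j \<le> 2 * \<theta> / 1" using \<theta> jr by (intro divide_left_mono) auto
          then show "orbit_pt \<alpha> x ?J + d < 1" using oJ \<theta>(2) by linarith
          show "\<bar>real_of_int m\<bar> \<le> C2 * real j" by (rule mR)
          show "0 \<le> ?J * m"
          proof (cases "0 < t0")
            case True
            then have "0 \<le> real n * t0 + s" using s by simp
            then have "0 \<le> m" using idx_diff(1)[OF xr, of 0 "real n * t0 + s"] idx_0[OF xr] by (simp add: m_def)
            then show ?thesis using True by (simp add: \<sigma>_def)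
          next
            case False
            have "2 / \<bar>t0\<bar> \<le> real n" using N(6) n K by auto
            then have "2 \<le> real n * \<bar>t0\<bar>" using t0 by (simp add: field_simps)
            then have "real n * t0 + s \<le> 0" using False s by simp
            then have "m \<le> 0" using idx_diff(1)[OF xr, of "real n * t0 + s" 0] idx_0[OF xr] by (simp add: m_def)
            then show ?thesis using False by (simp add: \<sigma>_def mult_nonneg_nonpos)
          qed
        qed
        moreover have "d * Zc * (c / (2 * real j)) powr (\<gamma> - 1) \<le> cP / 2"
        proof -
          have e: "(c / (2 * real j)) powr (\<gamma> - 1) = (c / 2) powr (\<gamma> - 1) * real j powr (1 - \<gamma>)"
          proof -
            have "c / (2 * real j) = (c / 2) / real j" by simp
            then have "(c / (2 * real j)) powr (\<gamma> - 1) = (c / 2) powr (\<gamma> - 1) / real j powr (\<gamma> - 1)"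
              using c_pos jr by (simp only: powr_divide)
            also have "\<dots> = (c / 2) powr (\<gamma> - 1) * real j powr (1 - \<gamma>)"
              using powr_minus_divide[of "real j" "\<gamma> - 1"] by simp
            finally show ?thesis .
          qed
          have "d * Zc * (c / (2 * real j)) powr (\<gamma> - 1)
              \<le> (\<rho> / 2 * real j powr (\<gamma> - 1)) * (Zc + 1) * ((c / 2) powr (\<gamma> - 1) * real j powr (1 - \<gamma>))"
            unfolding e using dsize Zc by (intro mult_right_mono mult_mono) auto
          also have "\<dots> = (\<rho> * ((Zc + 1) * (c / 2) powr (\<gamma> - 1))) / 2 * (real j powr (\<gamma> - 1) * real j powr (1 - \<gamma>))"
            by simp
          also have "real j powr (\<gamma> - 1) * real j powr (1 - \<gamma>) = 1" using jr by (simp flip: powr_add)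
          also have "\<rho> * ((Zc + 1) * (c / 2) powr (\<gamma> - 1)) = cP"
          proof -
            have "(Zc + 1) * (c / 2) powr (\<gamma> - 1) \<noteq> 0" using Zc c_pos by simp
            then show ?thesis unfolding \<rho>_def by simp
          qed
          finally show ?thesis by simp
        qed
        moreover have "2 * CP + 1 \<le> - \<gamma> * d * (orbit_pt \<alpha> x ?J + d) powr (\<gamma> - 1)"
        proof -
          have "Y = (Y powr (- \<beta>)) powr (\<gamma> - 1)" using \<beta>(5) Y by (simp add: powr_powr)
          also have "\<dots> \<le> (2 * \<theta>) powr (\<gamma> - 1)" using \<theta> gamma by (intro powr_mono2') auto
          finally have Y1: "Y \<le> (2 * \<theta>) powr (\<gamma> - 1)" .
          have "(2 * \<theta> / real j) powr (\<gamma> - 1) = (2 * \<theta>) powr (\<gamma> - 1) / real j powr (\<gamma> - 1)"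
            by (rule powr_divide)
          then have "Y / real j powr (\<gamma> - 1) \<le> (2 * \<theta> / real j) powr (\<gamma> - 1)"
            using Y1 by (simp add: divide_right_mono)
          also have "\<dots> \<le> (orbit_pt \<alpha> x ?J + d) powr (\<gamma> - 1)"
            using oJ gamma by (intro powr_mono2') auto
          finally have "Y / real j powr (\<gamma> - 1) \<le> (orbit_pt \<alpha> x ?J + d) powr (\<gamma> - 1)" .
          then have "(- \<gamma> * (\<rho>1 * real j powr (\<gamma> - 1))) * (Y / real j powr (\<gamma> - 1))
            \<le> (- \<gamma> * d) * (orbit_pt \<alpha> x ?J + d) powr (\<gamma> - 1)"
            using dsize(2,3) gamma \<rho>1 Y by (intro mult_mono mult_left_mono) (auto intro: mult_nonpos_nonneg)
          moreover have "(- \<gamma> * (\<rho>1 * real j powr (\<gamma> - 1))) * (Y / real j powr (\<gamma> - 1)) = - \<gamma> * \<rho>1 * Y"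
            using jr by simp
          moreover have "- \<gamma> * \<rho>1 * Y = 2 * CP + 1"
          proof -
            have "- \<gamma> * \<rho>1 \<noteq> 0" using gamma \<rho>1 by simp
            moreover have "w * (v / w) = v" if "w \<noteq> 0" for v w :: real using that by simp
            ultimately show ?thesis unfolding Y_def by blast
          qed
          ultimately show ?thesis by linarith
        qed
        moreover have "\<bar>F m (x + d) - F m x - p\<bar> < \<epsilon>"
          using cl mm unfolding close_def m_def m'_def y_def by simp
        ultimately show False using cP(3)[OF p] cP(4)[OF p] \<epsilon>(4,5) cP(2) by linarith
      qed
      then show ?thesis using gd dsize(2) \<beta>(3) by simp
    qed
  qed
  have "{n \<in> {K..K + L}. flow_dist circle_dist (?T (real n * t0) (x, s)) (?T (real n * t0 + p) (y, s)) < \<epsilon>}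
      \<subseteq> {n \<in> {K..K+L}. close \<epsilon> x y s p (real n * t0)}"
    using flow_dist_less_imp_close[OF xr yr] by blast
  then have "card {n \<in> {K..K + L}. flow_dist circle_dist (?T (real n * t0) (x, s)) (?T (real n * t0 + p) (y, s)) < \<epsilon>}
      \<le> card {n \<in> {K..K+L}. close \<epsilon> x y s p (real n * t0)}"
    by (intro card_mono) auto
  also have "real \<dots> \<le> real L / 2"
    using LN by (intro few[OF \<epsilon>(2) xr yr _ low gaps]) auto
  finally have "real (card {n \<in> {K..K + L}. flow_dist circle_dist (?T (real n * t0) (x, s))
      (?T (real n * t0 + p) (y, s)) < \<epsilon>}) / real L \<le> 1 / 2"
    using LN by (simp add: field_simps)
  then show False using dense \<epsilon>(2) \<epsilon>0(2) by linarith
qed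

end

theorem theorem1:
  fixes \<alpha> \<gamma> r :: real and f :: "real \<Rightarrow> real"
  assumes "\<alpha> \<in> {0..<1}" and "\<alpha> \<notin> \<rat>" and "bounded_partial_quotients \<alpha>"
    and "-1 < \<gamma>" and "\<gamma> < 0" and "r > 0"
    and "\<And>x. x \<in> {0<..<1} \<Longrightarrow> f x = x powr \<gamma> + r"
    and "f 0 > 0"
  shows "\<not> WR_property (flow_measure circle f) (flow_dist circle_dist)
           (special_flow circle (rotation \<alpha>) f)"
proof
  obtain c where c: "badly_approximable c \<alpha>"
    using bounded_partial_quotients_imp_badly_approximable assms(1-3) by blast
  interpret power_ceiling \<alpha> \<gamma> r c f
    using assms c by unfold_locales auto
  assume "WR_property (flow_measure circle f) (flow_dist circle_dist) (special_flow circle (rotation \<alpha>) f)"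
  then obtain P where P: "compact P" "0 \<notin> P"
    and unc: "uncountable {t0. R_property (flow_measure circle f) (flow_dist circle_dist)
      (special_flow circle (rotation \<alpha>) f) t0 P}"
    unfolding WR_property_def by blast
  have "{t0. R_property (flow_measure circle f) (flow_dist circle_dist)
      (special_flow circle (rotation \<alpha>) f) t0 P} \<subseteq> {0}"
    using not_R_property[OF assms(8) _ P] by blast
  then show False using unc countable_subset by blast
qed

end
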